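(* In the setting of the context, let $\widetilde u$ be the solution of the linear SPDE $d\widetilde u=\Delta\widetilde w\,dt+d\widetilde W$, $\widetilde w=-\varepsilon\Delta\widetilde u$ in $(0,T)\times\mathcal D$, with $\partial_{\vec n}\widetilde u=\partial_{\vec n}\widetilde w=0$ on $\partial\mathcal D$ and $\widetilde u(0)=0$. Then for any $p\ge2$, $$\mathbb E\Big[\sup_{t\in[0,T]}\|\widetilde u(t)\|_{\mathbb L^p}^p\Big]\le C\,\tilde h^{-\frac{3pd}2}\,\varepsilon^{-\frac p2}.$$
   Context: $d\in\{1,2,3\}$, $\mathcal D=(0,1)^d$, $T>0$, $0<\varepsilon<1$; $\mathbb L^p=L^p(\mathcal D)$; $m(v)=|\mathcal D|^{-1}\int_{\mathcal D}v\,dx$; $(\cdot,\cdot)$ is the $L^2(\mathcal D)$ inner product. $\mathcal T_{\tilde h}$ is a quasi-uniform partition of $\mathcal D$ into simplices of mesh size $\tilde h$, $\mathbb V_{\tilde h}$ the continuous piecewise affine functions on it, $\phi_1,\dots,\phi_L$ its nodal basis, $\beta_1,\dots,\beta_L$ independent standard real Brownian motions, and $\widetilde W(t)=\sum_{\ell=1}^L\frac{\phi_\ell-m(\phi_\ell)}{\sqrt{(d+1)^{-1}|(\phi_\ell,1)|}}\beta_\ell(t)$. The solution is $\widetilde u(t)=\int_0^te^{-\varepsilon\Delta^2(t-s)}d\widetilde W(s)$, with $\Delta$ the Neumann Laplacian. $C$ is a constant independent of $\varepsilon$ and $\tilde h$ (it may depend on $p,T,d$ and mesh regularity constants). *)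

theory Defs
  imports "HOL-Probability.Probability"
begin

section \<open>Lebesgue spaces on the open unit cube\<close>

text \<open>Elements of the Lebesgue spaces are represented by functions on \<open>\<real>\<^sup>d\<close> of which only the
  restriction to \<open>(0,1)\<^sup>d\<close>, up to null sets, matters.\<close>

abbreviation cubeM :: "(real^'d::finite) measure"
  where "cubeM \<equiv> restrict_space lborel (box 0 1)"

text \<open>\<open>Lp_pow p v\<close> is the \<open>p\<close>-th power of the \<open>L\<^sup>p\<close> norm of \<open>v\<close>, possibly infinite.\<close>

definition Lp_pow :: "real \<Rightarrow> (real^'d::finite \<Rightarrow> real) \<Rightarrow> ennreal"
  where "Lp_pow p v = (\<integral>\<^sup>+x. ennreal (\<bar>v x\<bar> powr p) \<partial>cubeM)"

definition L2 :: "(real^'d::finite \<Rightarrow> real) set"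
  where "L2 = {v \<in> borel_measurable cubeM. Lp_pow 2 v < \<infinity>}"

definition L2_inner :: "(real^'d::finite \<Rightarrow> real) \<Rightarrow> (real^'d \<Rightarrow> real) \<Rightarrow> real"
  where "L2_inner v w = (\<integral>x. v x * w x \<partial>cubeM)"

definition mean :: "(real^'d::finite \<Rightarrow> real) \<Rightarrow> real"
  where "mean v = (\<integral>x. v x \<partial>cubeM) / measure lborel (box 0 1 :: (real^'d) set)"

definition L2_continuous_on :: "real set \<Rightarrow> (real \<Rightarrow> real^'d::finite \<Rightarrow> real) \<Rightarrow> bool"
  where "L2_continuous_on S y \<longleftrightarrow>
    (\<forall>t\<in>S. y t \<in> L2 \<and> ((\<lambda>s. Lp_pow 2 (\<lambda>x. y s x - y t x)) \<longlongrightarrow> 0) (at t within S))"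


section \<open>The Neumann Laplacian and the semigroup generated by \<open>- \<epsilon> \<Delta>\<^sup>2\<close>\<close>

text \<open>\<open>weak_gradient v G\<close>: \<open>v\<close> belongs to \<open>H\<^sup>1\<close> and \<open>G\<close> is its distributional gradient,
  tested against continuously differentiable functions with compact support in the open cube.\<close>

definition weak_gradient :: "(real^'d::finite \<Rightarrow> real) \<Rightarrow> (real^'d \<Rightarrow> real^'d) \<Rightarrow> bool"
  where "weak_gradient v G \<longleftrightarrow>
    v \<in> L2 \<and> (\<forall>i. (\<lambda>x. G x $ i) \<in> L2) \<and>
    (\<forall>\<psi> D\<psi>. (\<forall>x. GDERIV \<psi> x :> D\<psi> x) \<and> continuous_on UNIV D\<psi> \<and>
        compact (closure {x. \<psi> x \<noteq> 0}) \<and> closure {x. \<psi> x \<noteq> 0} \<subseteq> box 0 1 \<longrightarrow>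
        (\<integral>x. v x *\<^sub>R D\<psi> x \<partial>cubeM) = - (\<integral>x. \<psi> x *\<^sub>R G x \<partial>cubeM))"

text \<open>\<open>neumann_laplacian v f\<close>: \<open>v\<close> is in the domain of the \<open>L\<^sup>2\<close> realisation of the Laplacian with
  homogeneous Neumann boundary conditions, and \<open>\<Delta> v = f\<close>.  As usual the boundary condition is
  natural, that is, encoded by admitting all of \<open>H\<^sup>1\<close> as test functions.\<close>

definition neumann_laplacian :: "(real^'d::finite \<Rightarrow> real) \<Rightarrow> (real^'d \<Rightarrow> real) \<Rightarrow> bool"
  where "neumann_laplacian v f \<longleftrightarrow>
    f \<in> L2 \<and>
    (\<exists>G. weak_gradient v G \<and>
      (\<forall>w H. weak_gradient w H \<longrightarrow> (\<integral>x. G x \<bullet> H x \<partial>cubeM) = - L2_inner f w))"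

definition neumann_eigenbasis :: "(nat \<Rightarrow> real^'d::finite \<Rightarrow> real) \<Rightarrow> (nat \<Rightarrow> real) \<Rightarrow> bool"
  where "neumann_eigenbasis e lam \<longleftrightarrow>
    (\<forall>k. e k \<in> L2 \<and> neumann_laplacian (e k) (\<lambda>x. - lam k * e k x)) \<and>
    (\<forall>j k. L2_inner (e j) (e k) = (if j = k then 1 else 0)) \<and>
    (\<forall>v\<in>L2. (\<forall>k. L2_inner v (e k) = 0) \<longrightarrow> (AE x in cubeM. v x = 0))"

text \<open>\<open>exp_bilaplacian \<epsilon> t v w\<close> means \<open>w = exp (- \<epsilon> t \<Delta>\<^sup>2) v\<close>.  The exponential
  is the spectral functional calculus of the Neumann Laplacian: with an orthonormal basis \<open>e\<close> of
  eigenfunctions, \<open>- \<Delta> e\<^sub>k = lam\<^sub>k e\<^sub>k\<close>, it is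
  the \<open>L\<^sup>2\<close>-convergent series \<open>\<Sum>\<^sub>k exp (- \<epsilon> lam\<^sub>k\<^sup>2 t) (v, e\<^sub>k) e\<^sub>k\<close>, whose value does not depend
  on the choice of the basis.\<close>

definition exp_bilaplacian ::
    "real \<Rightarrow> real \<Rightarrow> (real^'d::finite \<Rightarrow> real) \<Rightarrow> (real^'d \<Rightarrow> real) \<Rightarrow> bool"
  where "exp_bilaplacian \<epsilon> t v w \<longleftrightarrow>
    v \<in> L2 \<and> w \<in> L2 \<and>
    (\<exists>e lam. neumann_eigenbasis e lam \<and>
      (\<lambda>n. Lp_pow 2 (\<lambda>x. w x - (\<Sum>k<n. exp (- \<epsilon> * (lam k)\<^sup>2 * t) * L2_inner v (e k) * e k x)))
        \<longlonglongrightarrow> 0)"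


section \<open>Simplicial meshes and piecewise affine finite elements\<close>

definition mesh_size :: "(real^'d::finite) set set \<Rightarrow> real"
  where "mesh_size \<T> = Max (diameter ` \<T>)"

text \<open>The diameter of the largest ball contained in \<open>K\<close>.\<close>

definition in_diameter :: "(real^'d::finite) set \<Rightarrow> real"
  where "in_diameter K = Sup {2 * r |r. r \<ge> 0 \<and> (\<exists>x. cball x r \<subseteq> K)}"

text \<open>Conforming partition into closed nondegenerate simplices that is shape regular and whose
  elements have comparable sizes, both quantified by the constant \<open>\<kappa>\<close>.\<close>

definition quasi_uniform_mesh :: "real \<Rightarrow> (real^'d::finite) set set \<Rightarrow> bool"
  where "quasi_uniform_mesh \<kappa> \<T> \<longleftrightarrow>
    triangulation \<T> \<and> (\<forall>K\<in>\<T>. int CARD('d) simplex K) \<and> \<Union>\<T> = cbox 0 1 \<and>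
    (\<forall>K\<in>\<T>. diameter K \<le> \<kappa> * in_diameter K \<and> mesh_size \<T> \<le> \<kappa> * diameter K)"

definition nodes :: "(real^'d::finite) set set \<Rightarrow> (real^'d) set"
  where "nodes \<T> = {z. \<exists>K\<in>\<T>. z extreme_point_of K}"

definition fe_space :: "(real^'d::finite) set set \<Rightarrow> (real^'d \<Rightarrow> real) set"
  where "fe_space \<T> = {v. continuous_on (cbox 0 1) v \<and>
    (\<forall>K\<in>\<T>. \<exists>a b. \<forall>x\<in>K. v x = a \<bullet> x + b)}"

text \<open>The nodal basis is indexed by the nodes themselves instead of \<open>1, \<dots>, L\<close>.\<close>

definition nodal_basis ::
    "(real^'d::finite) set set \<Rightarrow> (real^'d \<Rightarrow> real^'d \<Rightarrow> real) \<Rightarrow> bool"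
  where "nodal_basis \<T> \<phi> \<longleftrightarrow>
    (\<forall>z\<in>nodes \<T>. \<phi> z \<in> fe_space \<T> \<and>
      (\<forall>z'\<in>nodes \<T>. \<phi> z z' = (if z = z' then 1 else 0)))"


section \<open>Brownian motions and Wiener integrals\<close>

definition brownian_motion :: "'w measure \<Rightarrow> (real \<Rightarrow> 'w \<Rightarrow> real) \<Rightarrow> bool"
  where "brownian_motion M B \<longleftrightarrow>
    (\<forall>t\<ge>0. B t \<in> borel_measurable M) \<and>
    (AE \<omega> in M. B 0 \<omega> = 0) \<and>
    (\<forall>s t. 0 \<le> s \<and> s < t \<longrightarrow>
      distributed M lborel (\<lambda>\<omega>. B t \<omega> - B s \<omega>) (\<lambda>x. ennreal (normal_density 0 (sqrt (t - s)) x))) \<and>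
    (\<forall>n \<tau>. 0 \<le> \<tau> 0 \<and> (\<forall>i<n. \<tau> i \<le> \<tau> (Suc i)) \<longrightarrow>
      prob_space.indep_vars M (\<lambda>_. borel) (\<lambda>i \<omega>. B (\<tau> (Suc i)) \<omega> - B (\<tau> i) \<omega>) {..<n::nat}) \<and>
    (AE \<omega> in M. continuous_on {0..} (\<lambda>t. B t \<omega>))"

text \<open>Independence of the family is independence of the whole processes, as random elements of
  the product space \<open>\<real>\<^bsup>[0,\<infinity>)\<^esup>\<close>.\<close>

definition independent_brownian_motions ::
    "'w measure \<Rightarrow> 'i set \<Rightarrow> ('i \<Rightarrow> real \<Rightarrow> 'w \<Rightarrow> real) \<Rightarrow> bool"
  where "independent_brownian_motions M J \<beta> \<longleftrightarrow>
    (\<forall>j\<in>J. brownian_motion M (\<beta> j)) \<and>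
    prob_space.indep_vars M (\<lambda>_. PiM {0..} (\<lambda>_. borel)) (\<lambda>j \<omega>. \<lambda>t\<in>{0..}. \<beta> j t \<omega>) J"

definition step_integrand ::
    "nat \<Rightarrow> (nat \<Rightarrow> real) \<Rightarrow> (nat \<Rightarrow> real^'d::finite \<Rightarrow> real) \<Rightarrow> real \<Rightarrow> real^'d \<Rightarrow> real"
  where "step_integrand N \<tau> \<psi> s x = (\<Sum>i<N. indicator {\<tau> i<..\<tau> (Suc i)} s * \<psi> i x)"

definition step_integral ::
    "(real \<Rightarrow> 'w \<Rightarrow> real) \<Rightarrow> nat \<Rightarrow> (nat \<Rightarrow> real) \<Rightarrow> (nat \<Rightarrow> real^'d::finite \<Rightarrow> real) \<Rightarrow> 'w \<Rightarrow> real^'d \<Rightarrow> real"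
  where "step_integral B N \<tau> \<psi> \<omega> x = (\<Sum>i<N. (B (\<tau> (Suc i)) \<omega> - B (\<tau> i) \<omega>) * \<psi> i x)"

text \<open>\<open>wiener_integral M B a b \<Phi> X\<close>: \<open>X\<close> is (a jointly measurable representative of) the stochastic
  integral of the deterministic \<open>L\<^sup>2\<close>-valued integrand \<open>\<Phi>\<close> over \<open>[a,b]\<close>, that is, the limit in
  \<open>L\<^sup>2(\<Omega>; L\<^sup>2)\<close> of the integrals of step functions that approximate \<open>\<Phi>\<close> in \<open>L\<^sup>2(a,b; L\<^sup>2)\<close>.\<close>

definition wiener_integral ::
    "'w measure \<Rightarrow> (real \<Rightarrow> 'w \<Rightarrow> real) \<Rightarrow> real \<Rightarrow> real \<Rightarrow>
      (real \<Rightarrow> real^'d::finite \<Rightarrow> real) \<Rightarrow> ('w \<Rightarrow> real^'d \<Rightarrow> real) \<Rightarrow> bool"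
  where "wiener_integral M B a b \<Phi> X \<longleftrightarrow>
    (\<lambda>(\<omega>, x). X \<omega> x) \<in> borel_measurable (M \<Otimes>\<^sub>M cubeM) \<and>
    (\<exists>N \<tau> \<psi>.
      (\<forall>n. \<tau> n 0 = a \<and> \<tau> n (N n) = b \<and> (\<forall>i<N n. \<tau> n i \<le> \<tau> n (Suc i) \<and> \<psi> n i \<in> L2)) \<and>
      (\<lambda>n. \<integral>\<^sup>+s\<in>{a..b}. Lp_pow 2 (\<lambda>x. step_integrand (N n) (\<tau> n) (\<psi> n) s x - \<Phi> s x) \<partial>lborel)
        \<longlonglongrightarrow> 0 \<and>
      (\<lambda>n. \<integral>\<^sup>+\<omega>. Lp_pow 2 (\<lambda>x. step_integral B (N n) (\<tau> n) (\<psi> n) \<omega> x - X \<omega> x) \<partial>M)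
        \<longlonglongrightarrow> 0)"


section \<open>The noise and the linear equation\<close>

definition noise_coeff ::
    "(real^'d::finite \<Rightarrow> real^'d \<Rightarrow> real) \<Rightarrow> real^'d \<Rightarrow> real^'d \<Rightarrow> real"
  where "noise_coeff \<phi> z x =
    (\<phi> z x - mean (\<phi> z)) / sqrt (inverse (real CARD('d) + 1) * \<bar>L2_inner (\<phi> z) (\<lambda>_. 1)\<bar>)"

text \<open>With \<open>W(t) = \<Sum>\<^sub>z noise_coeff \<phi> z \<beta>\<^sub>z(t)\<close>, summed over the nodes \<open>z\<close>, the mild solution of
  \<open>du = - \<epsilon> \<Delta>\<^sup>2 u dt + dW\<close>, \<open>u(0) = 0\<close>, is the stochastic convolution
  \<open>u(t) = \<integral>\<^sub>0\<^sup>t S(t - s) dW(s) = \<Sum>\<^sub>z \<integral>\<^sub>0\<^sup>t S(t - s) (noise_coeff \<phi> z) d\<beta>\<^sub>z(s)\<close>, where \<open>S\<close> is the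
  semigroup generated by \<open>- \<epsilon> \<Delta>\<^sup>2\<close>.  It is determined up to modification, so the version with
  \<open>L\<^sup>2\<close>-continuous paths is taken.\<close>

definition linear_spde_solution ::
    "'w measure \<Rightarrow> real \<Rightarrow> real \<Rightarrow> (real^'d::finite) set set \<Rightarrow> (real^'d \<Rightarrow> real^'d \<Rightarrow> real) \<Rightarrow>
      (real^'d \<Rightarrow> real \<Rightarrow> 'w \<Rightarrow> real) \<Rightarrow> (real \<Rightarrow> 'w \<Rightarrow> real^'d \<Rightarrow> real) \<Rightarrow> bool"
  where "linear_spde_solution M T \<epsilon> \<T> \<phi> \<beta> u \<longleftrightarrow>
    (\<forall>t\<in>{0..T}. (\<lambda>(\<omega>, x). u t \<omega> x) \<in> borel_measurable (M \<Otimes>\<^sub>M cubeM)) \<and>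
    (AE \<omega> in M. L2_continuous_on {0..T} (\<lambda>t. u t \<omega>)) \<and>
    (\<forall>t\<in>{0..T}. \<exists>\<Phi> I.
      (\<forall>z\<in>nodes \<T>.
        (\<forall>s\<in>{0..t}. exp_bilaplacian \<epsilon> (t - s) (noise_coeff \<phi> z) (\<Phi> z s)) \<and>
        wiener_integral M (\<beta> z) 0 t (\<Phi> z) (I z)) \<and>
      (AE \<omega> in M. AE x in cubeM. u t \<omega> x = (\<Sum>z\<in>nodes \<T>. I z \<omega> x)))"

end

theory Submission
  imports Defs
begin

text \<open>
  Why the estimate holds.  The Neumann Laplacian on the unit cube is diagonalized by products of cosines,
  and all of these are bounded by the same constant.  Expanded in this basis, the contribution of one
  node \<open>z\<close> to the solution is \<open>\<Sum>\<^sub>m (g\<^sub>z, c\<^sub>m) X\<^sub>m(t) c\<^sub>m\<close>, where \<open>g\<^sub>z\<close> is the noise coefficient and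
  \<open>X\<^sub>m(t) = \<integral>\<^sub>0\<^sup>t exp (- \<epsilon> lam\<^sub>m\<^sup>2 (t - s)) d\<beta>\<^sub>z(s)\<close> is a scalar Ornstein--Uhlenbeck process.  Integrating
  by parts in time bounds it path by path: if \<open>H\<^sub>z\<close> is a Hoelder constant of \<open>\<beta>\<^sub>z\<close> on \<open>[0,T]\<close> for the exponent
  \<open>7/16\<close>, then \<open>|X\<^sub>m(t)| \<le> const * H\<^sub>z (\<epsilon> lam\<^sub>m\<^sup>2)\<^sup>-\<^sup>7\<^sup>/\<^sup>1\<^sup>6\<close> for all \<open>t\<close> at once.  The exponent must be
  less than \<open>1/2\<close>, for Brownian paths to be Hoelder continuous, and greater than \<open>3/8\<close>, for
  \<open>\<Sum>\<^sub>m |(g\<^sub>z, c\<^sub>m)| lam\<^sub>m\<^sup>-\<^sup>7\<^sup>/\<^sup>8\<close> to converge by Cauchy--Schwarz and Bessel's inequality in dimension three.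
  The frequency zero does not occur because \<open>g\<^sub>z\<close> has mean zero.

  The contribution of \<open>z\<close> is therefore bounded, uniformly in space and time, by a constant times
  \<open>\<epsilon>\<^sup>-\<^sup>7\<^sup>/\<^sup>1\<^sup>6 \<parallel>g\<^sub>z\<parallel> H\<^sub>z\<close> (lemma \<open>convolution_sup_bound\<close>), and the \<open>p\<close>-th moment of \<open>H\<^sub>z\<close> is bounded by
  Kolmogorov's argument (\<open>brownian_dyadic_hoelder\<close>).  Shape regularity gives \<open>\<parallel>g\<^sub>z\<parallel> \<le> const * h\<^sup>-\<^sup>d\<^sup>/\<^sup>2\<close>
  (\<open>noise_coeff_L2_norm_le\<close>) and at most \<open>const * h\<^sup>-\<^sup>d\<close> nodes (\<open>card_mesh_le\<close>, \<open>card_nodes_le\<close>).  Adding up the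
  nodes yields the factor \<open>h\<^sup>-\<^sup>3\<^sup>d\<^sup>/\<^sup>2\<close>, and \<open>\<epsilon>\<^sup>-\<^sup>7\<^sup>/\<^sup>1\<^sup>6 \<le> \<epsilon>\<^sup>-\<^sup>1\<^sup>/\<^sup>2\<close>.

  Two links to the definitions need work.  The semigroup is defined through an arbitrary eigenbasis, so it
  has to be shown that it multiplies the \<open>m\<close>-th cosine coefficient by \<open>exp (- \<epsilon> lam\<^sub>m\<^sup>2 t)\<close>
  (\<open>exp_bilaplacian_cosine\<close>); this rests on completeness of the cosines and on integration by parts against
  functions with a weak gradient.  And the Wiener integral is an \<open>L\<^sup>2(\<Omega>)\<close>-limit of integrals of unspecified step
  functions; by the isometry its cosine coefficients are also limits of Riemann sums over dyadic grids,
  for which the pathwise bound is elementary (\<open>wiener_integral_coefficient_bound\<close>).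
\<close>

section \<open>The Hilbert space of square integrable functions on the cube\<close>

lemma space_cubeM: "space cubeM = box 0 1"
  by (simp add: space_restrict_space)

lemma emeasure_cubeM: "emeasure (cubeM :: (real^'d::finite) measure) (box 0 1) = 1"
proof -
  have "emeasure lborel (box 0 1 :: (real^'d) set) = (\<Prod>b\<in>Basis. (1 - 0 :: real^'d) \<bullet> b)"
    by (rule emeasure_lborel_box) (auto simp: Basis_vec_def inner_axis)
  also have "(\<Prod>b\<in>Basis. (1 - 0 :: real^'d) \<bullet> b) = 1"
    by (intro prod.neutral) (auto simp: Basis_vec_def inner_axis)
  finally show ?thesis by (simp add: emeasure_restrict_space)
qed

lemma prob_space_cubeM: "prob_space (cubeM :: (real^'d::finite) measure)"
  by (rule prob_spaceI) (simp add: space_cubeM emeasure_cubeM)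

lemma measure_box_0_1: "measure lborel (box 0 1 :: (real^'d::finite) set) = 1"
  using emeasure_cubeM[where 'd='d] by (simp add: emeasure_restrict_space measure_def)

lemma finite_measure_cubeM: "finite_measure (cubeM :: (real^'d::finite) measure)"
  by (rule prob_space.finite_measure[OF prob_space_cubeM])

lemma sigma_finite_cubeM: "sigma_finite_measure (cubeM :: (real^'d::finite) measure)"
  by (rule finite_measure.sigma_finite_measure[OF finite_measure_cubeM])

lemma borel_measurable_cubeM_I:
  "f \<in> borel_measurable borel \<Longrightarrow> f \<in> borel_measurable cubeM"
  by (intro measurable_restrict_space1) simp

lemma Lp_pow_2: "Lp_pow 2 v = (\<integral>\<^sup>+x. ennreal ((v x)\<^sup>2) \<partial>cubeM)"
proof -
  have "\<bar>a\<bar> powr 2 = a\<^sup>2" for a :: real by (cases "a = 0") (simp_all add: powr_numeral)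
  then show ?thesis by (simp add: Lp_pow_def)
qed

lemma L2_iff: "v \<in> L2 \<longleftrightarrow> v \<in> borel_measurable cubeM \<and> integrable cubeM (\<lambda>x. (v x)\<^sup>2)"
proof -
  have "Lp_pow 2 v < \<infinity> \<longleftrightarrow> integrable cubeM (\<lambda>x. (v x)\<^sup>2)" if [measurable]: "v \<in> borel_measurable cubeM"
    unfolding Lp_pow_2 by (subst integrable_iff_bounded) simp
  then show ?thesis by (auto simp: L2_def)
qed

lemma L2_measurable: "v \<in> L2 \<Longrightarrow> v \<in> borel_measurable cubeM"
  by (simp add: L2_iff)

lemma L2_integrable_mult:
  assumes "v \<in> L2" "w \<in> L2" shows "integrable cubeM (\<lambda>x. v x * w x)"
proof (rule Bochner_Integration.integrable_bound)
  show "integrable cubeM (\<lambda>x. (v x)\<^sup>2 + (w x)\<^sup>2)" using assms by (auto simp: L2_iff)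
  show "(\<lambda>x. v x * w x) \<in> borel_measurable cubeM" using assms by (auto simp: L2_iff)
  have "\<bar>a * b\<bar> \<le> a\<^sup>2 + b\<^sup>2" for a b :: real
  proof -
    have "0 \<le> (\<bar>a\<bar> - \<bar>b\<bar>)\<^sup>2" by simp
    then have "2 * \<bar>a * b\<bar> \<le> a\<^sup>2 + b\<^sup>2" by (simp add: power2_diff abs_mult)
    then show ?thesis by linarith
  qed
  then show "AE x in cubeM. norm (v x * w x) \<le> norm ((v x)\<^sup>2 + (w x)\<^sup>2)" by simp
qed

lemma L2_add:
  assumes "v \<in> L2" "w \<in> L2" shows "(\<lambda>x. v x + w x) \<in> L2"
  unfolding L2_iff
proof
  show "(\<lambda>x. v x + w x) \<in> borel_measurable cubeM" using assms by (auto simp: L2_iff)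
  have "integrable cubeM (\<lambda>x. (v x)\<^sup>2 + (w x)\<^sup>2 + 2 * (v x * w x))"
    using assms L2_integrable_mult[OF assms] by (auto simp: L2_iff simp del: integrable_mult_right_iff)
  then show "integrable cubeM (\<lambda>x. (v x + w x)\<^sup>2)" by (simp add: power2_sum algebra_simps)
qed

lemma L2_scale:
  assumes "v \<in> L2" shows "(\<lambda>x. c * v x) \<in> L2"
  using assms by (auto simp: L2_iff power_mult_distrib)

lemma L2_diff:
  assumes "v \<in> L2" "w \<in> L2" shows "(\<lambda>x. v x - w x) \<in> L2"
  using L2_add[OF assms(1) L2_scale[OF assms(2), of "-1"]] by simp

lemma L2_zero: "(\<lambda>_. 0) \<in> L2"
  by (simp add: L2_iff)

lemma L2_sum:
  "(\<And>i. i \<in> A \<Longrightarrow> f i \<in> L2) \<Longrightarrow> (\<lambda>x. \<Sum>i\<in>A. f i x) \<in> L2"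
  by (induction A rule: infinite_finite_induct) (auto intro: L2_add L2_zero)

lemma L2_mult_bounded:
  fixes v :: "real^'d::finite \<Rightarrow> real"
  assumes "v \<in> L2" "g \<in> borel_measurable cubeM" "\<And>x. x \<in> box 0 1 \<Longrightarrow> \<bar>g x\<bar> \<le> B"
  shows "(\<lambda>x. g x * v x) \<in> L2"
  unfolding L2_iff
proof
  show "(\<lambda>x. g x * v x) \<in> borel_measurable cubeM" using assms by (auto simp: L2_iff)
  show "integrable cubeM (\<lambda>x. (g x * v x)\<^sup>2)"
  proof (rule Bochner_Integration.integrable_bound)
    show "integrable cubeM (\<lambda>x. B\<^sup>2 * (v x)\<^sup>2)" using assms by (auto simp: L2_iff)
    show "(\<lambda>x. (g x * v x)\<^sup>2) \<in> borel_measurable cubeM" using assms by (auto simp: L2_iff)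
    show "AE x in cubeM. norm ((g x * v x)\<^sup>2) \<le> norm (B\<^sup>2 * (v x)\<^sup>2)"
    proof (rule AE_I2)
      fix x :: "real^'d" assume "x \<in> space cubeM"
      then have "\<bar>g x\<bar> \<le> B" using assms(3) by (simp add: space_cubeM)
      then have "(g x)\<^sup>2 \<le> B\<^sup>2" using abs_le_square_iff by fastforce
      then show "norm ((g x * v x)\<^sup>2) \<le> norm (B\<^sup>2 * (v x)\<^sup>2)"
        by (simp add: power_mult_distrib mult_right_mono)
    qed
  qed
qed

lemma L2_const: "(\<lambda>_. c) \<in> L2"
proof -
  interpret prob_space "cubeM :: (real^'a) measure" by (rule prob_space_cubeM)
  show ?thesis by (simp add: L2_iff)
qed

lemma L2_bounded:
  assumes "g \<in> borel_measurable cubeM" "\<And>x. x \<in> box 0 1 \<Longrightarrow> \<bar>g x\<bar> \<le> B"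
  shows "g \<in> L2"
  using L2_mult_bounded[OF L2_const[of 1] assms] by simp

lemma L2_integrable: "v \<in> L2 \<Longrightarrow> integrable cubeM v"
  using L2_integrable_mult[OF _ L2_const[of 1]] by simp

lemma L2_inner_commute: "L2_inner v w = L2_inner w v"
  by (simp add: L2_inner_def mult.commute)

lemma L2_inner_add_left:
  "u \<in> L2 \<Longrightarrow> v \<in> L2 \<Longrightarrow> w \<in> L2 \<Longrightarrow> L2_inner (\<lambda>x. u x + v x) w = L2_inner u w + L2_inner v w"
  unfolding L2_inner_def by (simp add: distrib_right L2_integrable_mult)

lemma L2_inner_diff_left:
  "u \<in> L2 \<Longrightarrow> v \<in> L2 \<Longrightarrow> w \<in> L2 \<Longrightarrow> L2_inner (\<lambda>x. u x - v x) w = L2_inner u w - L2_inner v w"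
  unfolding L2_inner_def by (simp add: left_diff_distrib L2_integrable_mult)

lemma L2_inner_scale_left: "L2_inner (\<lambda>x. c * v x) w = c * L2_inner v w"
  unfolding L2_inner_def by (simp add: mult.assoc)

lemma L2_inner_sum_left:
  "(\<And>i. i \<in> A \<Longrightarrow> f i \<in> L2) \<Longrightarrow> w \<in> L2 \<Longrightarrow> L2_inner (\<lambda>x. \<Sum>i\<in>A. f i x) w = (\<Sum>i\<in>A. L2_inner (f i) w)"
  unfolding L2_inner_def by (simp add: sum_distrib_right L2_integrable_mult)

lemma L2_inner_lincomb_left:
  "(\<And>i. i \<in> A \<Longrightarrow> f i \<in> L2) \<Longrightarrow> w \<in> L2 \<Longrightarrow>
    L2_inner (\<lambda>x. \<Sum>i\<in>A. c i * f i x) w = (\<Sum>i\<in>A. c i * L2_inner (f i) w)"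
  by (subst L2_inner_sum_left) (auto intro: L2_scale simp: L2_inner_scale_left)

lemma L2_inner_cong_AE:
  assumes "AE x in cubeM. u x = v x" "u \<in> L2" "v \<in> L2" "w \<in> L2"
  shows "L2_inner u w = L2_inner v w"
  unfolding L2_inner_def
  by (rule integral_cong_AE) (use assms in \<open>auto simp: L2_iff elim: eventually_mono\<close>)

lemma Lp_pow_2_L2_inner: "v \<in> L2 \<Longrightarrow> Lp_pow 2 v = ennreal (L2_inner v v)"
  unfolding Lp_pow_2 L2_inner_def
  by (subst nn_integral_eq_integral) (auto simp: L2_iff power2_eq_square)

lemma L2_inner_self_nonneg: "L2_inner v v \<ge> 0"
  unfolding L2_inner_def by (rule integral_nonneg_AE) auto

text \<open>The right-hand side may be infinite, so that the inequality can be applied to realizations whose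
  square integrability is not known in advance.\<close>

lemma L2_inner_Cauchy_Schwarz_ennreal:
  assumes "v \<in> borel_measurable cubeM" "w \<in> L2"
  shows "ennreal ((L2_inner v w)\<^sup>2) \<le> Lp_pow 2 v * ennreal (L2_inner w w)"
proof -
  have [measurable]: "v \<in> borel_measurable cubeM" "w \<in> borel_measurable cubeM"
    using assms by (auto simp: L2_iff)
  have "ennreal \<bar>L2_inner v w\<bar> \<le> (\<integral>\<^sup>+x. ennreal \<bar>v x\<bar> * ennreal \<bar>w x\<bar> \<partial>cubeM)"
  proof (cases "integrable cubeM (\<lambda>x. v x * w x)")
    case True
    have "ennreal (norm (L2_inner v w)) \<le> (\<integral>\<^sup>+x. ennreal (norm (v x * w x)) \<partial>cubeM)"
      unfolding L2_inner_def by (rule integral_norm_bound_ennreal[OF True])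
    then show ?thesis by (simp add: abs_mult ennreal_mult)
  qed (simp add: L2_inner_def not_integrable_integral_eq)
  then have "(ennreal \<bar>L2_inner v w\<bar>)\<^sup>2 \<le> (\<integral>\<^sup>+x. ennreal \<bar>v x\<bar> * ennreal \<bar>w x\<bar> \<partial>cubeM)\<^sup>2"
    by (rule power_mono) simp
  also have "\<dots> \<le> (\<integral>\<^sup>+x. (ennreal \<bar>v x\<bar>)\<^sup>2 \<partial>cubeM) * (\<integral>\<^sup>+x. (ennreal \<bar>w x\<bar>)\<^sup>2 \<partial>cubeM)"
    by (rule Cauchy_Schwarz_nn_integral) auto
  also have "\<dots> = Lp_pow 2 v * Lp_pow 2 w" by (simp add: Lp_pow_2 ennreal_power)
  finally show ?thesis using assms by (simp add: ennreal_power Lp_pow_2_L2_inner)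
qed

lemma L2_Bessel:
  assumes A: "finite A" and e: "\<And>i. i \<in> A \<Longrightarrow> e i \<in> L2"
    and on: "\<And>i j. i \<in> A \<Longrightarrow> j \<in> A \<Longrightarrow> L2_inner (e i) (e j) = (if i = j then 1 else 0)"
    and v: "v \<in> L2"
  shows "(\<Sum>i\<in>A. (L2_inner v (e i))\<^sup>2) \<le> L2_inner v v"
proof -
  define c where "c i = L2_inner v (e i)" for i
  define s where "s x = (\<Sum>i\<in>A. c i * e i x)" for x
  have s: "s \<in> L2" unfolding s_def by (intro L2_sum L2_scale e)
  have sw: "L2_inner s w = (\<Sum>i\<in>A. c i * L2_inner (e i) w)" if "w \<in> L2" for w
    unfolding s_def by (rule L2_inner_lincomb_left) (use e that in auto)
  have se: "L2_inner s (e i) = c i" if "i \<in> A" for i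
  proof -
    have "L2_inner s (e i) = (\<Sum>j\<in>A. c j * (if j = i then 1 else 0))"
      using that e on by (subst sw) auto
    also have "\<dots> = c i" using A that by (simp add: mult_delta_right)
    finally show ?thesis .
  qed
  have ss: "L2_inner s s = (\<Sum>i\<in>A. (c i)\<^sup>2)"
    by (subst sw) (auto simp: s se L2_inner_commute[of _ s] power2_eq_square intro!: sum.cong)
  have vs: "L2_inner s v = (\<Sum>i\<in>A. (c i)\<^sup>2)"
    by (subst sw) (auto simp: v c_def L2_inner_commute[of _ v] power2_eq_square intro!: sum.cong)
  have "0 \<le> L2_inner (\<lambda>x. v x - s x) (\<lambda>x. v x - s x)" by (rule L2_inner_self_nonneg)
  also have "\<dots> = L2_inner v (\<lambda>x. v x - s x) - L2_inner s (\<lambda>x. v x - s x)"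
    by (intro L2_inner_diff_left v s L2_diff)
  also have "\<dots> = (L2_inner v v - L2_inner s v) - (L2_inner v s - L2_inner s s)"
    using v s by (subst (1 2) L2_inner_commute) (simp add: L2_inner_diff_left)
  finally show ?thesis using ss vs by (simp add: L2_inner_commute[of v s] c_def)
qed

section \<open>The cosine basis\<close>

definition cos_mode :: "nat \<Rightarrow> real \<Rightarrow> real"
  where "cos_mode n s = (if n = 0 then 1 else sqrt 2 * cos (real n * pi * s))"

definition cosine :: "('d::finite \<Rightarrow> nat) \<Rightarrow> real^'d \<Rightarrow> real"
  where "cosine m x = (\<Prod>i\<in>UNIV. cos_mode (m i) (x $ i))"

lemma continuous_cos_mode: "continuous_on S (cos_mode n)"
  unfolding cos_mode_def by (cases "n = 0") (auto intro!: continuous_intros)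

lemma continuous_cosine: "continuous_on S (cosine m)"
  unfolding cosine_def
  by (intro continuous_intros continuous_on_compose2[OF continuous_cos_mode[of UNIV]]) auto

lemma borel_measurable_cosine: "cosine m \<in> borel_measurable borel"
  by (intro borel_measurable_continuous_onI continuous_cosine)

lemma abs_cos_mode_le: "\<bar>cos_mode n s\<bar> \<le> sqrt 2"
proof -
  have "sqrt 2 * \<bar>cos (real n * pi * s)\<bar> \<le> sqrt 2 * 1" by (intro mult_left_mono) auto
  then show ?thesis by (auto simp: cos_mode_def abs_mult)
qed

lemma abs_cosine_le: "\<bar>cosine m (x::real^'d::finite)\<bar> \<le> sqrt 2 ^ CARD('d)"
proof -
  have "\<bar>cosine m x\<bar> = (\<Prod>i\<in>UNIV. \<bar>cos_mode (m i) (x $ i)\<bar>)" by (simp add: cosine_def abs_prod)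
  also have "\<dots> \<le> (\<Prod>i\<in>(UNIV::'d set). sqrt 2)" by (intro prod_mono) (auto simp: abs_cos_mode_le)
  finally show ?thesis by simp
qed

lemma cosine_L2: "cosine m \<in> L2"
  by (rule L2_bounded[OF borel_measurable_cubeM_I[OF borel_measurable_cosine] abs_cosine_le])

lemma integral_cubeM_prod:
  fixes f :: "'d::finite \<Rightarrow> real \<Rightarrow> real"
  assumes f: "\<And>i. continuous_on UNIV (f i)"
  shows "(\<integral>x. (\<Prod>i\<in>UNIV. f i (x $ i)) \<partial>(cubeM :: (real^'d) measure)) =
    (\<Prod>i\<in>UNIV. \<integral>s. indicator {0<..<1} s * f i s \<partial>lborel)"
proof -
  interpret product_sigma_finite "\<lambda>_::real^'d. lborel :: real measure" by standard
  define ax where "ax i = axis i (1::real)" for i :: 'd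
  have ax: "inj ax" "Basis = ax ` UNIV"
    by (auto simp: ax_def inj_def axis_eq_axis Basis_vec_def)
  define g where "g b s = indicator {0<..<1} s * f (inv ax b) s" for b and s :: real
  have g_ax: "g (ax i) = (\<lambda>s. indicator {0<..<1} s * f i s)" for i
    by (simp add: g_def ax(1) fun_eq_iff)
  have fm: "f i \<in> borel_measurable borel" for i
    by (intro borel_measurable_continuous_onI f)
  have gm: "g b \<in> borel_measurable lborel" for b
    unfolding g_def using fm by measurable
  have gi: "integrable lborel (g b)" for b
  proof -
    have "integrable lborel (\<lambda>s. indicator {0..1} s *\<^sub>R f (inv ax b) s)"
      by (intro borel_integrable_compact continuous_on_subset[OF f]) auto
    then have "integrable lborel (\<lambda>s. indicator {0<..<1} s *\<^sub>R (indicator {0..1} s *\<^sub>R f (inv ax b) s))"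
      by (rule integrable_mult_indicator[rotated]) simp
    moreover have "(\<lambda>s. indicator {0<..<1} s *\<^sub>R (indicator {0..1} s *\<^sub>R f (inv ax b) s)) = g b"
      by (auto simp: g_def fun_eq_iff indicator_def)
    ultimately show ?thesis by simp
  qed
  have box: "x \<in> box 0 1 \<longleftrightarrow> (\<forall>i. 0 < x $ i \<and> x $ i < 1)" for x :: "real^'d"
    by (simp add: mem_box_cart)
  have comp: "(\<Sum>b\<in>Basis. y b *\<^sub>R b) $ i = y (ax i)" for y and i :: 'd
  proof -
    have "(\<Sum>b\<in>Basis. y b *\<^sub>R b) $ i = (\<Sum>j\<in>UNIV. (y (ax j) *\<^sub>R ax j) $ i)"
      by (simp add: ax(2) sum.reindex[OF ax(1)])
    also have "\<dots> = (\<Sum>j\<in>UNIV. if j = i then y (ax j) else 0)"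
      by (intro sum.cong) (auto simp: ax_def axis_def)
    finally show ?thesis by simp
  qed
  have comp': "(\<Sum>b\<in>Basis. y b * b $ i) = y (ax i)" for y and i :: 'd
    using comp[of y i] by simp
  have ind: "indicator (box 0 1) x * (\<Prod>i\<in>UNIV. f i (x $ i)) = (\<Prod>i\<in>UNIV. g (ax i) (x $ i))"
    for x :: "real^'d"
  proof (cases "x \<in> box 0 1")
    case True
    then show ?thesis by (auto simp: box g_ax intro!: prod.cong)
  next
    case False
    then obtain i where "\<not> (0 < x $ i \<and> x $ i < 1)" by (auto simp: box)
    then have "(\<Prod>i\<in>UNIV. g (ax i) (x $ i)) = 0"
      by (intro prod_zero) (auto simp: g_ax intro!: exI[of _ i])
    then show ?thesis using False by simp
  qed
  have "(\<integral>x. (\<Prod>i\<in>UNIV. f i (x $ i)) \<partial>(cubeM :: (real^'d) measure)) =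
      (\<integral>x. (\<Prod>i\<in>UNIV. g (ax i) (x $ i)) \<partial>lborel)"
    by (subst integral_restrict_space) (auto simp: ind)
  also have "\<dots> = (\<integral>y. (\<Prod>i\<in>UNIV. g (ax i) (y (ax i))) \<partial>(\<Pi>\<^sub>M b\<in>Basis. lborel))"
    by (subst lborel_eq, subst integral_distr) (use gm in \<open>auto simp: comp'\<close>)
  also have "\<dots> = (\<integral>y. (\<Prod>b\<in>Basis. g b (y b)) \<partial>(\<Pi>\<^sub>M b\<in>Basis. lborel))"
    by (simp add: ax(2) prod.reindex[OF ax(1)])
  also have "\<dots> = (\<Prod>b\<in>Basis. integral\<^sup>L lborel (g b))"
    by (intro product_integral_prod gi) auto
  also have "\<dots> = (\<Prod>i\<in>UNIV. integral\<^sup>L lborel (g (ax i)))"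
    by (simp add: ax(2) prod.reindex[OF ax(1)])
  finally show ?thesis by (simp add: g_ax)
qed

lemma integral_cos_pi_multiple:
  "(\<integral>s. indicator {0<..<1} s * cos (real n * pi * s) \<partial>lborel) = (if n = 0 then 1 else 0)"
proof (cases "n = 0")
  case False
  have "(\<integral>s. indicator {0<..<1} s * cos (real n * pi * s) \<partial>lborel) =
      (\<integral>s. indicator {0..1} s *\<^sub>R cos (real n * pi * s) \<partial>lborel)"
  proof (rule integral_cong_AE)
    have "AE s::real in lborel. s \<notin> {0,1}"
      by (intro AE_not_in countable_imp_null_set_lborel) auto
    then show "AE s in lborel. indicator {0<..<1} s * cos (real n * pi * s) =
        indicator {0..1} s *\<^sub>R cos (real n * pi * s)"
      by eventually_elim (auto simp: indicator_def)
  qed auto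
  also have "\<dots> = sin (real n * pi * 1) / (real n * pi) - sin (real n * pi * 0) / (real n * pi)"
    using False
    by (intro integral_FTC_Icc)
      (auto intro!: derivative_eq_intros continuous_intros simp: has_real_derivative_iff_has_vector_derivative[symmetric])
  also have "\<dots> = 0" by simp
  finally show ?thesis using False by simp
qed simp

lemma integral_cos_mode:
  "(\<integral>s. indicator {0<..<1} s * (cos_mode n s * cos_mode k s) \<partial>lborel) = (if n = k then 1 else 0)"
proof -
  define w where "w n = (if n = 0 then 1 else sqrt 2 :: real)" for n :: nat
  define c where "c j s = indicator {0<..<1} s * cos (real j * pi * s)" for j and s :: real
  have int: "integrable lborel (c j)" for j
  proof -
    have "integrable lborel (\<lambda>s::real. indicator {0..1} s *\<^sub>R cos (real j * pi * s))"
      by (intro borel_integrable_compact continuous_intros) auto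
    then have "integrable lborel (\<lambda>s::real. indicator {0<..<1} s *\<^sub>R (indicator {0..1} s *\<^sub>R cos (real j * pi * s)))"
      by (rule integrable_mult_indicator[rotated]) simp
    moreover have "(\<lambda>s. indicator {0<..<1} s *\<^sub>R (indicator {0..1} s *\<^sub>R cos (real j * pi * s))) = c j"
      by (auto simp: c_def fun_eq_iff indicator_def)
    ultimately show ?thesis by simp
  qed
  define D where "D = (if n \<le> k then k - n else n - k)"
  have cm: "cos_mode n s = w n * cos (real n * pi * s)" for n s
    by (simp add: cos_mode_def w_def)
  have D: "cos (real n * pi * s - real k * pi * s) = cos (real D * pi * s)" for s
  proof (cases "n \<le> k")
    case True
    then have "real D * pi * s = - (real n * pi * s - real k * pi * s)"
      by (simp add: D_def of_nat_diff algebra_simps)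
    then show ?thesis by (simp only: cos_minus)
  next
    case False
    then show ?thesis by (simp add: D_def of_nat_diff algebra_simps)
  qed
  have "indicator {0<..<1} s * (cos_mode n s * cos_mode k s) =
      w n * w k / 2 * (c D s + c (n + k) s)" for s :: real
  proof -
    have "cos (real n * pi * s) * cos (real k * pi * s) =
        (cos (real D * pi * s) + cos (real (n + k) * pi * s)) / 2"
      using cos_times_cos[of "real n * pi * s" "real k * pi * s"] D[of s]
      by (simp add: distrib_right)
    moreover have "i * (x * a * (y * b)) = x * y / 2 * (i * c + i * d)"
      if "a * b = (c + d) / 2" for i x y a b c d :: real
    proof -
      have "i * (x * a * (y * b)) = i * x * y * (a * b)" by simp
      also have "\<dots> = x * y / 2 * (i * c + i * d)" unfolding that by (simp add: algebra_simps)
      finally show ?thesis .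
    qed
    ultimately show ?thesis unfolding cm c_def by blast
  qed
  then have "(\<integral>s. indicator {0<..<1} s * (cos_mode n s * cos_mode k s) \<partial>lborel) =
      (\<integral>s. w n * w k / 2 * (c D s + c (n + k) s) \<partial>lborel)"
    by (simp only:)
  also have "\<dots> = w n * w k / 2 * ((\<integral>s. c D s \<partial>lborel) + (\<integral>s. c (n + k) s \<partial>lborel))"
    using int by simp
  also have "\<dots> = w n * w k / 2 * ((if D = 0 then 1 else 0) + (if n + k = 0 then 1 else 0))"
    unfolding c_def integral_cos_pi_multiple ..
  also have "\<dots> = (if n = k then 1 else 0)"
    by (auto simp: w_def D_def)
  finally show ?thesis .
qed

lemma cosine_orthonormal:
  "L2_inner (cosine m) (cosine m') = (if m = m' then 1 else 0)"
proof -
  have "L2_inner (cosine m) (cosine m') =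
      (\<integral>x. (\<Prod>i\<in>UNIV. cos_mode (m i) (x $ i) * cos_mode (m' i) (x $ i)) \<partial>cubeM)"
    by (simp add: L2_inner_def cosine_def prod.distrib)
  also have "\<dots> = (\<Prod>i\<in>UNIV. if m i = m' i then 1 else 0)"
    by (subst integral_cubeM_prod)
      (auto intro!: continuous_intros continuous_cos_mode simp: integral_cos_mode)
  also have "\<dots> = (if m = m' then 1 else 0)"
  proof (cases "m = m'")
    case False
    then obtain i where "m i \<noteq> m' i" by auto
    then have "(\<Prod>i\<in>UNIV. if m i = m' i then 1 else 0 :: real) = 0"
      by (intro prod_zero) (auto intro!: exI[of _ i])
    then show ?thesis using False by simp
  qed simp
  finally show ?thesis .
qed

lemma cosine_zero: "cosine (\<lambda>_. 0) x = 1"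
  by (simp add: cosine_def cos_mode_def)

lemma cos_times_cos_mode:
  obtains a b k l where "\<And>s. cos (pi * s) * cos_mode n s = a * cos_mode k s + b * cos_mode l s"
proof (cases "n = 0")
  case True
  have "cos (pi * s) * cos_mode n s = (1 / sqrt 2) * cos_mode 1 s + 0 * cos_mode 0 s" for s
    using True by (simp add: cos_mode_def)
  then show ?thesis by (rule that)
next
  case False
  define w where "w = (if n = 1 then sqrt 2 / 2 else 1 / 2 :: real)"
  have "cos (pi * s) * cos_mode n s = (1 / 2) * cos_mode (n + 1) s + w * cos_mode (n - 1) s" for s
  proof -
    have 1: "real (n + 1) * pi * s = real n * pi * s + pi * s" by (simp add: algebra_simps)
    have 2: "real (n - 1) * pi * s = real n * pi * s - pi * s"
      using False by (simp add: of_nat_diff algebra_simps)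
    have w: "w * cos_mode (n - 1) s = sqrt 2 / 2 * cos (real (n - 1) * pi * s)"
      using False by (cases "n = 1") (auto simp: w_def cos_mode_def)
    have c: "cos (real (n + 1) * pi * s) + cos (real (n - 1) * pi * s) =
        2 * (cos (pi * s) * cos (real n * pi * s))"
      unfolding 1 2 by (simp add: cos_add cos_diff)
    have "(1 / 2) * cos_mode (n + 1) s + w * cos_mode (n - 1) s =
        sqrt 2 / 2 * (cos (real (n + 1) * pi * s) + cos (real (n - 1) * pi * s))"
      unfolding w by (simp add: cos_mode_def algebra_simps)
    also have "\<dots> = cos (pi * s) * cos_mode n s"
      unfolding c using False by (simp add: cos_mode_def)
    finally show ?thesis by simp
  qed
  then show ?thesis by (rule that)
qed

lemma cos_times_cosine:
  obtains a b k l where "\<And>x. cos (pi * x $ i) * cosine m x = a * cosine k x + b * cosine l x"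
proof -
  obtain a b k l where *: "\<And>s. cos (pi * s) * cos_mode (m i) s = a * cos_mode k s + b * cos_mode l s"
    by (rule cos_times_cos_mode[of "m i"]) blast
  have split: "cosine m' x = cos_mode (m' i) (x $ i) * (\<Prod>j\<in>UNIV-{i}. cos_mode (m' j) (x $ j))" for m' x
    unfolding cosine_def by (rule prod.remove) auto
  have upd: "cosine (m(i := n)) x = cos_mode n (x $ i) * (\<Prod>j\<in>UNIV-{i}. cos_mode (m j) (x $ j))" for n x
    by (subst split) (auto intro!: arg_cong2[where f="(*)"] prod.cong)
  have "cos (pi * x $ i) * cosine m x = a * cosine (m(i := k)) x + b * cosine (m(i := l)) x" for x
    unfolding upd by (subst split) (simp add: mult.assoc[symmetric] * distrib_right)
  then show ?thesis by (rule that)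
qed

text \<open>A function whose integral against every continuous function vanishes is zero: by monotone
  approximation its integral over closed sets vanishes, and closed sets are an
  intersection-stable generator of the Borel sets.\<close>

lemma AE_zero_if_orthogonal_to_continuous:
  fixes f :: "real^'d::finite \<Rightarrow> real"
  assumes f: "integrable cubeM f"
    and orth: "\<And>g. continuous_on UNIV g \<Longrightarrow> (\<integral>x. g x * f x \<partial>cubeM) = 0"
  shows "AE x in cubeM. f x = 0"
proof -
  have fm[measurable]: "f \<in> borel_measurable cubeM" using f by auto
  have ind[measurable]: "indicator A \<in> borel_measurable (cubeM :: (real^'d) measure)"
    if "A \<in> sets borel" for A :: "(real^'d) set"
    by (rule borel_measurable_cubeM_I) (use that in auto)
  define I where "I A = (\<integral>x. indicator A x *\<^sub>R f x \<partial>cubeM)" for A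
  have int: "integrable cubeM (\<lambda>x. indicator A x *\<^sub>R f x)" if "A \<in> sets borel" for A
  proof (rule Bochner_Integration.integrable_bound[OF f])
    show "(\<lambda>x. indicator A x *\<^sub>R f x) \<in> borel_measurable cubeM"
      by (intro borel_measurable_scaleR ind that fm)
  qed (simp add: indicator_def)
  have closed: "I A = 0" if A: "closed A" for A
  proof (cases "A = {}")
    case False
    define g where "g n x = max 0 (1 - real n * infdist x A)" for n x
    have "(\<lambda>n. \<integral>x. g n x * f x \<partial>cubeM) \<longlonglongrightarrow> (\<integral>x. indicator A x *\<^sub>R f x \<partial>cubeM)"
    proof (rule integral_dominated_convergence)
      show "integrable cubeM (\<lambda>x. norm (f x))" using f by simp
      have gc: "continuous_on UNIV (g n)" for n
        unfolding g_def by (intro continuous_intros)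
      show "(\<lambda>x. g n x * f x) \<in> borel_measurable cubeM" for n
        by (intro borel_measurable_times fm borel_measurable_cubeM_I borel_measurable_continuous_onI gc)
      show "(\<lambda>x. indicator A x *\<^sub>R f x) \<in> borel_measurable cubeM"
        using int[of A] A by auto
      have "g n x * f x = max 0 (1 - real n * infdist x A) * f x" for n x by (simp add: g_def)
      have lim: "(\<lambda>n. g n x * f x) \<longlonglongrightarrow> indicator A x *\<^sub>R f x" for x
      proof (cases "x \<in> A")
        case True then show ?thesis by (simp add: g_def)
      next
        case False
        then have pos: "infdist x A > 0"
          using A \<open>A \<noteq> {}\<close> by (meson infdist_pos_not_in_closed)
        obtain N where N: "1 < real N * infdist x A" using reals_Archimedean3[OF pos] by blast
        have "\<forall>\<^sub>F n in sequentially. g n x * f x = 0"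
          using eventually_ge_at_top[of N]
        proof eventually_elim
          case (elim n)
          have "real N * infdist x A \<le> real n * infdist x A" using elim pos by simp
          then show ?case using N by (simp add: g_def)
        qed
        then show ?thesis using False by (simp add: tendsto_eventually)
      qed
      then show "AE x in cubeM. (\<lambda>n. g n x * f x) \<longlonglongrightarrow> indicator A x *\<^sub>R f x" by simp
      have "\<bar>g n x\<bar> \<le> 1" for n x by (simp add: g_def infdist_nonneg)
      then show "AE x in cubeM. norm (g n x * f x) \<le> norm (f x)" for n
        by (simp add: abs_mult mult_left_le_one_le)
    qed
    moreover have "(\<integral>x. g n x * f x \<partial>cubeM) = 0" for n
      by (rule orth) (auto simp: g_def intro!: continuous_intros)
    ultimately show ?thesis by (simp add: I_def LIMSEQ_const_iff)
  qed (simp add: I_def)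
  have total: "(\<integral>x. f x \<partial>cubeM) = 0" using closed[of UNIV] by (simp add: I_def)
  have all: "I A = 0" if "A \<in> sets borel" for A
  proof -
    have A: "A \<in> sigma_sets UNIV {S. closed S}" using that by (simp add: borel_eq_closed)
    have "Int_stable {S :: (real^'d) set. closed S}" by (auto simp: Int_stable_def)
    moreover have "{S :: (real^'d) set. closed S} \<subseteq> Pow UNIV" by auto
    ultimately show ?thesis using A
    proof (induction rule: sigma_sets_induct_disjoint)
      case (basic A) then show ?case using closed by auto
    next
      case empty show ?case by (simp add: I_def)
    next
      case (compl A)
      then have A: "A \<in> sets borel" by (simp add: borel_eq_closed)
      have "(\<lambda>x. indicator (UNIV - A) x *\<^sub>R f x) = (\<lambda>x. f x - indicator A x *\<^sub>R f x)"
        by (auto simp: indicator_def)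
      then show ?case
        using compl int[OF A] f total by (simp add: I_def)
    next
      case (union A)
      then have A: "A i \<in> sets borel" for i by (auto simp: borel_eq_closed)
      have "(\<lambda>n. \<integral>x. (\<Sum>i<n. indicator (A i) x *\<^sub>R f x) \<partial>cubeM) \<longlonglongrightarrow> (\<integral>x. indicator (\<Union>i. A i) x *\<^sub>R f x \<partial>cubeM)"
      proof (rule integral_dominated_convergence)
        show "integrable cubeM (\<lambda>x. norm (f x))" using f by simp
        show "(\<lambda>x. \<Sum>i<n. indicator (A i) x *\<^sub>R f x) \<in> borel_measurable cubeM" for n
          using int[OF A] by (intro borel_measurable_sum) auto
        show "(\<lambda>x. indicator (\<Union>i. A i) x *\<^sub>R f x) \<in> borel_measurable cubeM"
          using int[of "\<Union>i. A i"] A by auto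
        have eq: "(\<Sum>i<n. indicator (A i) x *\<^sub>R f x) = indicator (\<Union>i<n. A i) x *\<^sub>R f x" for n x
        proof -
          have "disjoint_family_on A {..<n}" using union(1) by (auto simp: disjoint_family_on_def)
          then have "indicator (\<Union>i<n. A i) x = (\<Sum>i<n. indicator (A i) x :: real)"
            by (intro indicator_UN_disjoint) auto
          then show ?thesis by (simp add: sum_distrib_right)
        qed
        show "AE x in cubeM. norm (\<Sum>i<n. indicator (A i) x *\<^sub>R f x) \<le> norm (f x)" for n
          unfolding eq by (auto simp: indicator_def)
        have "(\<lambda>n. indicator (\<Union>i<n. A i) x :: real) \<longlonglongrightarrow> indicator (\<Union>i. A i) x" for x
          by (rule LIMSEQ_indicator_UN)
        then show "AE x in cubeM. (\<lambda>n. \<Sum>i<n. indicator (A i) x *\<^sub>R f x) \<longlonglongrightarrow> indicator (\<Union>i. A i) x *\<^sub>R f x"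
          unfolding eq by (intro AE_I2 tendsto_intros)
      qed
      moreover have "(\<integral>x. (\<Sum>i<n. indicator (A i) x *\<^sub>R f x) \<partial>cubeM) = 0" for n
        using union int[OF A] by (subst Bochner_Integration.integral_sum) (auto simp: I_def)
      ultimately show ?case by (simp add: I_def LIMSEQ_const_iff)
    qed
  qed
  have sgn: "AE x in cubeM. s * f x \<le> 0" if s: "s \<in> {1, -1}" for s :: real
  proof -
    define A where "A = {x \<in> space cubeM. 0 < s * f x}"
    have "A \<in> sets cubeM" unfolding A_def by measurable
    then have A: "A \<in> sets borel" by (auto simp: sets_restrict_space)
    have "(\<integral>x. s * (indicator A x *\<^sub>R f x) \<partial>cubeM) = 0"
      using all[OF A] by (simp add: I_def)
    moreover have "AE x in cubeM. 0 \<le> s * (indicator A x *\<^sub>R f x)"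
      by (auto simp: A_def indicator_def)
    moreover have "integrable cubeM (\<lambda>x. s * (indicator A x *\<^sub>R f x))"
      using int[OF A] by (intro integrable_mult_right)
    ultimately have "AE x in cubeM. s * (indicator A x *\<^sub>R f x) = 0"
      by (subst (asm) integral_nonneg_eq_0_iff_AE)
    then show ?thesis
      by (rule AE_mp) (rule AE_I2, auto simp: A_def space_cubeM indicator_def split: if_splits)
  qed
  show ?thesis using sgn[of 1] sgn[of "-1"] by auto
qed

text \<open>The functions orthogonal to all cosine products form a module over the ring of those
  continuous functions whose multiplication preserves the orthogonality.  That ring contains every
  \<open>cos (\<pi> x\<^sub>i)\<close>, so it separates points and is dense by Stone--Weierstrass.\<close>

lemma cosine_complete:
  fixes f :: "real^'d::finite \<Rightarrow> real"
  assumes f: "f \<in> L2" and orth: "\<And>m. L2_inner f (cosine m) = 0"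
  shows "AE x in cubeM. f x = 0"
proof (rule AE_zero_if_orthogonal_to_continuous)
  show fi: "integrable cubeM f" by (rule L2_integrable[OF f])
  define X where "X = {v :: real^'d \<Rightarrow> real. v \<in> L2 \<and> (\<forall>m. L2_inner v (cosine m) = 0)}"
  define R where "R = {g :: real^'d \<Rightarrow> real. continuous_on (cbox 0 1) g \<and> (\<forall>v\<in>X. (\<lambda>x. g x * v x) \<in> X)}"
  have fX: "f \<in> X" using f orth by (simp add: X_def)
  have Xadd: "(\<lambda>x. a * v x + b * w x) \<in> X" if "v \<in> X" "w \<in> X" for v w a b
    using that by (auto simp: X_def L2_add L2_scale L2_inner_add_left L2_inner_scale_left cosine_L2)
  have gen: "(\<lambda>x. cos (pi * x $ i)) \<in> R" for i
  proof -
    have "(\<lambda>x. cos (pi * x $ i) * v x) \<in> X" if v: "v \<in> X" for v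
      unfolding X_def
    proof (intro CollectI conjI allI)
      show "(\<lambda>x. cos (pi * x $ i) * v x) \<in> L2"
      proof (rule L2_mult_bounded[where B=1])
        show "v \<in> L2" using v by (simp add: X_def)
        show "(\<lambda>x. cos (pi * x $ i)) \<in> borel_measurable cubeM"
          by (intro borel_measurable_cubeM_I borel_measurable_continuous_onI continuous_intros)
      qed simp
      fix m
      obtain a b k l where *: "\<And>x. cos (pi * x $ i) * cosine m x = a * cosine k x + b * cosine l x"
        by (rule cos_times_cosine[of i m]) blast
      have "L2_inner (\<lambda>x. cos (pi * x $ i) * v x) (cosine m) =
          L2_inner (\<lambda>x. a * cosine k x + b * cosine l x) v"
        unfolding L2_inner_def *[symmetric] by (simp add: algebra_simps)
      also have "\<dots> = 0"
        using v by (subst L2_inner_add_left)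
          (auto simp: X_def L2_scale cosine_L2 L2_inner_scale_left L2_inner_commute[of "cosine _"])
      finally show "L2_inner (\<lambda>x. cos (pi * x $ i) * v x) (cosine m) = 0" .
    qed
    then show ?thesis by (auto simp: R_def intro!: continuous_intros)
  qed
  interpret function_ring_on R "cbox 0 1 :: (real^'d) set"
  proof
    show "compact (cbox 0 1 :: (real^'d) set)" by simp
    show "continuous_on (cbox 0 1) g" if "g \<in> R" for g using that by (simp add: R_def)
    show "(\<lambda>x. g x + h x) \<in> R" if "g \<in> R" "h \<in> R" for g h
      using that Xadd[of _ _ 1 1] by (auto simp: R_def distrib_right intro!: continuous_intros)
    show "(\<lambda>x. g x * h x) \<in> R" if "g \<in> R" "h \<in> R" for g h
      using that by (auto simp: R_def mult.assoc intro!: continuous_intros)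
    show "(\<lambda>_. c) \<in> R" for c
      using Xadd[of _ _ c 0] by (auto simp: R_def)
    fix x y :: "real^'d" assume xy: "x \<in> cbox 0 1" "y \<in> cbox 0 1" "x \<noteq> y"
    then obtain i where i: "x $ i \<noteq> y $ i" by (auto simp: vec_eq_iff)
    have "0 \<le> x $ i" "x $ i \<le> 1" "0 \<le> y $ i" "y $ i \<le> 1"
      using xy by (auto simp: mem_box_cart)
    then have "cos (pi * x $ i) \<noteq> cos (pi * y $ i)"
      using i cos_inj_pi[of "pi * x $ i" "pi * y $ i"] by (auto simp: mult_le_cancel_left1)
    then show "\<exists>g\<in>R. g x \<noteq> g y" by (intro bexI[OF _ gen[of i]])
  qed
  fix g :: "real^'d \<Rightarrow> real" assume g: "continuous_on UNIV g"
  then have gc: "continuous_on (cbox 0 1) g" by (rule continuous_on_subset) simp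
  obtain F where F: "\<And>n. F n \<in> R" and lim: "uniform_limit (cbox 0 1) F g sequentially"
    using Stone_Weierstrass[OF gc] by (auto simp: Pi_iff)
  have gm: "g \<in> borel_measurable cubeM"
    by (intro borel_measurable_cubeM_I borel_measurable_continuous_onI g)
  have "bounded (g ` cbox 0 1)" by (intro compact_imp_bounded compact_continuous_image gc) simp
  then obtain B where B: "\<And>x. x \<in> cbox 0 1 \<Longrightarrow> \<bar>g x\<bar> \<le> B" by (auto simp: bounded_iff)
  have "(\<lambda>x. g x * f x) \<in> L2"
    by (rule L2_mult_bounded[OF f gm]) (use B box_subset_cbox in blast)
  then have gf: "integrable cubeM (\<lambda>x. g x * f x)" by (rule L2_integrable)
  have Ff: "integrable cubeM (\<lambda>x. F n x * f x)" "(\<integral>x. F n x * f x \<partial>cubeM) = 0" for n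
  proof -
    have *: "(\<lambda>x. F n x * f x) \<in> X" using F[of n] fX by (simp add: R_def)
    then show "integrable cubeM (\<lambda>x. F n x * f x)" by (simp add: X_def L2_integrable)
    have "L2_inner (\<lambda>x. F n x * f x) (cosine (\<lambda>_. 0)) = 0" using * by (simp add: X_def)
    then show "(\<integral>x. F n x * f x \<partial>cubeM) = 0" by (simp add: L2_inner_def cosine_zero)
  qed
  define J where "J = (\<integral>x. \<bar>f x\<bar> \<partial>cubeM)"
  have J: "J \<ge> 0" unfolding J_def by simp
  have "\<bar>\<integral>x. g x * f x \<partial>cubeM\<bar> \<le> e" if e: "e > 0" for e
  proof -
    have "e / (J + 1) > 0" using e J by simp
    then obtain n where n: "\<And>x. x \<in> cbox 0 1 \<Longrightarrow> dist (F n x) (g x) < e / (J + 1)"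
      using lim unfolding uniform_limit_iff eventually_sequentially by (meson order_refl)
    have "\<bar>\<integral>x. g x * f x \<partial>cubeM\<bar> = \<bar>\<integral>x. g x * f x - F n x * f x \<partial>cubeM\<bar>"
      using gf Ff by simp
    also have "\<dots> \<le> (\<integral>x. \<bar>g x * f x - F n x * f x\<bar> \<partial>cubeM)"
      by (rule integral_abs_bound)
    also have "\<dots> \<le> (\<integral>x. e / (J + 1) * \<bar>f x\<bar> \<partial>cubeM)"
    proof (rule integral_mono)
      show "integrable cubeM (\<lambda>x. \<bar>g x * f x - F n x * f x\<bar>)" using gf Ff by simp
      show "integrable cubeM (\<lambda>x. e / (J + 1) * \<bar>f x\<bar>)" using fi by simp
      fix x :: "real^'d" assume "x \<in> space cubeM"
      then have "x \<in> cbox 0 1" using box_subset_cbox by (auto simp: space_cubeM)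
      then have "\<bar>g x - F n x\<bar> \<le> e / (J + 1)" using n[of x] by (simp add: dist_real_def abs_minus_commute)
      then have "\<bar>g x - F n x\<bar> * \<bar>f x\<bar> \<le> e / (J + 1) * \<bar>f x\<bar>" by (intro mult_right_mono) auto
      then show "\<bar>g x * f x - F n x * f x\<bar> \<le> e / (J + 1) * \<bar>f x\<bar>"
        by (simp add: left_diff_distrib[symmetric] abs_mult)
    qed
    also have "\<dots> = e * (J / (J + 1))" by (simp add: J_def)
    also have "\<dots> \<le> e * 1" using J e by (intro mult_left_mono) auto
    finally show ?thesis by simp
  qed
  then have "\<bar>\<integral>x. g x * f x \<partial>cubeM\<bar> \<le> 0" by (rule field_le_epsilon) simp
  then show "(\<integral>x. g x * f x \<partial>cubeM) = 0" by simp
qed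


lemma L2_eq_if_same_cosine_coefficients:
  assumes "f \<in> L2" "v \<in> L2" "\<And>m. L2_inner f (cosine m) = L2_inner v (cosine m)"
  shows "AE x in cubeM. f x = v x"
proof -
  have "AE x in cubeM. f x - v x = 0"
    by (rule cosine_complete) (auto simp: L2_diff L2_inner_diff_left cosine_L2 assms)
  then show ?thesis by simp
qed

lemma finite_cosine_expansion:
  assumes f: "f \<in> L2" and A: "finite A" and z: "\<And>m. m \<notin> A \<Longrightarrow> L2_inner f (cosine m) = 0"
  shows "AE x in cubeM. f x = (\<Sum>m\<in>A. L2_inner f (cosine m) * cosine m x)"
proof (rule L2_eq_if_same_cosine_coefficients[OF f])
  show "(\<lambda>x. \<Sum>m\<in>A. L2_inner f (cosine m) * cosine m x) \<in> L2"
    by (rule L2_sum, rule L2_scale, rule cosine_L2)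
  fix k
  have "L2_inner (\<lambda>x. \<Sum>m\<in>A. L2_inner f (cosine m) * cosine m x) (cosine k) =
      (\<Sum>m\<in>A. if m = k then L2_inner f (cosine m) else 0)"
    by (subst L2_inner_lincomb_left) (auto simp: cosine_L2 cosine_orthonormal intro!: sum.cong)
  also have "\<dots> = L2_inner f (cosine k)" using A z by (simp add: sum.delta')
  finally show "L2_inner f (cosine k) =
      L2_inner (\<lambda>x. \<Sum>m\<in>A. L2_inner f (cosine m) * cosine m x) (cosine k)" by simp
qed

text \<open>If the cosine coefficients are absolutely summable, the cosine series converges uniformly, and
  by completeness its sum is the given function.\<close>

lemma AE_abs_le_sum_cosine_coefficients:
  fixes f :: "real^'d::finite \<Rightarrow> real"
  assumes f: "f \<in> L2" and S: "\<And>A. finite A \<Longrightarrow> (\<Sum>m\<in>A. \<bar>L2_inner f (cosine m)\<bar>) \<le> S"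
  shows "AE x in cubeM. \<bar>f x\<bar> \<le> sqrt 2 ^ CARD('d) * S"
proof -
  interpret prob_space "cubeM :: (real^'d) measure" by (rule prob_space_cubeM)
  have "infinite (UNIV :: ('d \<Rightarrow> nat) set)"
  proof
    assume "finite (UNIV :: ('d \<Rightarrow> nat) set)"
    then have "finite (range (\<lambda>n::nat. \<lambda>_::'d. n))" by (rule finite_subset[rotated]) simp
    then have "finite (UNIV :: nat set)" by (rule finite_imageD) (auto simp: inj_def fun_eq_iff)
    then show False by simp
  qed
  then have bij: "bij (from_nat_into (UNIV :: ('d \<Rightarrow> nat) set))"
    by (intro bij_betw_from_nat_into) auto
  define e where "e = from_nat_into (UNIV :: ('d \<Rightarrow> nat) set)"
  have inj: "inj e" and surj: "surj e" using bij by (auto simp: e_def bij_def)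
  define B where "B = sqrt 2 ^ CARD('d)"
  have B: "B \<ge> 0" "\<And>m x. \<bar>cosine m (x :: real^'d)\<bar> \<le> B" by (auto simp: B_def abs_cosine_le)
  define a where "a n = L2_inner f (cosine (e n))" for n
  have fin: "(\<Sum>n<N. \<bar>a n\<bar>) \<le> S" for N
    using S[of "e ` {..<N}"] inj by (simp add: a_def sum.reindex inj_on_subset)
  then have sa: "summable (\<lambda>n. \<bar>a n\<bar>)" by (intro summableI_nonneg_bounded) auto
  then have sum_a: "(\<Sum>n. \<bar>a n\<bar>) \<le> S" by (intro suminf_le_const fin)
  have le: "\<bar>a n * cosine (e n) x\<bar> \<le> B * \<bar>a n\<bar>" for n x
    using mult_left_mono[OF B(2)[of "e n" x], of "\<bar>a n\<bar>"] by (simp add: abs_mult mult.commute)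
  have sc: "summable (\<lambda>n. \<bar>a n * cosine (e n) x\<bar>)" for x
    by (rule summable_comparison_test'[OF summable_mult[OF sa, of B], of 0]) (use le in auto)
  define v where "v x = (\<Sum>n. a n * cosine (e n) x)" for x
  have v_le: "\<bar>v x\<bar> \<le> B * S" for x
  proof -
    have "\<bar>v x\<bar> \<le> (\<Sum>n. \<bar>a n * cosine (e n) x\<bar>)" unfolding v_def by (rule summable_rabs[OF sc])
    also have "\<dots> \<le> (\<Sum>n. B * \<bar>a n\<bar>)" by (intro suminf_le le sc summable_mult sa)
    also have "\<dots> = B * (\<Sum>n. \<bar>a n\<bar>)" by (rule suminf_mult[OF sa])
    also have "\<dots> \<le> B * S" by (intro mult_left_mono sum_a B)
    finally show ?thesis .
  qed
  have cm: "cosine m \<in> borel_measurable cubeM" for m :: "'d \<Rightarrow> nat"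
    by (rule L2_measurable[OF cosine_L2])
  have vm: "v \<in> borel_measurable cubeM"
    unfolding v_def by (intro borel_measurable_suminf borel_measurable_times borel_measurable_const cm)
  have vL: "v \<in> L2" by (rule L2_bounded[OF vm v_le])
  have coeff: "L2_inner v (cosine (e k)) = a k" for k
  proof -
    have "L2_inner v (cosine (e k)) = (\<integral>x. (\<Sum>n. a n * cosine (e n) x * cosine (e k) x) \<partial>cubeM)"
      unfolding L2_inner_def v_def
      by (simp only: suminf_mult2[OF summable_rabs_cancel[OF sc]])
    also have "\<dots> = (\<Sum>n. \<integral>x. a n * cosine (e n) x * cosine (e k) x \<partial>cubeM)"
    proof (rule integral_suminf)
      have *: "\<bar>a n * cosine (e n) x * cosine (e k) x\<bar> \<le> B * B * \<bar>a n\<bar>" for n x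
        using mult_mono[OF le[of n x] B(2)[of "e k" x]] B(1) by (simp add: abs_mult mult_ac)
      show int: "integrable cubeM (\<lambda>x. a n * cosine (e n) x * cosine (e k) x)" for n
        by (intro L2_integrable_mult L2_scale cosine_L2)
      show "AE x in cubeM. summable (\<lambda>n. norm (a n * cosine (e n) x * cosine (e k) x))"
        by (rule AE_I2, rule summable_comparison_test'[OF summable_mult[OF sa, of "B * B"], of 0])
          (simp only: real_norm_def abs_idempotent *)
      show "summable (\<lambda>n. \<integral>x. norm (a n * cosine (e n) x * cosine (e k) x) \<partial>cubeM)"
      proof (rule summable_comparison_test'[OF summable_mult[OF sa, of "B * B"], of 0])
        fix n
        have "(\<integral>x. norm (a n * cosine (e n) x * cosine (e k) x) \<partial>cubeM) \<le>
            (\<integral>x. B * B * \<bar>a n\<bar> \<partial>(cubeM :: (real^'d) measure))"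
          by (rule integral_mono) (use int * in auto)
        then show "norm (\<integral>x. norm (a n * cosine (e n) x * cosine (e k) x) \<partial>cubeM) \<le> B * B * \<bar>a n\<bar>"
          by (simp add: measure_box_0_1 measure_restrict_space space_cubeM)
      qed
    qed
    also have "\<dots> = (\<Sum>n. a n * L2_inner (cosine (e n)) (cosine (e k)))"
      by (simp add: L2_inner_def mult.assoc)
    also have "\<dots> = (\<Sum>n. if n = k then a n else 0)"
      by (intro arg_cong[where f=suminf] ext) (use inj in \<open>auto simp: cosine_orthonormal inj_eq\<close>)
    also have "\<dots> = a k" using suminf_finite[of "{k}" "\<lambda>n. if n = k then a n else 0"] by simp
    finally show ?thesis .
  qed
  have "AE x in cubeM. f x = v x"
  proof (rule L2_eq_if_same_cosine_coefficients[OF f vL])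
    fix m :: "'d \<Rightarrow> nat"
    obtain k where "m = e k" using surj by (metis surjD)
    then show "L2_inner f (cosine m) = L2_inner v (cosine m)" using coeff by (simp add: a_def)
  qed
  then show ?thesis using v_le by (auto elim!: eventually_mono simp: B_def)
qed

section \<open>Weak gradients and the cosine basis\<close>

definition cos_mode_deriv :: "nat \<Rightarrow> real \<Rightarrow> real"
  where "cos_mode_deriv n s = - (sqrt 2 * (real n * pi) * sin (real n * pi * s))"

definition cosine_grad :: "('d::finite \<Rightarrow> nat) \<Rightarrow> real^'d \<Rightarrow> real^'d"
  where "cosine_grad m x =
    (\<chi> i. cos_mode_deriv (m i) (x $ i) * (\<Prod>j\<in>UNIV-{i}. cos_mode (m j) (x $ j)))"

definition neumann_eigenvalue :: "('d::finite \<Rightarrow> nat) \<Rightarrow> real"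
  where "neumann_eigenvalue m = (\<Sum>i\<in>UNIV. (real (m i) * pi)\<^sup>2)"

lemma DERIV_cos_mode: "(cos_mode n has_real_derivative cos_mode_deriv n s) (at s)"
proof (cases "n = 0")
  case True
  then have "cos_mode n = (\<lambda>_. 1)" by (auto simp: cos_mode_def)
  then show ?thesis using True by (simp add: cos_mode_deriv_def)
next
  case False
  then have "cos_mode n = (\<lambda>s. sqrt 2 * cos (real n * pi * s))" by (auto simp: cos_mode_def)
  then show ?thesis
    by (auto simp: cos_mode_deriv_def intro!: derivative_eq_intros)
qed

lemma DERIV_cos_mode_deriv:
  "(cos_mode_deriv n has_real_derivative - ((real n * pi)\<^sup>2 * cos_mode n s)) (at s)"
  unfolding cos_mode_deriv_def
  by (auto intro!: derivative_eq_intros simp: cos_mode_def power2_eq_square)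

lemma continuous_cos_mode_deriv: "continuous_on S (cos_mode_deriv n)"
  unfolding cos_mode_deriv_def by (intro continuous_intros)

lemma abs_cos_mode_deriv_le:
  assumes s: "0 < s" "s < 1"
  shows "\<bar>cos_mode_deriv n s\<bar> \<le> 2 * sqrt 2 * (real n * pi)\<^sup>2 * (s * (1 - s))"
proof -
  define k where "k = real n * pi"
  have k: "k \<ge> 0" by (simp add: k_def)
  have sin_le: "\<bar>sin y\<bar> \<le> \<bar>y\<bar>" for y :: real by (rule abs_sin_x_le_abs_x)
  have "sin (k * (1 - s)) = - (cos k * sin (k * s))"
    by (simp add: right_diff_distrib sin_diff k_def)
  then have "\<bar>sin (k * s)\<bar> = \<bar>sin (k * (1 - s))\<bar>"
    by (simp add: abs_mult k_def)
  then have 1: "\<bar>sin (k * s)\<bar> \<le> k * (1 - s)" using sin_le[of "k * (1 - s)"] k s by (simp add: abs_mult)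
  have 2: "\<bar>sin (k * s)\<bar> \<le> k * s" using sin_le[of "k * s"] k s by (simp add: abs_mult)
  have "\<bar>sin (k * s)\<bar> \<le> 2 * k * (s * (1 - s))"
  proof (cases "s \<le> 1/2")
    case True
    have "k * s * 1 \<le> k * s * (2 * (1 - s))" using True k s by (intro mult_left_mono) auto
    with 2 show ?thesis by (simp add: algebra_simps)
  next
    case False
    have "k * (1 - s) * 1 \<le> k * (1 - s) * (2 * s)" using False k s by (intro mult_left_mono) auto
    with 1 show ?thesis by (simp add: mult_ac)
  qed
  then have "sqrt 2 * k * \<bar>sin (k * s)\<bar> \<le> sqrt 2 * k * (2 * k * (s * (1 - s)))"
    using k by (intro mult_left_mono) auto
  moreover have "\<bar>cos_mode_deriv n s\<bar> = sqrt 2 * k * \<bar>sin (k * s)\<bar>"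
    using k by (simp only: cos_mode_deriv_def k_def[symmetric] abs_minus_cancel abs_mult) simp
  ultimately have "\<bar>cos_mode_deriv n s\<bar> \<le> 2 * sqrt 2 * k\<^sup>2 * (s * (1 - s))"
    by (simp only: power2_eq_square mult_ac)
  then show ?thesis by (simp only: k_def)
qed

lemma GDERIV_prod_coordinates:
  fixes \<rho> :: "'d::finite \<Rightarrow> real \<Rightarrow> real"
  assumes "\<And>i s. (\<rho> i has_real_derivative \<rho>' i s) (at s)"
  shows "GDERIV (\<lambda>x. \<Prod>i\<in>UNIV. \<rho> i (x $ i)) x :>
    (\<chi> i. \<rho>' i (x $ i) * (\<Prod>j\<in>UNIV-{i}. \<rho> j (x $ j)))"
proof -
  have 1: "((\<lambda>x::real^'d. \<rho> i (x $ i)) has_derivative (\<lambda>h. h $ i * \<rho>' i (x $ i))) (at x)" for i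
  proof -
    have "(\<rho> i has_derivative (\<lambda>h. h * \<rho>' i (x $ i))) (at (x $ i))"
      using assms[of i "x $ i"] by (simp add: has_field_derivative_def mult_commute_abs)
    from has_derivative_compose[OF bounded_linear_imp_has_derivative[OF bounded_linear_vec_nth] this]
    show ?thesis .
  qed
  have "((\<lambda>x. \<Prod>i\<in>UNIV. \<rho> i (x $ i)) has_derivative
      (\<lambda>h. \<Sum>i\<in>UNIV. h $ i * \<rho>' i (x $ i) * (\<Prod>j\<in>UNIV-{i}. \<rho> j (x $ j)))) (at x)"
    by (rule has_derivative_prod) (rule 1)
  then show ?thesis
    by (simp add: gderiv_def inner_vec_def mult.assoc)
qed

lemma GDERIV_cosine: "GDERIV (cosine m) x :> cosine_grad m x"
  unfolding cosine_def cosine_grad_def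
  by (rule GDERIV_prod_coordinates) (rule DERIV_cos_mode)

lemma continuous_on_prod_coordinates:
  fixes \<rho> :: "'d::finite \<Rightarrow> real \<Rightarrow> real"
  assumes "\<And>j. continuous_on UNIV (\<rho> j)"
  shows "continuous_on S (\<lambda>x::real^'d. \<Prod>j\<in>A. \<rho> j (x $ j))"
  by (intro continuous_intros continuous_on_compose2[OF assms]) auto

lemma continuous_cosine_grad: "continuous_on S (cosine_grad m)"
proof -
  have "continuous_on S (\<lambda>x. cos_mode_deriv (m i) (x $ i))" for i
    by (rule continuous_on_compose2[OF continuous_cos_mode_deriv[of UNIV]]) (auto intro: continuous_intros)
  then show ?thesis
    unfolding cosine_grad_def
    by (intro continuous_on_vec_lambda continuous_on_mult)
      (auto intro: continuous_on_prod_coordinates continuous_cos_mode)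
qed

lemma cosine_grad_L2: "(\<lambda>x. cosine_grad m x $ i) \<in> L2"
proof -
  have c: "continuous_on S (\<lambda>x. cosine_grad m x $ i)" for S
    by (rule continuous_on_component[OF continuous_cosine_grad])
  have "bounded ((\<lambda>x. cosine_grad m x $ i) ` cbox 0 1)"
    by (intro compact_imp_bounded compact_continuous_image c) simp
  then obtain B where "\<And>x. x \<in> cbox 0 1 \<Longrightarrow> \<bar>cosine_grad m x $ i\<bar> \<le> B"
    by (auto simp: bounded_iff)
  then show ?thesis
    using box_subset_cbox
    by (intro L2_bounded[where B=B] borel_measurable_cubeM_I borel_measurable_continuous_onI c) blast
qed

lemma GDERIV_zero_outside_support:
  assumes "GDERIV F x :> D" "x \<notin> closure {x. F x \<noteq> 0}"
  shows "D = (0 :: 'a::euclidean_space)"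
proof -
  have F0: "0 = F y" if "y \<in> - closure {x. F x \<noteq> 0}" for y
    using that closure_subset[of "{x. F x \<noteq> 0}"] by (metis (mono_tags, lifting) ComplD mem_Collect_eq subsetD)
  have "(F has_derivative (\<lambda>h. 0)) (at x)"
  proof (rule has_derivative_transform_within_open)
    show "((\<lambda>_. 0) has_derivative (\<lambda>h. 0)) (at x)" by (rule has_derivative_const)
    show "open (- closure {x. F x \<noteq> 0})" by (intro open_Compl closed_closure)
    show "x \<in> - closure {x. F x \<noteq> 0}" unfolding Compl_iff by (rule assms(2))
  qed (rule F0)
  then have "(\<lambda>h. inner h D) = (\<lambda>h. 0)"
    using assms(1) unfolding gderiv_def by (rule has_derivative_unique[rotated])
  then have "inner D D = 0" by (rule fun_cong)
  then show ?thesis by simp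
qed

text \<open>A partial derivative is a limit of difference quotients, and these have integral zero because
  Lebesgue measure is translation invariant.\<close>

lemma integral_partial_derivative_zero:
  fixes F :: "real^'d::finite \<Rightarrow> real"
  assumes F: "\<And>x. GDERIV F x :> DF x" and DF: "continuous_on UNIV DF"
    and supp: "compact (closure {x. F x \<noteq> 0})"
  shows "(\<integral>x. DF x $ i \<partial>lborel) = 0"
proof -
  define K where "K = closure {x. F x \<noteq> 0}"
  have F0: "F x = 0" if "x \<notin> K" for x using that closure_subset[of "{x. F x \<noteq> 0}"] by (auto simp: K_def)
  have DF0: "DF x = 0" if "x \<notin> K" for x
    using GDERIV_zero_outside_support[OF F] that by (auto simp: K_def)
  have Fd: "(F has_derivative (\<lambda>h. h \<bullet> DF x)) (at x within S)" for x S
    using F[of x] by (auto simp: gderiv_def intro: has_derivative_at_withinI)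
  have Fc: "continuous_on UNIV F"
    by (rule has_derivative_continuous_on[OF Fd])
  obtain r where r: "\<And>x. x \<in> K \<Longrightarrow> norm x \<le> r"
    using compact_imp_bounded[OF supp] by (auto simp: K_def bounded_iff)
  obtain B where B: "\<And>x. norm (DF x) \<le> B"
  proof -
    have "bounded (DF ` K)"
      using supp by (intro compact_imp_bounded compact_continuous_image continuous_on_subset[OF DF]) (auto simp: K_def)
    then obtain B where "\<And>x. x \<in> K \<Longrightarrow> norm (DF x) \<le> B" by (auto simp: bounded_iff)
    then have "norm (DF x) \<le> max B 0" for x using DF0[of x] by (cases "x \<in> K") (auto intro: max.coboundedI1)
    then show ?thesis by (rule that)
  qed
  have lip: "\<bar>F (x + h) - F x\<bar> \<le> B * norm h" for x h
  proof -
    have "norm (F (x + h) - F x) \<le> B * norm (x + h - x)"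
    proof (rule differentiable_bound[OF convex_UNIV Fd])
      fix y :: "real^'d"
      show "onorm (\<lambda>h. h \<bullet> DF y) \<le> B"
      proof (rule onorm_le)
        fix h :: "real^'d"
        have "norm (h \<bullet> DF y) \<le> norm h * norm (DF y)" by (simp add: Cauchy_Schwarz_ineq2)
        also have "\<dots> \<le> norm h * B" by (intro mult_left_mono B) simp
        finally show "norm (h \<bullet> DF y) \<le> B * norm h" by (simp add: mult.commute)
      qed
    qed auto
    then show ?thesis by simp
  qed
  define e where "e n = (1 / real (Suc n)) *\<^sub>R axis i (1::real)" for n :: nat
  have ne: "norm (e n) = 1 / real (Suc n)" for n by (simp add: e_def norm_axis_1)
  define g where "g n x = real (Suc n) * (F (x + e n) - F x)" for n x
  have Fint: "integrable lborel F"
  proof -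
    have "integrable lborel (\<lambda>x. indicator K x *\<^sub>R F x)"
      using supp by (intro borel_integrable_compact continuous_on_subset[OF Fc]) (auto simp: K_def)
    moreover have "(\<lambda>x. indicator K x *\<^sub>R F x) = F"
      using F0 by (intro ext) (metis indicator_simps scaleR_one scaleR_zero_right)
    ultimately show ?thesis by simp
  qed
  have Fm: "F \<in> borel_measurable borel" using borel_measurable_continuous_onI[OF Fc] .
  have trans: "(\<integral>x. F (x + e n) \<partial>lborel) = (\<integral>x. F x \<partial>lborel)"
    "integrable lborel (\<lambda>x. F (x + e n))" for n
  proof -
    have d: "distr lborel borel ((+) (e n)) = lborel" by (rule lborel_distr_plus)
    have "(\<integral>x. F x \<partial>distr lborel borel ((+) (e n))) = (\<integral>x. F (e n + x) \<partial>lborel)"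
      using Fm by (intro integral_distr) auto
    then show "(\<integral>x. F (x + e n) \<partial>lborel) = (\<integral>x. F x \<partial>lborel)" by (simp add: d add.commute)
    have "integrable (distr lborel borel ((+) (e n))) F \<longleftrightarrow> integrable lborel (\<lambda>x. F (e n + x))"
      using Fm by (intro integrable_distr_eq) auto
    then show "integrable lborel (\<lambda>x. F (x + e n))" using Fint by (simp add: d add.commute)
  qed
  have "(\<lambda>n. \<integral>x. g n x \<partial>lborel) \<longlonglongrightarrow> (\<integral>x. DF x $ i \<partial>lborel)"
  proof (rule integral_dominated_convergence)
    show "(\<lambda>x. DF x $ i) \<in> borel_measurable lborel"
      using borel_measurable_continuous_onI[OF continuous_on_component[OF DF]] by simp
    show "g n \<in> borel_measurable lborel" for n
      unfolding g_def using Fint trans(2)[of n] by auto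
    have "integrable lborel (\<lambda>x. indicator (cball 0 (r + 1)) x *\<^sub>R B)"
      by (intro borel_integrable_compact) auto
    then show "integrable lborel (\<lambda>x::real^'d. B * indicator (cball 0 (r + 1)) x)" by (simp add: mult.commute)
    have lim: "(\<lambda>n. g n x) \<longlonglongrightarrow> DF x $ i" for x
    proof -
      have "((\<lambda>t. F (x + t *\<^sub>R axis i 1)) has_derivative (\<lambda>t. (t *\<^sub>R axis i 1) \<bullet> DF x)) (at 0)"
      proof -
        have "((\<lambda>t::real. x + t *\<^sub>R axis i 1) has_derivative (\<lambda>t. t *\<^sub>R axis i 1)) (at 0)"
          by (auto intro!: derivative_eq_intros)
        moreover have "(F has_derivative (\<lambda>h. h \<bullet> DF x)) (at (x + 0 *\<^sub>R axis i 1))" using Fd by simp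
        ultimately show ?thesis by (rule has_derivative_compose)
      qed
      then have "((\<lambda>t. F (x + t *\<^sub>R axis i 1)) has_real_derivative DF x $ i) (at 0)"
        by (simp add: has_field_derivative_def inner_axis inner_commute mult_commute_abs)
      then have "((\<lambda>t. (F (x + t *\<^sub>R axis i 1) - F x) / t) \<longlongrightarrow> DF x $ i) (at 0)"
        by (simp add: DERIV_def)
      moreover have "filterlim (\<lambda>n. 1 / real (Suc n)) (at 0) sequentially"
        by (rule filterlim_atI[OF LIMSEQ_Suc[OF lim_1_over_n]]) simp
      ultimately have "(\<lambda>n. (F (x + (1 / real (Suc n)) *\<^sub>R axis i 1) - F x) / (1 / real (Suc n))) \<longlonglongrightarrow> DF x $ i"
        by (rule filterlim_compose)
      then show ?thesis by (simp add: g_def e_def mult.commute)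
    qed
    then show "AE x in lborel. (\<lambda>n. g n x) \<longlonglongrightarrow> DF x $ i" by simp
    have "norm (g n x) \<le> B * indicator (cball 0 (r + 1)) x" for n x
    proof (cases "norm x \<le> r + 1")
      case True
      have "norm (g n x) = real (Suc n) * \<bar>F (x + e n) - F x\<bar>" by (simp add: g_def abs_mult)
      also have "\<dots> \<le> real (Suc n) * (B * norm (e n))" by (intro mult_left_mono lip) simp
      also have "\<dots> = B" by (simp add: ne)
      finally show ?thesis using True by simp
    next
      case False
      have "norm x \<le> norm (x + e n) + norm (e n)" using norm_triangle_ineq4[of "x + e n" "e n"] by simp
      moreover have "norm (e n) \<le> 1" by (simp add: ne)
      ultimately have "r < norm x" "r < norm (x + e n)" using False by linarith+
      then have "x \<notin> K" "x + e n \<notin> K" using r leD by blast+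
      then show ?thesis using False by (simp add: g_def F0)
    qed
    then show "AE x in lborel. norm (g n x) \<le> B * indicator (cball 0 (r + 1)) x" for n by simp
  qed
  moreover have "(\<integral>x. g n x \<partial>lborel) = 0" for n
    using trans[of n] Fint by (simp add: g_def)
  ultimately show ?thesis by (simp add: LIMSEQ_const_iff)
qed

lemma vec_integral_nth:
  fixes f :: "'a \<Rightarrow> real^'d::finite"
  assumes "integrable M f" shows "integral\<^sup>L M f $ i = (\<integral>x. f x $ i \<partial>M)"
  using integral_bounded_linear[OF bounded_linear_vec_nth[of i] assms] by simp

lemma integrable_cubeM_bounded_continuous:
  fixes f :: "real^'d::finite \<Rightarrow> 'b::euclidean_space"
  assumes "continuous_on UNIV f"
  shows "integrable cubeM f"
proof -
  interpret prob_space "cubeM :: (real^'d) measure" by (rule prob_space_cubeM)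
  have "bounded (f ` cbox 0 1)"
    by (intro compact_imp_bounded compact_continuous_image continuous_on_subset[OF assms]) auto
  then obtain B where B: "\<And>x. x \<in> cbox 0 1 \<Longrightarrow> norm (f x) \<le> B" by (auto simp: bounded_iff)
  show ?thesis
  proof (rule integrable_const_bound[where B=B])
    show "AE x in cubeM. norm (f x) \<le> B"
      by (rule AE_I2) (metis B space_cubeM box_subset_cbox subsetD)
    show "f \<in> borel_measurable cubeM"
      by (intro borel_measurable_cubeM_I borel_measurable_continuous_onI assms)
  qed
qed

lemma weak_gradient_cosine:
  "weak_gradient (cosine m :: real^'d::finite \<Rightarrow> real) (cosine_grad m)"
  unfolding weak_gradient_def
proof (intro conjI allI impI)
  show "cosine m \<in> L2" by (rule cosine_L2)
  show "(\<lambda>x. cosine_grad m x $ i) \<in> L2" for i by (rule cosine_grad_L2)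
  fix \<psi> :: "real^'d \<Rightarrow> real" and D\<psi>
  assume H: "(\<forall>x. GDERIV \<psi> x :> D\<psi> x) \<and> continuous_on UNIV D\<psi> \<and>
    compact (closure {x. \<psi> x \<noteq> 0}) \<and> closure {x. \<psi> x \<noteq> 0} \<subseteq> box 0 1"
  then have \<psi>: "\<And>x. GDERIV \<psi> x :> D\<psi> x" and D\<psi>: "continuous_on UNIV D\<psi>"
    and supp: "compact (closure {x. \<psi> x \<noteq> 0})" "closure {x. \<psi> x \<noteq> 0} \<subseteq> box 0 1" by auto
  have \<psi>c: "continuous_on UNIV \<psi>"
    by (rule has_derivative_continuous_on[of _ _ "\<lambda>x h. h \<bullet> D\<psi> x"])
      (use \<psi> in \<open>auto simp: gderiv_def intro: has_derivative_at_withinI\<close>)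
  define DF where "DF x = cosine m x *\<^sub>R D\<psi> x + \<psi> x *\<^sub>R cosine_grad m x" for x
  have F: "GDERIV (\<lambda>x. cosine m x * \<psi> x) x :> DF x" for x
    unfolding DF_def by (rule GDERIV_mult[OF GDERIV_cosine \<psi>])
  have int: "integrable cubeM (\<lambda>x. cosine m x *\<^sub>R D\<psi> x)" "integrable cubeM (\<lambda>x. \<psi> x *\<^sub>R cosine_grad m x)"
    by (intro integrable_cubeM_bounded_continuous continuous_intros continuous_cosine
        continuous_cosine_grad D\<psi> \<psi>c)+
  have sub: "closure {x. cosine m x * \<psi> x \<noteq> 0} \<subseteq> closure {x. \<psi> x \<noteq> 0}"
    by (rule closure_mono) auto
  then have Fsupp: "compact (closure {x. cosine m x * \<psi> x \<noteq> 0})"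
    using supp(1) by (meson closed_closure compact_Int_closed compact_closure bounded_subset compact_imp_bounded closure_subset)
  have DFc: "continuous_on UNIV DF"
    unfolding DF_def by (intro continuous_intros continuous_cosine continuous_cosine_grad D\<psi> \<psi>c)
  have "(\<integral>x. DF x $ i \<partial>cubeM) = 0" for i
  proof -
    have "DF x = 0" if "x \<notin> box 0 1" for x
    proof -
      have "x \<notin> closure {x. cosine m x * \<psi> x \<noteq> 0}" using that sub supp(2) by blast
      then show ?thesis by (rule GDERIV_zero_outside_support[OF F])
    qed
    then have ind: "indicator (box 0 1) x *\<^sub>R DF x $ i = DF x $ i" for x
      by (cases "x \<in> box 0 1") auto
    have "(\<integral>x. DF x $ i \<partial>cubeM) = (\<integral>x. indicator (box 0 1) x *\<^sub>R DF x $ i \<partial>lborel)"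
      by (rule integral_restrict_space) simp
    then have "(\<integral>x. DF x $ i \<partial>cubeM) = (\<integral>x. DF x $ i \<partial>lborel)"
      by (simp only: ind)
    then show ?thesis using integral_partial_derivative_zero[OF F DFc Fsupp] by simp
  qed
  have "integral\<^sup>L cubeM DF = 0"
  proof -
    have "integrable cubeM DF" unfolding DF_def by (intro Bochner_Integration.integrable_add int)
    then show ?thesis using \<open>\<And>i. (\<integral>x. DF x $ i \<partial>cubeM) = 0\<close> by (simp add: vec_eq_iff vec_integral_nth)
  qed
  then show "(\<integral>x. cosine m x *\<^sub>R D\<psi> x \<partial>cubeM) = - (\<integral>x. \<psi> x *\<^sub>R cosine_grad m x \<partial>cubeM)"
    unfolding DF_def using int by (simp add: add_eq_0_iff2)
qed

text \<open>A continuously differentiable cutoff, equal to \<open>0\<close> unless \<open>s (1 - s) > \<delta>\<close>, which tends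
  to \<open>1\<close> on \<open>(0,1)\<close> as \<open>\<delta> \<rightarrow> 0\<close>.\<close>

definition cutoff :: "real \<Rightarrow> real \<Rightarrow> real"
  where "cutoff \<delta> s = (max 0 (s * (1 - s) - \<delta>))\<^sup>2 / ((max 0 (s * (1 - s) - \<delta>))\<^sup>2 + \<delta>\<^sup>2)"

definition cutoff_deriv :: "real \<Rightarrow> real \<Rightarrow> real"
  where "cutoff_deriv \<delta> s = 2 * max 0 (s * (1 - s) - \<delta>) * (1 - 2 * s) * \<delta>\<^sup>2 /
    ((max 0 (s * (1 - s) - \<delta>))\<^sup>2 + \<delta>\<^sup>2)\<^sup>2"

lemma DERIV_max_0_power2: "((\<lambda>y::real. (max 0 y)\<^sup>2) has_real_derivative 2 * max 0 y) (at y)"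
proof -
  consider "y = 0" | "y < 0" | "y > 0" by linarith
  then show ?thesis
  proof cases
    case 1
    have "(\<lambda>h. (max 0 h)\<^sup>2 / h) \<midarrow>0\<rightarrow> (0::real)"
    proof (rule Lim_null_comparison)
      show "\<forall>\<^sub>F h in at 0. norm ((max 0 h)\<^sup>2 / h) \<le> \<bar>h::real\<bar>"
        by (rule always_eventually) (auto simp: max_def power2_eq_square)
      show "(\<lambda>h::real. \<bar>h\<bar>) \<midarrow>0\<rightarrow> 0" by (rule tendsto_rabs_zero) (rule tendsto_ident_at)
    qed
    then show ?thesis using 1 by (simp add: DERIV_def)
  next
    case 2
    show ?thesis
    proof (rule has_field_derivative_transform_within_open)
      show "((\<lambda>_. 0) has_real_derivative 2 * max 0 y) (at y)" using 2 by simp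
      show "open {..<0::real}" by simp
    qed (use 2 in auto)
  next
    case 3
    show ?thesis
    proof (rule has_field_derivative_transform_within_open)
      show "((\<lambda>y. y\<^sup>2) has_real_derivative 2 * max 0 y) (at y)"
        using 3 by (auto intro!: derivative_eq_intros)
      show "open {0::real<..}" by simp
    qed (use 3 in auto)
  qed
qed

lemma DERIV_cutoff:
  assumes "\<delta> > 0"
  shows "(cutoff \<delta> has_real_derivative cutoff_deriv \<delta> s) (at s)"
proof -
  define y where "y = s * (1 - s) - \<delta>"
  have "((\<lambda>s. s * (1 - s) - \<delta>) has_real_derivative (1 - 2 * s)) (at s)"
    by (auto intro!: derivative_eq_intros simp: algebra_simps)
  from DERIV_chain2[OF DERIV_max_0_power2 this]
  have 1: "((\<lambda>s. (max 0 (s * (1 - s) - \<delta>))\<^sup>2) has_real_derivative 2 * max 0 y * (1 - 2 * s)) (at s)"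
    by (simp add: y_def)
  have pos: "(max 0 y)\<^sup>2 + \<delta>\<^sup>2 > 0" using assms by (simp add: add_nonneg_pos)
  have "((\<lambda>q. q / (q + \<delta>\<^sup>2)) has_real_derivative \<delta>\<^sup>2 / ((max 0 y)\<^sup>2 + \<delta>\<^sup>2)\<^sup>2) (at ((max 0 y)\<^sup>2))"
    by (rule DERIV_cong[OF DERIV_divide[OF DERIV_ident DERIV_add[OF DERIV_ident DERIV_const]]])
      (use pos in \<open>auto simp: power2_eq_square[of "(max 0 y)\<^sup>2 + \<delta>\<^sup>2"]\<close>)
  from DERIV_chain2[OF this[unfolded y_def] 1]
  show ?thesis by (simp add: cutoff_def[abs_def] cutoff_deriv_def y_def mult_ac)
qed

lemma continuous_cutoff_deriv:
  assumes "\<delta> > 0" shows "continuous_on S (cutoff_deriv \<delta>)"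
proof -
  have "(max 0 y)\<^sup>2 + \<delta>\<^sup>2 \<noteq> 0" for y using assms by (simp add: add_nonneg_eq_0_iff)
  then show ?thesis unfolding cutoff_deriv_def by (intro continuous_intros) auto
qed

lemma continuous_cutoff:
  assumes "\<delta> > 0" shows "continuous_on S (cutoff \<delta>)"
proof -
  have "(max 0 y)\<^sup>2 + \<delta>\<^sup>2 \<noteq> 0" for y using assms by (simp add: add_nonneg_eq_0_iff)
  then show ?thesis unfolding cutoff_def by (intro continuous_intros) auto
qed

lemma abs_cutoff_le: "\<bar>cutoff \<delta> s\<bar> \<le> 1"
proof -
  have "0 \<le> a / (a + b) \<and> a / (a + b) \<le> 1" if "a \<ge> 0" "b \<ge> 0" for a b :: real
    using that by (cases "a + b = 0") (auto simp: divide_le_eq_1)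
  from this[of "(max 0 (s * (1 - s) - \<delta>))\<^sup>2" "\<delta>\<^sup>2"] show ?thesis
    unfolding cutoff_def by simp
qed

lemma cutoff_nonzeroD: "cutoff \<delta> s \<noteq> 0 \<Longrightarrow> s * (1 - s) > \<delta>"
  unfolding cutoff_def by (auto simp: max_def split: if_splits)

text \<open>The derivative of the cutoff blows up near the endpoints, but only at the rate
  \<open>1 / (s (1 - s))\<close>, which is compensated by a function that vanishes there.\<close>

lemma abs_cutoff_deriv_le:
  assumes "\<delta> > 0" "0 < s" "s < 1"
  shows "s * (1 - s) * \<bar>cutoff_deriv \<delta> s\<bar> \<le> 3"
proof (cases "s * (1 - s) \<le> \<delta>")
  case True
  then show ?thesis by (simp add: cutoff_deriv_def)
next
  case False
  define r where "r = s * (1 - s) - \<delta>"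
  have r: "r > 0" "max 0 r = r" using False by (auto simp: r_def)
  define Q where "Q = r\<^sup>2 + \<delta>\<^sup>2"
  have Q: "Q > 0" using r by (simp add: Q_def add_pos_nonneg)
  have s: "\<bar>1 - 2 * s\<bar> \<le> 1" using assms by auto
  have eq: "s * (1 - s) * \<bar>cutoff_deriv \<delta> s\<bar> = (r + \<delta>) * (2 * r * \<delta>\<^sup>2) * \<bar>1 - 2 * s\<bar> / Q\<^sup>2"
    using r(1) by (simp add: cutoff_deriv_def r_def[symmetric] r(2) Q_def abs_mult abs_div)
      (simp add: r_def)
  have "(r + \<delta>) * (2 * r * \<delta>\<^sup>2) * \<bar>1 - 2 * s\<bar> \<le> (r + \<delta>) * (2 * r * \<delta>\<^sup>2) * 1"
    using r assms by (intro mult_left_mono s) auto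
  also have "\<dots> = (2 * r\<^sup>2 + 2 * r * \<delta>) * \<delta>\<^sup>2" by (simp add: algebra_simps power2_eq_square)
  also have "\<dots> \<le> (3 * Q) * Q"
  proof (rule mult_mono)
    have "0 \<le> (r - \<delta>)\<^sup>2" by simp
    then have "2 * r * \<delta> \<le> r\<^sup>2 + \<delta>\<^sup>2" by (simp add: power2_diff)
    moreover have "0 \<le> r\<^sup>2" "0 \<le> \<delta>\<^sup>2" by simp_all
    ultimately show "2 * r\<^sup>2 + 2 * r * \<delta> \<le> 3 * Q" unfolding Q_def by argo
  qed (use Q r assms in \<open>auto simp: Q_def\<close>)
  finally have "(r + \<delta>) * (2 * r * \<delta>\<^sup>2) * \<bar>1 - 2 * s\<bar> \<le> 3 * Q\<^sup>2" by (simp add: power2_eq_square)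
  then show ?thesis unfolding eq using Q by (simp add: divide_le_eq)
qed

lemma cutoff_tendsto:
  assumes s: "0 < s" "s < 1"
  shows "(\<lambda>n. cutoff (1 / real (Suc n)) s) \<longlonglongrightarrow> 1"
    and "(\<lambda>n. cutoff_deriv (1 / real (Suc n)) s) \<longlonglongrightarrow> 0"
proof -
  define y where "y = s * (1 - s)"
  have y: "y > 0" using s by (simp add: y_def)
  have d: "(\<lambda>n. 1 / real (Suc n)) \<longlonglongrightarrow> 0" by (rule LIMSEQ_Suc[OF lim_1_over_n])
  have "(\<lambda>n. (max 0 (y - 1 / real (Suc n)))\<^sup>2 / ((max 0 (y - 1 / real (Suc n)))\<^sup>2 + (1 / real (Suc n))\<^sup>2))
      \<longlonglongrightarrow> (max 0 (y - 0))\<^sup>2 / ((max 0 (y - 0))\<^sup>2 + 0\<^sup>2)"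
    by (intro tendsto_intros d) (use y in auto)
  then show "(\<lambda>n. cutoff (1 / real (Suc n)) s) \<longlonglongrightarrow> 1"
    unfolding cutoff_def y_def[symmetric] using y by simp
  have "(\<lambda>n. 2 * max 0 (y - 1 / real (Suc n)) * (1 - 2 * s) * (1 / real (Suc n))\<^sup>2 /
      ((max 0 (y - 1 / real (Suc n)))\<^sup>2 + (1 / real (Suc n))\<^sup>2)\<^sup>2)
      \<longlonglongrightarrow> 2 * max 0 (y - 0) * (1 - 2 * s) * 0\<^sup>2 / ((max 0 (y - 0))\<^sup>2 + 0\<^sup>2)\<^sup>2"
    by (intro tendsto_intros d) (use y in auto)
  then show "(\<lambda>n. cutoff_deriv (1 / real (Suc n)) s) \<longlonglongrightarrow> 0"
    unfolding cutoff_deriv_def y_def[symmetric] by simp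
qed

lemma integrable_vecI:
  fixes f :: "'a \<Rightarrow> real^'d::finite"
  assumes "\<And>i. integrable M (\<lambda>x. f x $ i)"
  shows "integrable M f"
proof -
  have "integrable M (\<lambda>x. \<Sum>i\<in>UNIV. f x $ i *\<^sub>R axis i (1::real))"
    by (intro Bochner_Integration.integrable_sum integrable_scaleR_left assms)
  moreover have "(\<lambda>x. \<Sum>i\<in>UNIV. f x $ i *\<^sub>R axis i (1::real)) = f"
    by (simp add: scalar_mult_eq_scaleR[symmetric] basis_expansion)
  ultimately show ?thesis by (simp only:)
qed

text \<open>Integration by parts against \<open>\<partial>\<^sub>i\<close> of a cosine product.  That partial derivative vanishes
  on the two faces orthogonal to the \<open>i\<close>-th direction, so multiplying it by cutoffs in all coordinates
  gives admissible test functions whose \<open>i\<close>-th partial derivatives stay bounded.\<close>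

lemma weak_gradient_cosine_parts:
  fixes v :: "real^'d::finite \<Rightarrow> real"
  assumes vG: "weak_gradient v G"
  shows "(\<integral>x. cosine_grad m x $ i * G x $ i \<partial>cubeM) = (real (m i) * pi)\<^sup>2 * L2_inner v (cosine m)"
proof -
  have v: "v \<in> L2" and G: "\<And>i. (\<lambda>x. G x $ i) \<in> L2"
    and test: "\<And>\<psi> D\<psi>. (\<And>x. GDERIV \<psi> x :> D\<psi> x) \<Longrightarrow> continuous_on UNIV D\<psi> \<Longrightarrow>
        compact (closure {x. \<psi> x \<noteq> 0}) \<Longrightarrow> closure {x. \<psi> x \<noteq> 0} \<subseteq> box 0 1 \<Longrightarrow>
        (\<integral>x. v x *\<^sub>R D\<psi> x \<partial>cubeM) = - (\<integral>x. \<psi> x *\<^sub>R G x \<partial>cubeM)"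
    using vG unfolding weak_gradient_def by auto
  \<comment> \<open>The factors of \<open>\<partial>\<^sub>i\<close> of the cosine product, and their truncations \<open>\<rho> n j\<close>.\<close>
  define h where "h j = (if j = i then cos_mode_deriv (m j) else cos_mode (m j))" for j
  define h' where "h' j s = (if j = i then - ((real (m j) * pi)\<^sup>2 * cos_mode (m j) s) else cos_mode_deriv (m j) s)" for j s
  have h': "(h j has_real_derivative h' j s) (at s)" for j s
    by (simp add: h_def h'_def DERIV_cos_mode DERIV_cos_mode_deriv)
  have hc: "continuous_on S (h j)" for j S
    by (simp add: h_def continuous_cos_mode continuous_cos_mode_deriv)
  have h'c: "continuous_on S (h' j)" for j S
    unfolding h'_def
    by (cases "j = i") (auto intro!: continuous_intros continuous_cos_mode continuous_cos_mode_deriv)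
  define \<delta> where "\<delta> n = 1 / real (Suc n)" for n
  have \<delta>: "\<delta> n > 0" for n by (simp add: \<delta>_def)
  define \<rho> where "\<rho> n j s = cutoff (\<delta> n) s * h j s" for n j s
  define \<rho>' where "\<rho>' n j s = cutoff_deriv (\<delta> n) s * h j s + cutoff (\<delta> n) s * h' j s" for n j s
  have \<rho>': "(\<rho> n j has_real_derivative \<rho>' n j s) (at s)" for n j s
    unfolding \<rho>_def[abs_def] \<rho>'_def
    by (rule DERIV_cong[OF DERIV_mult[OF DERIV_cutoff[OF \<delta>] h']]) simp
  have \<rho>c: "continuous_on S (\<rho> n j)" for n j S
    unfolding \<rho>_def[abs_def] by (intro continuous_intros continuous_cutoff \<delta> hc)
  have \<rho>'c: "continuous_on S (\<rho>' n j)" for n j S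
    unfolding \<rho>'_def[abs_def] by (intro continuous_intros continuous_cutoff continuous_cutoff_deriv \<delta> hc h'c)
  define \<psi> where "\<psi> n x = (\<Prod>j\<in>UNIV. \<rho> n j (x $ j))" for n and x :: "real^'d"
  define D\<psi> where "D\<psi> n x = (\<chi> k. \<rho>' n k (x $ k) * (\<Prod>j\<in>UNIV-{k}. \<rho> n j (x $ j)))" for n and x :: "real^'d"
  have gd: "GDERIV (\<psi> n) x :> D\<psi> n x" for n x
    unfolding \<psi>_def[abs_def] D\<psi>_def by (rule GDERIV_prod_coordinates) (rule \<rho>')
  have \<psi>c: "continuous_on S (\<psi> n)" for n S
    unfolding \<psi>_def[abs_def] by (rule continuous_on_prod_coordinates) (rule \<rho>c)
  have D\<psi>c: "continuous_on S (D\<psi> n)" for n S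
  proof -
    have "continuous_on S (\<lambda>x::real^'d. \<rho>' n k (x $ k))" for k
      by (rule continuous_on_compose2[OF \<rho>'c[of UNIV]]) (auto intro: continuous_intros)
    then show ?thesis
      unfolding D\<psi>_def[abs_def]
      by (intro continuous_on_vec_lambda continuous_on_mult)
        (auto intro: continuous_on_prod_coordinates \<rho>c)
  qed
  have supp: "closure {x. \<psi> n x \<noteq> 0} \<subseteq> {x. \<forall>j. \<delta> n \<le> x $ j * (1 - x $ j)}" for n
  proof (rule closure_minimal)
    show "{x. \<psi> n x \<noteq> 0} \<subseteq> {x. \<forall>j. \<delta> n \<le> x $ j * (1 - x $ j)}"
    proof safe
      fix x j assume "\<psi> n x \<noteq> 0"
      then have "\<rho> n j (x $ j) \<noteq> 0" by (auto simp: \<psi>_def)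
      then have "cutoff (\<delta> n) (x $ j) \<noteq> 0" by (auto simp: \<rho>_def)
      from cutoff_nonzeroD[OF this] show "\<delta> n \<le> x $ j * (1 - x $ j)" by simp
    qed
    have "{x::real^'d. \<forall>j. \<delta> n \<le> x $ j * (1 - x $ j)} = (\<Inter>j. {x. \<delta> n \<le> x $ j * (1 - x $ j)})" by auto
    moreover have "closed {x::real^'d. \<delta> n \<le> x $ j * (1 - x $ j)}" for j
      by (intro closed_Collect_le continuous_intros)
    ultimately show "closed {x::real^'d. \<forall>j. \<delta> n \<le> x $ j * (1 - x $ j)}" by auto
  qed
  have "{x::real^'d. \<forall>j. \<delta> n \<le> x $ j * (1 - x $ j)} \<subseteq> box 0 1" for n
  proof
    fix x :: "real^'d" assume "x \<in> {x. \<forall>j. \<delta> n \<le> x $ j * (1 - x $ j)}"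
    then have "0 < x $ j * (1 - x $ j)" for j using \<delta>[of n] by (auto intro: less_le_trans)
    then show "x \<in> box 0 1" by (auto simp: mem_box_cart zero_less_mult_iff) (smt (verit))+
  qed
  with supp have supp': "closure {x. \<psi> n x \<noteq> 0} \<subseteq> box 0 1" for n by blast
  have cpt: "compact (closure {x. \<psi> n x \<noteq> 0})" for n
    using bounded_subset[OF bounded_box supp'[of n]] by (simp add: compact_eq_bounded_closed)
  have vm[measurable]: "v \<in> borel_measurable cubeM" and Gm[measurable]: "(\<lambda>x. G x $ i) \<in> borel_measurable cubeM"
    using v G by (auto simp: L2_iff)
  have cm: "f \<in> borel_measurable cubeM" if "continuous_on UNIV f" for f :: "real^'d \<Rightarrow> real"
    by (intro borel_measurable_cubeM_I borel_measurable_continuous_onI that)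
  obtain B where B: "B \<ge> 0" "\<And>j s. s \<in> {0..1} \<Longrightarrow> \<bar>h j s\<bar> \<le> B" "\<And>s. s \<in> {0..1} \<Longrightarrow> \<bar>h' i s\<bar> \<le> B"
  proof -
    have "bounded (\<Union>j. h j ` {0..1})" "bounded (h' i ` {0..1})"
      by (intro bounded_UN finite ballI compact_imp_bounded compact_continuous_image hc h'c compact_Icc)+
    then have "bounded ((\<Union>j. h j ` {0..1}) \<union> h' i ` {0..1})" by simp
    then obtain B where B: "\<forall>y\<in>(\<Union>j. h j ` {0..1}) \<union> h' i ` {0..1}. norm y \<le> B"
      unfolding bounded_iff by blast
    have "\<bar>h j s\<bar> \<le> max B 0" "\<bar>h' i s\<bar> \<le> max B 0" if s: "s \<in> {0..1}" for j s
    proof -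
      have "h j s \<in> (\<Union>j. h j ` {0..1}) \<union> h' i ` {0..1}" "h' i s \<in> (\<Union>j. h j ` {0..1}) \<union> h' i ` {0..1}"
        using s by blast+
      then have "norm (h j s) \<le> B" "norm (h' i s) \<le> B" using B by blast+
      then show "\<bar>h j s\<bar> \<le> max B 0" "\<bar>h' i s\<bar> \<le> max B 0" by simp_all
    qed
    then show ?thesis by (intro that[of "max B 0"]) auto
  qed
  define C where "C = 2 * sqrt 2 * (real (m i) * pi)\<^sup>2 * 3 + B"
  have C: "C \<ge> 0" using B by (simp add: C_def)
  have \<rho>_le: "\<bar>\<rho> n j s\<bar> \<le> B" if "s \<in> {0<..<1}" for n j s
    using mult_mono[OF abs_cutoff_le[of "\<delta> n" s] B(2)[of s j]] that B(1) by (auto simp: \<rho>_def abs_mult)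
  have \<rho>'_le: "\<bar>\<rho>' n i s\<bar> \<le> C" if s: "s \<in> {0<..<1}" for n s
  proof -
    have "\<bar>cutoff_deriv (\<delta> n) s * h i s\<bar> \<le>
        \<bar>cutoff_deriv (\<delta> n) s\<bar> * (2 * sqrt 2 * (real (m i) * pi)\<^sup>2 * (s * (1 - s)))"
      using s abs_cos_mode_deriv_le[of s "m i"] by (auto simp: abs_mult h_def intro!: mult_left_mono)
    also have "\<dots> = 2 * sqrt 2 * (real (m i) * pi)\<^sup>2 * (s * (1 - s) * \<bar>cutoff_deriv (\<delta> n) s\<bar>)" by simp
    also have "\<dots> \<le> 2 * sqrt 2 * (real (m i) * pi)\<^sup>2 * 3"
      using s by (intro mult_left_mono abs_cutoff_deriv_le \<delta>) auto
    finally have 1: "\<bar>cutoff_deriv (\<delta> n) s * h i s\<bar> \<le> 2 * sqrt 2 * (real (m i) * pi)\<^sup>2 * 3" .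
    have 2: "\<bar>cutoff (\<delta> n) s * h' i s\<bar> \<le> B"
      using mult_mono[OF abs_cutoff_le[of "\<delta> n" s] B(3)[of s]] s B(1) by (auto simp: abs_mult)
    show ?thesis unfolding \<rho>'_def C_def using 1 2 by linarith
  qed
  have prod_le: "\<bar>\<Prod>j\<in>A. \<rho> n j (x $ j)\<bar> \<le> B ^ card A" if "x \<in> box 0 1" for n A x
  proof -
    have "\<bar>\<Prod>j\<in>A. \<rho> n j (x $ j)\<bar> = (\<Prod>j\<in>A. \<bar>\<rho> n j (x $ j)\<bar>)" by (rule abs_prod)
    also have "\<dots> \<le> (\<Prod>j\<in>A. B)" using that by (intro prod_mono) (auto intro!: \<rho>_le simp: mem_box_cart)
    finally show ?thesis by simp
  qed
  have lim\<rho>: "(\<lambda>n. \<rho> n j s) \<longlonglongrightarrow> h j s" "(\<lambda>n. \<rho>' n j s) \<longlonglongrightarrow> h' j s" if "s \<in> {0<..<1}" for j s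
  proof -
    have *: "(\<lambda>n. cutoff (\<delta> n) s) \<longlonglongrightarrow> 1" "(\<lambda>n. cutoff_deriv (\<delta> n) s) \<longlonglongrightarrow> 0"
      using cutoff_tendsto that by (auto simp: \<delta>_def)
    have "(\<lambda>n. \<rho> n j s) \<longlonglongrightarrow> 1 * h j s" unfolding \<rho>_def by (intro tendsto_intros *)
    then show "(\<lambda>n. \<rho> n j s) \<longlonglongrightarrow> h j s" by simp
    have "(\<lambda>n. \<rho>' n j s) \<longlonglongrightarrow> 0 * h j s + 1 * h' j s" unfolding \<rho>'_def by (intro tendsto_intros *)
    then show "(\<lambda>n. \<rho>' n j s) \<longlonglongrightarrow> h' j s" by simp
  qed
  have lim\<psi>: "(\<lambda>n. \<psi> n x) \<longlonglongrightarrow> cosine_grad m x $ i" if x: "x \<in> box 0 1" for x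
  proof -
    have "cosine_grad m x $ i = (\<Prod>j\<in>UNIV. h j (x $ j))"
      by (subst prod.remove[of UNIV i]) (auto simp: cosine_grad_def h_def intro!: prod.cong)
    then show ?thesis
      unfolding \<psi>_def using x by (auto intro!: tendsto_prod lim\<rho> simp: mem_box_cart)
  qed
  have limD\<psi>: "(\<lambda>n. D\<psi> n x $ i) \<longlonglongrightarrow> - ((real (m i) * pi)\<^sup>2 * cosine m x)" if x: "x \<in> box 0 1" for x
  proof -
    have "cosine m x = cos_mode (m i) (x $ i) * (\<Prod>j\<in>UNIV-{i}. cos_mode (m j) (x $ j))"
      unfolding cosine_def by (rule prod.remove) auto
    then have "- ((real (m i) * pi)\<^sup>2 * cosine m x) = h' i (x $ i) * (\<Prod>j\<in>UNIV-{i}. h j (x $ j))"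
      by (auto simp: h'_def h_def intro!: prod.cong)
    then show ?thesis
      unfolding D\<psi>_def using x by (auto intro!: tendsto_mult tendsto_prod lim\<rho> simp: mem_box_cart)
  qed
  have int\<psi>: "integrable cubeM (\<lambda>x. \<psi> n x *\<^sub>R G x)" "integrable cubeM (\<lambda>x. v x *\<^sub>R D\<psi> n x)" for n
  proof -
    have b: "integrable cubeM (\<lambda>x. f x * w x)"
      if f: "continuous_on UNIV f" and w: "w \<in> L2" for f w :: "real^'d \<Rightarrow> real"
    proof -
      have "bounded (f ` cbox 0 1)"
        by (intro compact_imp_bounded compact_continuous_image continuous_on_subset[OF f]) auto
      then obtain B where "\<And>x. x \<in> cbox 0 1 \<Longrightarrow> \<bar>f x\<bar> \<le> B" by (auto simp: bounded_iff)
      then show ?thesis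
        using box_subset_cbox by (intro L2_integrable L2_mult_bounded[OF w cm[OF f], of B]) blast
    qed
    show "integrable cubeM (\<lambda>x. \<psi> n x *\<^sub>R G x)"
      by (rule integrable_vecI) (simp add: b[OF \<psi>c G])
    show "integrable cubeM (\<lambda>x. v x *\<^sub>R D\<psi> n x)"
      by (rule integrable_vecI) (simp add: b[OF continuous_on_component[OF D\<psi>c] v] mult.commute[of "v _"])
  qed
  have id: "(\<integral>x. v x * D\<psi> n x $ i \<partial>cubeM) = - (\<integral>x. \<psi> n x * G x $ i \<partial>cubeM)" for n
  proof -
    have "(\<integral>x. v x *\<^sub>R D\<psi> n x \<partial>cubeM) $ i = (- (\<integral>x. \<psi> n x *\<^sub>R G x \<partial>cubeM)) $ i"
      using test[OF gd D\<psi>c cpt supp'] by simp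
    then show ?thesis using int\<psi> by (simp add: vec_integral_nth)
  qed
  have "(\<lambda>n. \<integral>x. \<psi> n x * G x $ i \<partial>cubeM) \<longlonglongrightarrow> (\<integral>x. cosine_grad m x $ i * G x $ i \<partial>cubeM)"
  proof (rule integral_dominated_convergence)
    show "integrable cubeM (\<lambda>x. B ^ CARD('d) * \<bar>G x $ i\<bar>)" using L2_integrable[OF G] by simp
    show "(\<lambda>x. cosine_grad m x $ i * G x $ i) \<in> borel_measurable cubeM"
      using cosine_grad_L2[of m i] Gm by (auto simp: L2_iff)
    show "(\<lambda>x. \<psi> n x * G x $ i) \<in> borel_measurable cubeM" for n
      by (intro borel_measurable_times cm \<psi>c Gm)
    show "AE x in cubeM. (\<lambda>n. \<psi> n x * G x $ i) \<longlonglongrightarrow> cosine_grad m x $ i * G x $ i"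
      by (rule AE_I2) (auto simp: space_cubeM intro!: tendsto_intros lim\<psi>)
    show "AE x in cubeM. norm (\<psi> n x * G x $ i) \<le> B ^ CARD('d) * \<bar>G x $ i\<bar>" for n
      using prod_le[of _ n UNIV] by (intro AE_I2) (auto simp: \<psi>_def space_cubeM abs_mult intro!: mult_right_mono)
  qed
  moreover have "(\<lambda>n. \<integral>x. v x * D\<psi> n x $ i \<partial>cubeM) \<longlonglongrightarrow> (\<integral>x. v x * - ((real (m i) * pi)\<^sup>2 * cosine m x) \<partial>cubeM)"
  proof (rule integral_dominated_convergence)
    show "integrable cubeM (\<lambda>x. \<bar>v x\<bar> * (C * B ^ (CARD('d) - 1)))" using L2_integrable[OF v] by simp
    show "(\<lambda>x. v x * - ((real (m i) * pi)\<^sup>2 * cosine m x)) \<in> borel_measurable cubeM"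
      using cosine_L2[of m] v by (auto simp: L2_iff)
    show "(\<lambda>x. v x * D\<psi> n x $ i) \<in> borel_measurable cubeM" for n
      by (intro borel_measurable_times cm continuous_on_component D\<psi>c vm)
    show "AE x in cubeM. (\<lambda>n. v x * D\<psi> n x $ i) \<longlonglongrightarrow> v x * - ((real (m i) * pi)\<^sup>2 * cosine m x)"
      by (rule AE_I2) (intro tendsto_intros limD\<psi>, simp add: space_cubeM)
    have "\<bar>D\<psi> n x $ i\<bar> \<le> C * B ^ (CARD('d) - 1)" if x: "x \<in> box 0 1" for n x
      using mult_mono[OF \<rho>'_le[of "x $ i" n] prod_le[OF x, of n "UNIV - {i}"]] x C
      by (auto simp: D\<psi>_def abs_mult mem_box_cart)
    then show "AE x in cubeM. norm (v x * D\<psi> n x $ i) \<le> \<bar>v x\<bar> * (C * B ^ (CARD('d) - 1))" for n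
      by (intro AE_I2) (auto simp: space_cubeM abs_mult intro!: mult_left_mono)
  qed
  ultimately have "(\<integral>x. v x * - ((real (m i) * pi)\<^sup>2 * cosine m x) \<partial>cubeM) =
      - (\<integral>x. cosine_grad m x $ i * G x $ i \<partial>cubeM)"
    unfolding id by (intro LIMSEQ_unique[OF _ tendsto_minus])
  moreover have "(\<lambda>x. v x * - ((real (m i) * pi)\<^sup>2 * cosine m x)) =
      (\<lambda>x. - ((real (m i) * pi)\<^sup>2) * (v x * cosine m x))"
    by (simp add: fun_eq_iff)
  ultimately have "(\<integral>x. - ((real (m i) * pi)\<^sup>2) * (v x * cosine m x) \<partial>cubeM) =
      - (\<integral>x. cosine_grad m x $ i * G x $ i \<partial>cubeM)"
    by (simp only:)
  then show ?thesis unfolding integral_mult_right_zero L2_inner_def by simp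
qed

section \<open>The semigroup acts diagonally on cosines\<close>

lemma neumann_eigenfunction_cosine:
  fixes e :: "real^'d::finite \<Rightarrow> real"
  assumes e: "neumann_laplacian e (\<lambda>x. - lam * e x)" and ne: "neumann_eigenvalue m \<noteq> lam"
  shows "L2_inner e (cosine m) = 0"
proof -
  obtain G where G: "weak_gradient e G"
    and test: "\<And>w H. weak_gradient w H \<Longrightarrow> (\<integral>x. G x \<bullet> H x \<partial>cubeM) = - L2_inner (\<lambda>x. - lam * e x) w"
    using e unfolding neumann_laplacian_def by blast
  have GL: "(\<lambda>x. G x $ i) \<in> L2" for i using G by (simp add: weak_gradient_def)
  have "lam * L2_inner e (cosine m) = (\<integral>x. G x \<bullet> cosine_grad m x \<partial>cubeM)"
    using test[OF weak_gradient_cosine[of m]] L2_inner_scale_left[of "- lam" e "cosine m"] by simp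
  also have "\<dots> = (\<integral>x. (\<Sum>i\<in>UNIV. cosine_grad m x $ i * G x $ i) \<partial>cubeM)"
    by (simp add: inner_vec_def mult.commute)
  also have "\<dots> = (\<Sum>i\<in>UNIV. \<integral>x. cosine_grad m x $ i * G x $ i \<partial>cubeM)"
    by (intro Bochner_Integration.integral_sum L2_integrable_mult GL cosine_grad_L2)
  also have "\<dots> = neumann_eigenvalue m * L2_inner e (cosine m)"
    by (simp add: weak_gradient_cosine_parts[OF G] neumann_eigenvalue_def sum_distrib_right)
  finally show ?thesis using ne by simp
qed

lemma finite_neumann_eigenvalue_eq: "finite {m :: 'd::finite \<Rightarrow> nat. neumann_eigenvalue m = l}"
proof -
  obtain N where N: "l < real N" using reals_Archimedean2 by blast
  have "{m :: 'd \<Rightarrow> nat. neumann_eigenvalue m = l} \<subseteq> PiE UNIV (\<lambda>_. {..N})"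
  proof
    fix m :: "'d \<Rightarrow> nat" assume "m \<in> {m. neumann_eigenvalue m = l}"
    then have l: "neumann_eigenvalue m = l" by simp
    have "m i \<le> N" for i
    proof (cases "m i = 0")
      case False
      have "1 \<le> pi * pi" using pi_ge_two mult_mono[of 1 pi 1 pi] by simp
      have "real (m i) * 1 \<le> real (m i) * (real (m i) * (pi * pi))"
        using mult_mono[of 1 "real (m i)" 1 "pi * pi"] \<open>1 \<le> pi * pi\<close> False by (intro mult_left_mono) auto
      also have "\<dots> = (real (m i) * pi)\<^sup>2" by (simp add: power2_eq_square)
      also have "\<dots> \<le> neumann_eigenvalue m"
        unfolding neumann_eigenvalue_def by (rule member_le_sum) auto
      also have "\<dots> < real N" using N l by simp
      finally show ?thesis by simp
    qed simp
    then show "m \<in> PiE UNIV (\<lambda>_. {..N})" by (auto simp: PiE_iff)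
  qed
  moreover have "finite (PiE (UNIV :: 'd set) (\<lambda>_. {..N}))" by (intro finite_PiE) auto
  ultimately show ?thesis by (rule finite_subset)
qed

text \<open>Every eigenfunction with eigenvalue \<open>l\<close> is a combination of the finitely many cosine products
  with that eigenvalue, so by Bessel's inequality an orthonormal family contains only finitely many.\<close>

lemma finite_eigenspace:
  fixes e :: "nat \<Rightarrow> real^'d::finite \<Rightarrow> real"
  assumes basis: "neumann_eigenbasis e lam"
  shows "finite {k. lam k = l}"
proof -
  have e: "e k \<in> L2" "neumann_laplacian (e k) (\<lambda>x. - lam k * e k x)" for k
    using basis by (auto simp: neumann_eigenbasis_def)
  have on: "L2_inner (e j) (e k) = (if j = k then 1 else 0)" for j k
    using basis by (auto simp: neumann_eigenbasis_def)
  define A where "A = {m :: 'd \<Rightarrow> nat. neumann_eigenvalue m = l}"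
  have A: "finite A" unfolding A_def by (rule finite_neumann_eigenvalue_eq)
  have card: "card K \<le> card A" if K: "K \<subseteq> {k. lam k = l}" "finite K" for K
  proof -
    have "(\<Sum>m\<in>A. (L2_inner (cosine m) (e k))\<^sup>2) = 1" if k: "k \<in> K" for k
    proof -
      have AE: "AE x in cubeM. e k x = (\<Sum>m\<in>A. L2_inner (e k) (cosine m) * cosine m x)"
      proof (rule finite_cosine_expansion[OF e(1) A])
        fix m assume "m \<notin> A"
        then have "neumann_eigenvalue m \<noteq> lam k" using k K by (auto simp: A_def)
        then show "L2_inner (e k) (cosine m) = 0" by (rule neumann_eigenfunction_cosine[OF e(2)])
      qed
      have "1 = L2_inner (e k) (e k)" by (simp add: on)
      also have "\<dots> = L2_inner (\<lambda>x. \<Sum>m\<in>A. L2_inner (e k) (cosine m) * cosine m x) (e k)"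
        by (rule L2_inner_cong_AE[OF AE e(1) _ e(1)], rule L2_sum, rule L2_scale, rule cosine_L2)
      also have "\<dots> = (\<Sum>m\<in>A. (L2_inner (cosine m) (e k))\<^sup>2)"
        by (subst L2_inner_lincomb_left)
          (auto simp: cosine_L2 e L2_inner_commute[of "e k"] power2_eq_square)
      finally show ?thesis by simp
    qed
    then have "real (card K) = (\<Sum>k\<in>K. \<Sum>m\<in>A. (L2_inner (cosine m) (e k))\<^sup>2)" by simp
    also have "\<dots> = (\<Sum>m\<in>A. \<Sum>k\<in>K. (L2_inner (cosine m) (e k))\<^sup>2)" by (rule sum.swap)
    also have "\<dots> \<le> (\<Sum>m\<in>A. L2_inner (cosine m :: real^'d \<Rightarrow> real) (cosine m))"
      using K by (intro sum_mono L2_Bessel e on cosine_L2) auto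
    also have "\<dots> = real (card A)" by (simp add: cosine_orthonormal)
    finally show "card K \<le> card A" by simp
  qed
  then show ?thesis using finite_if_finite_subsets_card_bdd[of "{k. lam k = l}" "card A"] by blast
qed

text \<open>On cosine products the abstractly defined semigroup acts by multiplication, whatever eigenbasis
  was used to define it.\<close>

lemma exp_bilaplacian_cosine:
  fixes v w :: "real^'d::finite \<Rightarrow> real"
  assumes "exp_bilaplacian \<epsilon> t v w"
  shows "L2_inner w (cosine m) = exp (- \<epsilon> * (neumann_eigenvalue m)\<^sup>2 * t) * L2_inner v (cosine m)"
proof -
  define l where "l = neumann_eigenvalue m"
  define q where "q = exp (- \<epsilon> * l\<^sup>2 * t)"
  obtain e lam where v: "v \<in> L2" and w: "w \<in> L2" and basis: "neumann_eigenbasis e lam"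
    and lim: "(\<lambda>n. Lp_pow 2 (\<lambda>x. w x - (\<Sum>k<n. exp (- \<epsilon> * (lam k)\<^sup>2 * t) * L2_inner v (e k) * e k x))) \<longlonglongrightarrow> 0"
    using assms unfolding exp_bilaplacian_def by blast
  have e: "e k \<in> L2" "neumann_laplacian (e k) (\<lambda>x. - lam k * e k x)" for k
    using basis by (auto simp: neumann_eigenbasis_def)
  have on: "L2_inner (e j) (e k) = (if j = k then 1 else 0)" for j k
    using basis by (auto simp: neumann_eigenbasis_def)
  have total: "AE x in cubeM. y x = 0" if "y \<in> L2" "\<And>k. L2_inner y (e k) = 0" for y
    using basis that by (auto simp: neumann_eigenbasis_def)
  define F where "F = {k. lam k = l}"
  have F: "finite F" unfolding F_def by (rule finite_eigenspace[OF basis])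
  have ortho: "L2_inner (e k) (cosine m) = 0" if "k \<notin> F" for k
    by (rule neumann_eigenfunction_cosine[OF e(2)]) (use that in \<open>auto simp: F_def l_def\<close>)
  \<comment> \<open>The cosine product is its own projection onto the finitely many basis functions with the same
    eigenvalue, since the remainder is orthogonal to the whole basis.\<close>
  define p where "p x = (\<Sum>k\<in>F. L2_inner (e k) (cosine m) * e k x)" for x
  have p: "p \<in> L2" unfolding p_def by (rule L2_sum, rule L2_scale, rule e)
  have "AE x in cubeM. cosine m x - p x = 0"
  proof (rule total)
    show "(\<lambda>x. cosine m x - p x) \<in> L2" by (rule L2_diff[OF cosine_L2 p])
    fix j
    have "L2_inner p (e j) = (\<Sum>k\<in>F. if k = j then L2_inner (e k) (cosine m) else 0)"
      unfolding p_def by (subst L2_inner_lincomb_left) (auto simp: e on intro!: sum.cong)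
    also have "\<dots> = L2_inner (cosine m) (e j)"
      using F ortho[of j] by (simp add: sum.delta' L2_inner_commute)
    finally show "L2_inner (\<lambda>x. cosine m x - p x) (e j) = 0"
      by (simp add: L2_inner_diff_left[OF cosine_L2 p e(1)])
  qed
  then have AEp: "AE x in cubeM. cosine m x = p x" by simp
  have vm: "L2_inner v (cosine m) = (\<Sum>k\<in>F. L2_inner v (e k) * L2_inner (e k) (cosine m))"
  proof -
    have "L2_inner v (cosine m) = L2_inner p v"
      using L2_inner_cong_AE[OF AEp cosine_L2 p v] by (simp add: L2_inner_commute)
    also have "\<dots> = (\<Sum>k\<in>F. L2_inner v (e k) * L2_inner (e k) (cosine m))"
      unfolding p_def by (subst L2_inner_lincomb_left) (auto simp: e v L2_inner_commute[of _ v] mult.commute)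
    finally show ?thesis .
  qed
  obtain N where N: "F \<subseteq> {..<N}" using finite_nat_iff_bounded F by blast
  define s where "s n x = (\<Sum>k<n. exp (- \<epsilon> * (lam k)\<^sup>2 * t) * L2_inner v (e k) * e k x)" for n x
  have sL: "s n \<in> L2" for n unfolding s_def by (rule L2_sum, rule L2_scale, rule e)
  have sm: "L2_inner (s n) (cosine m) = q * L2_inner v (cosine m)" if n: "n \<ge> N" for n
  proof -
    have "L2_inner (s n) (cosine m) =
        (\<Sum>k<n. exp (- \<epsilon> * (lam k)\<^sup>2 * t) * L2_inner v (e k) * L2_inner (e k) (cosine m))"
      unfolding s_def by (subst L2_inner_lincomb_left) (auto simp: e cosine_L2)
    also have "\<dots> = (\<Sum>k\<in>F. exp (- \<epsilon> * (lam k)\<^sup>2 * t) * L2_inner v (e k) * L2_inner (e k) (cosine m))"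
      by (rule sum.mono_neutral_right) (use N n in \<open>auto simp: ortho\<close>)
    also have "\<dots> = (\<Sum>k\<in>F. q * (L2_inner v (e k) * L2_inner (e k) (cosine m)))"
      by (intro sum.cong) (auto simp: F_def q_def)
    finally show ?thesis by (simp add: vm sum_distrib_left)
  qed
  define z where "z = L2_inner w (cosine m) - q * L2_inner v (cosine m)"
  have "ennreal (z\<^sup>2) \<le> Lp_pow 2 (\<lambda>x. w x - s n x)" if n: "n \<ge> N" for n
  proof -
    have "L2_inner (\<lambda>x. w x - s n x) (cosine m) = z"
      by (simp add: L2_inner_diff_left[OF w sL cosine_L2] sm[OF n] z_def)
    then show ?thesis
      using L2_inner_Cauchy_Schwarz_ennreal[OF L2_measurable[OF L2_diff[OF w sL]] cosine_L2, of n m]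
      by (simp add: cosine_orthonormal)
  qed
  then have "ennreal (z\<^sup>2) \<le> 0"
    by (intro LIMSEQ_le_const[OF lim[folded s_def]]) auto
  then show ?thesis by (simp add: z_def q_def l_def)
qed

section \<open>Brownian motion: isometry, Hoelder constants and exponential convolutions\<close>

lemma brownian_increment_even_moment:
  assumes M: "prob_space M" and B: "brownian_motion M B" and st: "0 \<le> s" "s \<le> t" and k: "k > 0"
  shows "has_bochner_integral M (\<lambda>\<omega>. (B t \<omega> - B s \<omega>) ^ (2 * k)) (fact (2 * k) / (2 ^ k * fact k) * (t - s) ^ k)"
proof (cases "s = t")
  case True
  then show ?thesis using k by (simp add: has_bochner_integral_zero power_0_left)
next
  case False
  then have lt: "s < t" using st by simp
  interpret prob_space M by fact
  have D: "distributed M lborel (\<lambda>\<omega>. B t \<omega> - B s \<omega>) (\<lambda>x. ennreal (normal_density 0 (sqrt (t - s)) x))"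
    using B lt st by (auto simp: brownian_motion_def)
  have pos: "0 < sqrt (t - s)" using lt by simp
  have mom: "has_bochner_integral lborel (\<lambda>x. normal_density 0 (sqrt (t - s)) x * x ^ (2 * k))
      (fact (2 * k) / ((2 / (t - s)) ^ k * fact k))"
    using normal_moment_even[OF pos, of 0 k] lt by simp
  have int: "integrable M (\<lambda>\<omega>. (B t \<omega> - B s \<omega>) ^ (2 * k))"
    using distributed_integrable[OF D, of "\<lambda>x. x ^ (2 * k)"] has_bochner_integral_iff[THEN iffD1, OF mom]
    by simp
  have "(\<integral>\<omega>. (B t \<omega> - B s \<omega>) ^ (2 * k) \<partial>M) = fact (2 * k) / ((2 / (t - s)) ^ k * fact k)"
    using distributed_integral[OF D, of "\<lambda>x. x ^ (2 * k)"] has_bochner_integral_iff[THEN iffD1, OF mom]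
    by simp
  also have "\<dots> = fact (2 * k) / (2 ^ k * fact k) * (t - s) ^ k"
    using lt by (simp add: power_divide)
  finally show ?thesis using int by (simp add: has_bochner_integral_iff)
qed

lemma brownian_increment_variance:
  assumes M: "prob_space M" and B: "brownian_motion M B" and st: "0 \<le> s" "0 \<le> t"
  shows "has_bochner_integral M (\<lambda>\<omega>. (B t \<omega> - B s \<omega>)\<^sup>2) \<bar>t - s\<bar>"
proof (cases "s \<le> t")
  case True
  then show ?thesis
    using brownian_increment_even_moment[OF M B st(1) True, of 1] by (simp add: fact_numeral)
next
  case False
  then have "t \<le> s" by simp
  then show ?thesis
    using brownian_increment_even_moment[OF M B st(2), of s 1]
    by (simp add: fact_numeral power2_commute[of "B t _"])
qed

text \<open>If the mean square of \<open>X\<^sub>p - X\<^sub>q\<close> is \<open>|p - q|\<close>, polarization determines the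
  mean square of every linear combination of increments.\<close>

lemma increments_quadratic_form:
  fixes X :: "real \<Rightarrow> 'a \<Rightarrow> real"
  assumes X: "\<And>p q. 0 \<le> p \<Longrightarrow> 0 \<le> q \<Longrightarrow> has_bochner_integral M (\<lambda>\<omega>. (X p \<omega> - X q \<omega>)\<^sup>2) \<bar>p - q\<bar>"
    and ab: "\<And>i. i \<in> I \<Longrightarrow> 0 \<le> a i" "\<And>i. i \<in> I \<Longrightarrow> 0 \<le> b i"
  shows "has_bochner_integral M (\<lambda>\<omega>. (\<Sum>i\<in>I. c i * (X (b i) \<omega> - X (a i) \<omega>))\<^sup>2)
    (\<Sum>i\<in>I. \<Sum>j\<in>I. c i * c j / 2 * (\<bar>b i - a j\<bar> + \<bar>a i - b j\<bar> - \<bar>b i - b j\<bar> - \<bar>a i - a j\<bar>))"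
proof -
  have eq: "(\<Sum>i\<in>I. c i * (X (b i) \<omega> - X (a i) \<omega>))\<^sup>2 =
      (\<Sum>i\<in>I. \<Sum>j\<in>I. c i * c j / 2 * ((X (b i) \<omega> - X (a j) \<omega>)\<^sup>2 + (X (a i) \<omega> - X (b j) \<omega>)\<^sup>2
        - (X (b i) \<omega> - X (b j) \<omega>)\<^sup>2 - (X (a i) \<omega> - X (a j) \<omega>)\<^sup>2))" for \<omega>
  proof -
    have pol: "x * (b - a) * (y * (b' - a')) =
        x * y / 2 * ((b - a')\<^sup>2 + (a - b')\<^sup>2 - (b - b')\<^sup>2 - (a - a')\<^sup>2)" for x y a b a' b' :: real
      by (simp add: power2_eq_square field_simps)
    show ?thesis unfolding power2_eq_square[of "\<Sum>i\<in>I. _ i"] sum_product by (simp only: pol)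
  qed
  show ?thesis
    unfolding eq
    by (intro has_bochner_integral_sum has_bochner_integral_mult_right has_bochner_integral_diff
        has_bochner_integral_add X ab)
qed

lemma has_bochner_integral_indicator_increment:
  fixes p q :: real
  assumes "0 \<le> p" "0 \<le> q"
  shows "has_bochner_integral lborel (\<lambda>s. (indicator {0<..p} s - indicator {0<..q} s)\<^sup>2) \<bar>p - q\<bar>"
proof -
  have "(\<lambda>s. (indicator {0<..p} s - indicator {0<..q} s)\<^sup>2 :: real) = indicator {min p q<..max p q}"
    using assms by (auto simp: fun_eq_iff indicator_def)
  moreover have "has_bochner_integral lborel (indicator {min p q<..max p q} :: real \<Rightarrow> real)
      (measure lborel {min p q<..max p q})"
    by (rule has_bochner_integral_real_indicator) auto
  moreover have "measure lborel {min p q<..max p q} = \<bar>p - q\<bar>" by (simp add: max_def min_def)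
  ultimately show ?thesis by simp
qed

text \<open>The Ito isometry.  The intervals need not be disjoint, so that it also compares integrals of
  step functions over different partitions.\<close>

lemma wiener_isometry:
  assumes M: "prob_space M" and B: "brownian_motion M B"
    and ab: "\<And>i. i \<in> I \<Longrightarrow> 0 \<le> a i" "\<And>i. i \<in> I \<Longrightarrow> a i \<le> b i"
  shows "integrable M (\<lambda>\<omega>. (\<Sum>i\<in>I. c i * (B (b i) \<omega> - B (a i) \<omega>))\<^sup>2)"
    and "integrable lborel (\<lambda>s. (\<Sum>i\<in>I. c i * indicator {a i<..b i} s)\<^sup>2)"
    and "(\<integral>\<omega>. (\<Sum>i\<in>I. c i * (B (b i) \<omega> - B (a i) \<omega>))\<^sup>2 \<partial>M) =
      (\<integral>s. (\<Sum>i\<in>I. c i * indicator {a i<..b i} s)\<^sup>2 \<partial>lborel)"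
proof -
  have b: "0 \<le> b i" if "i \<in> I" for i using ab that order_trans by blast
  define Q where "Q = (\<Sum>i\<in>I. \<Sum>j\<in>I. c i * c j / 2 * (\<bar>b i - a j\<bar> + \<bar>a i - b j\<bar> - \<bar>b i - b j\<bar> - \<bar>a i - a j\<bar>))"
  have 1: "has_bochner_integral M (\<lambda>\<omega>. (\<Sum>i\<in>I. c i * (B (b i) \<omega> - B (a i) \<omega>))\<^sup>2) Q"
    unfolding Q_def
    by (rule increments_quadratic_form) (auto intro: brownian_increment_variance[OF M B] ab b)
  have "has_bochner_integral lborel
      (\<lambda>s. (\<Sum>i\<in>I. c i * (indicator {0<..b i} s - indicator {0<..a i} s))\<^sup>2) Q"
    unfolding Q_def
    by (rule increments_quadratic_form[where X="\<lambda>p. indicator {0<..p}"])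
      (auto intro: has_bochner_integral_indicator_increment ab b)
  moreover have "(\<lambda>s. (\<Sum>i\<in>I. c i * (indicator {0<..b i} s - indicator {0<..a i} s))\<^sup>2) =
      (\<lambda>s. (\<Sum>i\<in>I. c i * indicator {a i<..b i} s)\<^sup>2)"
    using ab by (intro ext arg_cong[where f="\<lambda>x. x\<^sup>2"] sum.cong) (force simp: indicator_def)+
  ultimately have 2: "has_bochner_integral lborel (\<lambda>s. (\<Sum>i\<in>I. c i * indicator {a i<..b i} s)\<^sup>2) Q"
    by simp
  show "integrable M (\<lambda>\<omega>. (\<Sum>i\<in>I. c i * (B (b i) \<omega> - B (a i) \<omega>))\<^sup>2)"
    "integrable lborel (\<lambda>s. (\<Sum>i\<in>I. c i * indicator {a i<..b i} s)\<^sup>2)"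
    "(\<integral>\<omega>. (\<Sum>i\<in>I. c i * (B (b i) \<omega> - B (a i) \<omega>))\<^sup>2 \<partial>M) =
      (\<integral>s. (\<Sum>i\<in>I. c i * indicator {a i<..b i} s)\<^sup>2 \<partial>lborel)"
    using 1 2 by (auto simp: has_bochner_integral_iff)
qed

text \<open>Chaining: two points of the grid of level \<open>N\<close> whose distance is at most \<open>2\<^sup>-\<^sup>k\<close> are joined
  by at most two steps of each level between \<open>k\<close> and \<open>N\<close>.\<close>

lemma dyadic_chaining:
  fixes F :: "nat \<Rightarrow> nat \<Rightarrow> real"
  assumes nested: "\<And>n k. F (Suc n) (2 * k) = F n k"
    and step: "\<And>n k. k < 2 ^ n \<Longrightarrow> \<bar>F n (Suc k) - F n k\<bar> \<le> A * r ^ n"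
    and A: "A \<ge> 0" and r: "r \<ge> 0"
  shows "k \<le> N \<Longrightarrow> i \<le> j \<Longrightarrow> j \<le> 2 ^ N \<Longrightarrow> j - i \<le> 2 ^ (N - k) \<Longrightarrow>
    \<bar>F N j - F N i\<bar> \<le> 2 * A * (\<Sum>n=k..N. r ^ n)"
proof (induction N arbitrary: i j)
  case 0
  have nn: "0 \<le> A * r ^ 0" using A by simp
  from 0 have "j = i \<or> i = 0 \<and> j = Suc 0" by auto
  then show ?case using step[of 0 0] 0 A by auto
next
  case (Suc N)
  have pw: "0 \<le> A * r ^ n" for n using A r by simp
  show ?case
  proof (cases "k = Suc N")
    case True
    then have "j = i \<or> j = Suc i" using Suc.prems by auto
    then have "\<bar>F (Suc N) j - F (Suc N) i\<bar> \<le> A * r ^ Suc N"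
      using step[of i "Suc N"] Suc.prems pw[of "Suc N"] by auto
    also have "\<dots> \<le> 2 * A * (\<Sum>n=k..Suc N. r ^ n)" using True pw[of "Suc N"] by simp
    finally show ?thesis .
  next
    case False
    then have kN: "k \<le> N" using Suc.prems by simp
    have S: "(\<Sum>n=k..Suc N. r ^ n) = (\<Sum>n=k..N. r ^ n) + r ^ Suc N" using kN by simp
    show ?thesis
    proof (cases "i = j")
      case True
      then show ?thesis using A r by (simp add: sum_nonneg)
    next
      case ne: False
      define i' where "i' = (i + 1) div 2"
      define j' where "j' = j div 2"
      have ij': "i' \<le> j'" "j' \<le> 2 ^ N" using Suc.prems ne by (auto simp: i'_def j'_def)
      have "2 * (j' - i') \<le> j - i" by (auto simp: i'_def j'_def)
      also have "\<dots> \<le> 2 * 2 ^ (N - k)" using Suc.prems kN by (simp add: Suc_diff_le)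
      finally have d: "j' - i' \<le> 2 ^ (N - k)" by simp
      have mid: "\<bar>F N j' - F N i'\<bar> \<le> 2 * A * (\<Sum>n=k..N. r ^ n)"
        by (rule Suc.IH[OF kN ij' d])
      have lo: "\<bar>F (Suc N) (2 * i') - F (Suc N) i\<bar> \<le> A * r ^ Suc N"
      proof (cases "even i")
        case True
        then have "2 * i' = i" by (auto simp: i'_def)
        then show ?thesis using pw[of "Suc N"] by simp
      next
        case False
        then have "2 * i' = Suc i" by (auto simp: i'_def elim!: oddE)
        moreover have "i < 2 ^ Suc N" using Suc.prems ne by simp
        ultimately show ?thesis using step[of i "Suc N"] by simp
      qed
      have hi: "\<bar>F (Suc N) j - F (Suc N) (2 * j')\<bar> \<le> A * r ^ Suc N"
      proof (cases "even j")
        case True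
        then have "2 * j' = j" by (auto simp: j'_def)
        then show ?thesis using pw[of "Suc N"] by simp
      next
        case False
        then have e: "j = Suc (2 * j')" by (auto simp: j'_def elim!: oddE)
        then have "2 * j' < 2 ^ Suc N" using Suc.prems by simp
        from step[OF this] show ?thesis using e by simp
      qed
      show ?thesis using mid lo hi unfolding S nested by (simp add: algebra_simps abs_le_iff)
    qed
  qed
qed

lemma dyadic_hoelder:
  fixes F :: "nat \<Rightarrow> nat \<Rightarrow> real"
  assumes nested: "\<And>n k. F (Suc n) (2 * k) = F n k"
    and step: "\<And>n k. k < 2 ^ n \<Longrightarrow> \<bar>F n (Suc k) - F n k\<bar> \<le> A * (2 powr - \<theta>) ^ n"
    and A: "A \<ge> 0" and \<theta>: "0 < \<theta>" "\<theta> \<le> 1" and ij: "i \<le> j" "j \<le> 2 ^ N"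
  shows "\<bar>F N j - F N i\<bar> \<le> 4 / (1 - 2 powr - \<theta>) * A * (real (j - i) / 2 ^ N) powr \<theta>"
proof (cases "i = j")
  case False
  define r where "r = 2 powr - \<theta>"
  have r: "0 < r" "r < 1" using \<theta> by (auto simp: r_def powr_less_one)
  define e where "e = (LEAST e. j - i \<le> 2 ^ e)"
  have e1: "j - i \<le> 2 ^ e" unfolding e_def by (rule LeastI[of _ "j - i"]) (simp add: less_imp_le)
  have eN: "e \<le> N" unfolding e_def by (rule Least_le) (use ij in auto)
  define x where "x = real (j - i) / 2 ^ N"
  have x: "x > 0" using ij False by (simp add: x_def)
  have e2: "2 ^ e / 2 ^ N \<le> 2 * x"
  proof (cases e)
    case 0
    have "1 \<le> real (j - i)" using ij False by simp
    then have "1 / 2 ^ N \<le> 2 * real (j - i) / 2 ^ N" by (intro divide_right_mono) auto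
    then show ?thesis using 0 by (simp add: x_def)
  next
    case (Suc e')
    then have "\<not> j - i \<le> 2 ^ e'" using not_less_Least[of e' "\<lambda>e. j - i \<le> 2 ^ e"] by (simp add: e_def)
    then have "2 ^ e' \<le> j - i" by simp
    then have "real (2 ^ e') \<le> real (j - i)" by (simp only: of_nat_le_iff)
    then have "2 ^ e \<le> 2 * real (j - i)" using Suc by simp
    then have "2 ^ e / 2 ^ N \<le> 2 * real (j - i) / 2 ^ N" by (rule divide_right_mono) simp
    then show ?thesis by (simp add: x_def)
  qed
  have geo: "(\<Sum>n=N-e..N. r ^ n) \<le> r ^ (N - e) / (1 - r)"
  proof -
    have "(\<Sum>n=N-e..N. r ^ n) = (r ^ (N - e) - r ^ Suc N) / (1 - r)"
      using sum_gp[of r "N - e" N] r by simp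
    also have "\<dots> \<le> r ^ (N - e) / (1 - r)" using r by (intro divide_right_mono) auto
    finally show ?thesis .
  qed
  have "r ^ (N - e) = (2 ^ e / 2 ^ N) powr \<theta>"
  proof -
    have "2 ^ e / 2 ^ N = (2::real) powr - real (N - e)"
    proof -
      have "(2::real) powr - real (N - e) = 2 powr (real e - real N)" using eN by (simp add: of_nat_diff)
      also have "\<dots> = 2 ^ e / 2 ^ N" by (simp add: powr_diff powr_realpow)
      finally show ?thesis by simp
    qed
    then have "(2 ^ e / 2 ^ N) powr \<theta> = 2 powr (- real (N - e) * \<theta>)" by (simp add: powr_powr)
    also have "\<dots> = r ^ (N - e)"
      by (simp add: r_def powr_realpow[symmetric] powr_powr mult.commute)
    finally show ?thesis by simp
  qed
  also have "\<dots> \<le> (2 * x) powr \<theta>" using e2 \<theta> by (intro powr_mono2) auto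
  also have "\<dots> = 2 powr \<theta> * x powr \<theta>" using x by (simp add: powr_mult)
  also have "\<dots> \<le> 2 * x powr \<theta>"
    using powr_mono[of \<theta> 1 2] \<theta> by (intro mult_right_mono) auto
  finally have re: "r ^ (N - e) \<le> 2 * x powr \<theta>" .
  have "\<bar>F N j - F N i\<bar> \<le> 2 * A * (\<Sum>n=N-e..N. r ^ n)"
    by (rule dyadic_chaining[where F=F, OF nested])
      (use step A r ij e1 eN in \<open>auto simp: r_def\<close>)
  also have "\<dots> \<le> 2 * A * (r ^ (N - e) / (1 - r))" using A by (intro mult_left_mono geo) auto
  also have "\<dots> \<le> 2 * A * (2 * x powr \<theta> / (1 - r))"
    using A r by (intro mult_left_mono divide_right_mono re) auto
  finally show ?thesis by (simp add: x_def r_def)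
qed simp

text \<open>Kolmogorov's continuity argument for the Hoelder exponent \<open>7/16\<close>, with control of the Hoelder
  constant: the \<open>2\<^sup>n\<close> increments over intervals of length \<open>2\<^sup>-\<^sup>n T\<close> have \<open>2 k\<close>-th moments of order
  \<open>2\<^sup>-\<^sup>n\<^sup>k\<close>, which beats the factor \<open>2\<^sup>n 2\<^sup>7\<^sup>n\<^sup>k\<^sup>/\<^sup>8\<close> as soon as \<open>k > 8\<close>.  Only dyadic times are considered;
  the bound \<open>C\<close> is chosen before the probability space and the Brownian motion.\<close>

lemma brownian_dyadic_hoelder:
  fixes T p :: real
  assumes T: "T > 0" and p: "p > 0"
  obtains C where "C > 0"
    and "\<And>(M :: 'w measure) B. prob_space M \<Longrightarrow> brownian_motion M B \<Longrightarrow>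
      \<exists>H \<in> borel_measurable M. (\<forall>\<omega>. 0 \<le> H \<omega>) \<and> (\<integral>\<^sup>+\<omega>. ennreal (H \<omega> powr p) \<partial>M) \<le> ennreal C \<and>
        (AE \<omega> in M. \<forall>N i j. i \<le> j \<and> j \<le> 2 ^ N \<longrightarrow>
          \<bar>B (T * real j / 2 ^ N) \<omega> - B (T * real i / 2 ^ N) \<omega>\<bar> \<le> H \<omega> * (real (j - i) / 2 ^ N) powr (7 / 16))"
proof -
  \<comment> \<open>Large enough for convergence and for the moment of order \<open>p\<close> to be controlled by that of
    order \<open>2 k\<close>.\<close>
  define k where "k = max 9 (nat \<lceil>p\<rceil>)"
  have k: "k \<ge> 9" "p \<le> real (2 * k)"
  proof -
    show "k \<ge> 9" by (simp add: k_def)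
    have "p \<le> real (nat \<lceil>p\<rceil>)" by (rule real_nat_ceiling_ge)
    also have "\<dots> \<le> real (2 * k)" by (simp add: k_def)
    finally show "p \<le> real (2 * k)" .
  qed
  define c where "c = fact (2 * k) / (2 ^ k * fact k) * T ^ k"
  have c: "c > 0" using T by (simp add: c_def)
  define \<rho> where "\<rho> = (2::real) powr (1 - real k / 8)"
  have \<rho>: "0 < \<rho>" "\<rho> < 1" using k by (auto simp: \<rho>_def powr_less_one)
  define D where "D = (4 / (1 - 2 powr - (7/16 :: real)))"
  have D: "D > 0" unfolding D_def by (simp add: powr_less_one)
  define C where "C = D powr p * (1 + c / (1 - \<rho>))"
  have C: "C > 0" unfolding C_def using D c \<rho> by (intro mult_pos_pos add_pos_pos) auto
  have "\<exists>H \<in> borel_measurable M. (\<forall>\<omega>. 0 \<le> H \<omega>) \<and> (\<integral>\<^sup>+\<omega>. ennreal (H \<omega> powr p) \<partial>M) \<le> ennreal C \<and>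
        (AE \<omega> in M. \<forall>N i j. i \<le> j \<and> j \<le> 2 ^ N \<longrightarrow>
          \<bar>B (T * real j / 2 ^ N) \<omega> - B (T * real i / 2 ^ N) \<omega>\<bar> \<le> H \<omega> * (real (j - i) / 2 ^ N) powr (7 / 16))"
    if M: "prob_space M" and B: "brownian_motion M B" for M :: "'w measure" and B
  proof -
    interpret prob_space M by fact
    have Bm: "B t \<in> borel_measurable M" if "t \<ge> 0" for t using B that by (simp add: brownian_motion_def)
    define F where "F \<omega> n i = B (T * real i / 2 ^ n) \<omega>" for \<omega> n i
    have Fm[measurable]: "(\<lambda>\<omega>. F \<omega> n i) \<in> borel_measurable M" for n i
      unfolding F_def using T by (intro Bm) simp
    define w where "w n = (2 powr (7/16 * real n) :: real)" for n :: nat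
    have w: "w n > 0" for n by (simp add: w_def)
    \<comment> \<open>Every weighted dyadic increment is bounded by \<open>Q\<close> to the power \<open>1 / (2 k)\<close>, and the
      expectation of \<open>Q\<close> is a geometric series.\<close>
    define Q where "Q \<omega> = (\<Sum>n. \<Sum>i<2^n. ennreal ((w n * (F \<omega> n (Suc i) - F \<omega> n i)) ^ (2 * k)))" for \<omega>
    have Qm[measurable]: "Q \<in> borel_measurable M" unfolding Q_def by measurable
    have inc: "(\<integral>\<^sup>+\<omega>. ennreal ((w n * (F \<omega> n (Suc i) - F \<omega> n i)) ^ (2 * k)) \<partial>M) =
        ennreal (w n ^ (2 * k) * (c / (2 ^ n) ^ k))" for n i
    proof -
      have "has_bochner_integral M (\<lambda>\<omega>. (F \<omega> n (Suc i) - F \<omega> n i) ^ (2 * k))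
          (fact (2 * k) / (2 ^ k * fact k) * (T * real (Suc i) / 2 ^ n - T * real i / 2 ^ n) ^ k)"
        unfolding F_def
        by (rule brownian_increment_even_moment[OF M B]) (use T k in \<open>auto intro!: divide_right_mono\<close>)
      also have "T * real (Suc i) / 2 ^ n - T * real i / 2 ^ n = T / 2 ^ n"
        by (simp add: field_simps)
      finally have "has_bochner_integral M (\<lambda>\<omega>. (F \<omega> n (Suc i) - F \<omega> n i) ^ (2 * k)) (c / (2 ^ n) ^ k)"
        by (simp add: c_def power_divide)
      then have "has_bochner_integral M (\<lambda>\<omega>. w n ^ (2 * k) * (F \<omega> n (Suc i) - F \<omega> n i) ^ (2 * k))
          (w n ^ (2 * k) * (c / (2 ^ n) ^ k))"
        by (intro has_bochner_integral_mult_right)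
      then have "has_bochner_integral M (\<lambda>\<omega>. (w n * (F \<omega> n (Suc i) - F \<omega> n i)) ^ (2 * k))
          (w n ^ (2 * k) * (c / (2 ^ n) ^ k))"
        by (simp add: power_mult_distrib)
      then show ?thesis
        by (subst nn_integral_eq_integral) (auto simp: has_bochner_integral_iff)
    qed
    have rate: "2 ^ n * (w n ^ (2 * k) * (c / (2 ^ n) ^ k)) = c * \<rho> ^ n" for n
    proof -
      have w2: "w n ^ (2 * k) = 2 powr (7/8 * real n * real k)"
        by (simp add: w_def powr_realpow[symmetric] powr_powr mult_ac)
      have pk: "((2::real) ^ n) ^ k = 2 powr (real n * real k)"
        by (simp add: powr_realpow[symmetric] powr_powr)
      have "2 ^ n * (w n ^ (2 * k) / (2 ^ n) ^ k) =
          2 powr real n * (2 powr (7/8 * real n * real k) / 2 powr (real n * real k))"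
        unfolding w2 pk by (simp add: powr_realpow)
      also have "\<dots> = (2::real) powr (real n * (1 - real k / 8))"
        unfolding powr_diff[symmetric] powr_add[symmetric] by (rule arg_cong) (simp add: algebra_simps)
      also have "\<dots> = \<rho> ^ n"
        by (simp add: \<rho>_def powr_realpow[symmetric] powr_powr mult.commute)
      finally have "c * (2 ^ n * (w n ^ (2 * k) / (2 ^ n) ^ k)) = c * \<rho> ^ n" by (simp only:)
      then show ?thesis by (simp add: mult_ac)
    qed
    have EQ: "(\<integral>\<^sup>+\<omega>. Q \<omega> \<partial>M) = ennreal (c / (1 - \<rho>))"
    proof -
      have "(\<integral>\<^sup>+\<omega>. Q \<omega> \<partial>M) =
          (\<Sum>n. \<Sum>i<2^n. \<integral>\<^sup>+\<omega>. ennreal ((w n * (F \<omega> n (Suc i) - F \<omega> n i)) ^ (2 * k)) \<partial>M)"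
        unfolding Q_def by (simp add: nn_integral_suminf nn_integral_sum del: sum_ennreal)
      also have "\<dots> = (\<Sum>n. ennreal (c * \<rho> ^ n))"
      proof -
        have const: "(\<Sum>i<(2::nat)^n. ennreal x) = ennreal (2 ^ n * x)" if "x \<ge> 0" for x and n :: nat
          using that by (subst sum_ennreal) auto
        have "w n ^ (2 * k) * (c / (2 ^ n) ^ k) \<ge> 0" for n using c w[of n] by simp
        then show ?thesis unfolding inc rate[symmetric] by (simp only: const)
      qed
      also have "\<dots> = ennreal (\<Sum>n. c * \<rho> ^ n)"
        using c \<rho> by (intro suminf_ennreal2 summable_mult summable_geometric) auto
      also have "(\<Sum>n. c * \<rho> ^ n) = c / (1 - \<rho>)"
        using \<rho> by (simp add: suminf_mult suminf_geometric summable_geometric)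
      finally show ?thesis .
    qed
    have fin: "AE \<omega> in M. Q \<omega> \<noteq> \<infinity>"
      by (rule nn_integral_PInf_AE) (simp_all add: EQ)
    define R where "R \<omega> = enn2real (Q \<omega>)" for \<omega>
    have R: "R \<omega> \<ge> 0" for \<omega> by (simp add: R_def)
    define H where "H \<omega> = D * R \<omega> powr (1 / real (2 * k))" for \<omega>
    have Hm: "H \<in> borel_measurable M" unfolding H_def R_def by measurable
    have H0: "0 \<le> H \<omega>" for \<omega> using D by (simp add: H_def)
    have Hp: "(\<integral>\<^sup>+\<omega>. ennreal (H \<omega> powr p) \<partial>M) \<le> ennreal C"
    proof -
      have le: "ennreal (H \<omega> powr p) \<le> ennreal (D powr p) * (1 + Q \<omega>)" for \<omega>
      proof (cases "Q \<omega> = \<infinity>")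
        case True
        then show ?thesis using D by (simp add: ennreal_mult_top)
      next
        case False
        have "R \<omega> powr (p / real (2 * k)) \<le> 1 + R \<omega>"
        proof (cases "R \<omega> \<le> 1")
          case True
          have "R \<omega> powr (p / real (2 * k)) \<le> 1 powr (p / real (2 * k))"
            using True R p k by (intro powr_mono2) auto
          then show ?thesis using R[of \<omega>] by simp
        next
          case False
          have "R \<omega> powr (p / real (2 * k)) \<le> R \<omega> powr 1"
            using False k by (intro powr_mono) auto
          then show ?thesis using False by simp
        qed
        then have "D powr p * R \<omega> powr (p / real (2 * k)) \<le> D powr p * (1 + R \<omega>)"
          by (intro mult_left_mono) auto
        then have "H \<omega> powr p \<le> D powr p * (1 + R \<omega>)"
          using D R[of \<omega>] by (simp add: H_def powr_mult powr_powr)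
        then have "ennreal (H \<omega> powr p) \<le> ennreal (D powr p * (1 + R \<omega>))" by (rule ennreal_leI)
        also have "\<dots> = ennreal (D powr p) * (1 + Q \<omega>)"
          using False R[of \<omega>] by (simp add: ennreal_mult R_def ennreal_enn2real less_top)
        finally show ?thesis .
      qed
      have "(\<integral>\<^sup>+\<omega>. ennreal (H \<omega> powr p) \<partial>M) \<le> (\<integral>\<^sup>+\<omega>. ennreal (D powr p) * (1 + Q \<omega>) \<partial>M)"
        by (intro nn_integral_mono le)
      also have "\<dots> = ennreal (D powr p) * (1 + ennreal (c / (1 - \<rho>)))"
        by (simp add: nn_integral_cmult nn_integral_add EQ emeasure_space_1)
      also have "\<dots> = ennreal C"
        using c \<rho> by (simp add: C_def ennreal_mult)
      finally show ?thesis .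
    qed
    have "AE \<omega> in M. \<forall>N i j. i \<le> j \<and> j \<le> 2 ^ N \<longrightarrow>
        \<bar>F \<omega> N j - F \<omega> N i\<bar> \<le> H \<omega> * (real (j - i) / 2 ^ N) powr (7 / 16)"
      using fin
    proof eventually_elim
      case (elim \<omega>)
      have step: "\<bar>F \<omega> n (Suc i) - F \<omega> n i\<bar> \<le> R \<omega> powr (1 / real (2 * k)) * (2 powr - (7 / 16)) ^ n"
        if i: "i < 2 ^ n" for n i
      proof -
        define d where "d = w n * \<bar>F \<omega> n (Suc i) - F \<omega> n i\<bar>"
        have d: "d \<ge> 0" using w[of n] by (simp add: d_def)
        have "ennreal ((w n * (F \<omega> n (Suc i) - F \<omega> n i)) ^ (2 * k)) \<le>
            (\<Sum>i<2^n. ennreal ((w n * (F \<omega> n (Suc i) - F \<omega> n i)) ^ (2 * k)))"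
          using i by (intro member_le_sum) auto
        also have "\<dots> \<le> Q \<omega>" unfolding Q_def
          using sum_le_suminf[of "\<lambda>n. \<Sum>i<2^n. ennreal ((w n * (F \<omega> n (Suc i) - F \<omega> n i)) ^ (2 * k))" "{n}"]
          by simp
        also have "(w n * (F \<omega> n (Suc i) - F \<omega> n i)) ^ (2 * k) = d ^ (2 * k)"
        proof -
          have "d = \<bar>w n * (F \<omega> n (Suc i) - F \<omega> n i)\<bar>" using w[of n] by (simp add: d_def abs_mult)
          then show ?thesis by (simp add: power_even_abs)
        qed
        finally have "ennreal (d ^ (2 * k)) \<le> Q \<omega>" .
        then have "ennreal (d ^ (2 * k)) \<le> ennreal (R \<omega>)"
          using elim by (simp add: R_def ennreal_enn2real less_top)
        then have "d ^ (2 * k) \<le> R \<omega>" using R by (simp add: ennreal_le_iff)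
        then have "(d ^ (2 * k)) powr (1 / real (2 * k)) \<le> R \<omega> powr (1 / real (2 * k))"
          using d by (intro powr_mono2) auto
        moreover have "(d ^ (2 * k)) powr (1 / real (2 * k)) = d"
        proof (cases "d = 0")
          case False
          then have "0 < d" using d by simp
          then have "d ^ (2 * k) = d powr real (2 * k)" by (rule powr_realpow[symmetric])
          then show ?thesis using k d by (simp add: powr_powr)
        qed (use k in simp)
        ultimately have "d \<le> R \<omega> powr (1 / real (2 * k))" by simp
        then have "d / w n \<le> R \<omega> powr (1 / real (2 * k)) / w n"
          using w[of n] by (intro divide_right_mono) auto
        moreover have "d / w n = \<bar>F \<omega> n (Suc i) - F \<omega> n i\<bar>" using w[of n] by (simp add: d_def)
        ultimately have "\<bar>F \<omega> n (Suc i) - F \<omega> n i\<bar> \<le> R \<omega> powr (1 / real (2 * k)) * (1 / w n)"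
          by (simp only: times_divide_eq_right mult_1_right)
        moreover have "1 / w n = (2 powr - (7 / 16)) ^ n"
        proof -
          have "(2 powr - (7 / 16)) ^ n = (2::real) powr (- (7 / 16 * real n))"
            by (simp add: powr_realpow[symmetric] powr_powr del: powr_minus)
          then show ?thesis by (simp only: w_def powr_minus_divide)
        qed
        ultimately show ?thesis by (simp only:)
      qed
      have nested: "F \<omega> (Suc n) (2 * i) = F \<omega> n i" for n i by (simp add: F_def)
      show ?case
      proof (intro allI impI)
        fix N i j :: nat assume "i \<le> j \<and> j \<le> 2 ^ N"
        then show "\<bar>F \<omega> N j - F \<omega> N i\<bar> \<le> H \<omega> * (real (j - i) / 2 ^ N) powr (7 / 16)"
          using dyadic_hoelder[of "F \<omega>", OF nested step, of i j N] by (simp add: H_def D_def)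
      qed
    qed
    then show ?thesis using Hm H0 Hp unfolding F_def by blast
  qed
  with C show ?thesis by (rule that)
qed

lemma powr_le_exp_half:
  fixes y :: real
  assumes "0 \<le> y" "0 < \<theta>" "\<theta> \<le> 1/2"
  shows "y powr \<theta> \<le> exp (y / 2)"
proof (cases "y \<le> 1")
  case True
  have "y powr \<theta> \<le> 1 powr \<theta>" using True assms by (intro powr_mono2) auto
  then show ?thesis using assms by (simp add: order_trans[OF _ one_le_exp_iff[THEN iffD2]])
next
  case False
  have "y powr \<theta> \<le> y powr (1/2)" using False assms by (intro powr_mono) auto
  also have "\<dots> \<le> exp y powr (1/2)"
  proof (rule powr_mono2)
    show "y \<le> exp y" using exp_ge_add_one_self[of y] by linarith
  qed (use assms in auto)
  also have "\<dots> = exp (y / 2)" by (simp add: powr_def)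
  finally show ?thesis .
qed

text \<open>Discrete stochastic convolution with the kernel \<open>exp (- a (t - s))\<close>: summation by parts
  only involves the increments of the path up to the final time \<open>t\<close>, of size \<open>(t - s)\<^sup>\<theta>\<close>; where the
  kernel is not small, \<open>t - s\<close> is at most of order \<open>1/a\<close>, which produces the factor \<open>a\<^sup>-\<^sup>\<theta>\<close>.\<close>

lemma exponential_convolution_bound:
  fixes x y :: "nat \<Rightarrow> real"
  assumes a: "a > 0" and \<theta>: "0 < \<theta>" "\<theta> \<le> 1/2" and D: "D \<ge> 0"
    and y: "\<And>i. i < J \<Longrightarrow> y (Suc i) \<le> y i" "y J = 0"
    and x: "\<And>i. i \<le> J \<Longrightarrow> \<bar>x J - x i\<bar> \<le> D * y i powr \<theta>"
  shows "\<bar>\<Sum>i<J. exp (- a * y i) * (x (Suc i) - x i)\<bar> \<le> 3 * D * a powr - \<theta>"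
proof -
  define E where "E i = exp (- a * y i)" for i
  define S where "S i = exp (- a * y i / 2)" for i
  define z where "z i = x J - x i" for i
  have ES: "E i = S i * S i" for i by (simp add: E_def S_def exp_add[symmetric])
  have S0: "S i > 0" for i by (simp add: S_def)
  have ynn: "0 \<le> y i" if "i \<le> J" for i
    using that
  proof (induction rule: inc_induct)
    case base then show ?case using y by simp
  next
    case (step n) then show ?case using y(1)[of n] by linarith
  qed
  have Smono: "S i \<le> S (Suc i)" if "i < J" for i
    using y(1)[OF that] a by (simp add: S_def)
  have zS: "\<bar>z i\<bar> * S i \<le> D * a powr - \<theta>" if "i \<le> J" for i
  proof -
    have "y i powr \<theta> * S i = a powr - \<theta> * ((a * y i) powr \<theta> * S i)"
      using a ynn[OF that] by (simp add: powr_mult powr_minus field_simps)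
    also have "\<dots> \<le> a powr - \<theta> * (exp (a * y i / 2) * S i)"
      using a ynn[OF that] \<theta> S0[of i] by (intro mult_left_mono mult_right_mono powr_le_exp_half) auto
    also have "\<dots> = a powr - \<theta>" by (simp add: S_def exp_add[symmetric])
    finally have "D * (y i powr \<theta> * S i) \<le> D * a powr - \<theta>" using D by (rule mult_left_mono)
    moreover have "\<bar>z i\<bar> * S i \<le> D * y i powr \<theta> * S i"
      using x[OF that] S0[of i] by (intro mult_right_mono) (auto simp: z_def)
    ultimately show ?thesis by simp
  qed
  have parts: "(\<Sum>i<K. E i * (x (Suc i) - x i)) = E 0 * z 0 + (\<Sum>i<K. (E (Suc i) - E i) * z (Suc i)) - E K * z K" for K
    by (induction K) (auto simp: z_def algebra_simps)
  have summand: "\<bar>(E (Suc i) - E i) * z (Suc i)\<bar> \<le> 2 * (D * a powr - \<theta>) * (S (Suc i) - S i)" if i: "i < J" for i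
  proof -
    have E: "E (Suc i) - E i = (S (Suc i) - S i) * (S (Suc i) + S i)" by (simp add: ES algebra_simps)
    have "\<bar>(E (Suc i) - E i) * z (Suc i)\<bar> = (S (Suc i) - S i) * (S (Suc i) + S i) * \<bar>z (Suc i)\<bar>"
      using Smono[OF i] S0[of i] S0[of "Suc i"] by (simp add: E abs_mult)
    also have "\<dots> \<le> (S (Suc i) - S i) * (2 * S (Suc i)) * \<bar>z (Suc i)\<bar>"
      using Smono[OF i] by (intro mult_right_mono mult_left_mono) auto
    also have "\<dots> = 2 * (S (Suc i) - S i) * (\<bar>z (Suc i)\<bar> * S (Suc i))" by simp
    also have "\<dots> \<le> 2 * (S (Suc i) - S i) * (D * a powr - \<theta>)"
      using Smono[OF i] zS[of "Suc i"] i by (intro mult_left_mono) auto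
    finally show ?thesis by (simp only: mult_ac)
  qed
  have "\<bar>E 0 * z 0\<bar> \<le> D * a powr - \<theta>"
  proof -
    have "\<bar>E 0 * z 0\<bar> = S 0 * (\<bar>z 0\<bar> * S 0)" using S0[of 0] by (simp add: ES abs_mult)
    also have "\<dots> \<le> 1 * (D * a powr - \<theta>)"
    proof (rule mult_mono)
      show "S 0 \<le> 1" using ynn[of 0] a by (simp add: S_def)
    qed (use zS[of 0] S0[of 0] in auto)
    finally show ?thesis by simp
  qed
  moreover have "\<bar>\<Sum>i<J. (E (Suc i) - E i) * z (Suc i)\<bar> \<le> 2 * (D * a powr - \<theta>)"
  proof -
    have "\<bar>\<Sum>i<J. (E (Suc i) - E i) * z (Suc i)\<bar> \<le> (\<Sum>i<J. 2 * (D * a powr - \<theta>) * (S (Suc i) - S i))"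
      by (rule order_trans[OF sum_abs]) (intro sum_mono summand, simp)
    also have "\<dots> = 2 * (D * a powr - \<theta>) * (S J - S 0)"
      by (simp only: sum_distrib_left[symmetric] sum_lessThan_telescope)
    also have "\<dots> \<le> 2 * (D * a powr - \<theta>) * 1"
      using D y(2) S0[of 0] by (intro mult_left_mono) (auto simp: S_def)
    finally show ?thesis by simp
  qed
  moreover have "z J = 0" by (simp add: z_def)
  ultimately show ?thesis using parts[of J] unfolding E_def[symmetric] by simp
qed

section \<open>Cosine coefficients of Wiener integrals\<close>

lemma step_integral_joint_measurable:
  fixes \<psi> :: "nat \<Rightarrow> real^'d::finite \<Rightarrow> real"
  assumes B: "\<And>i. i < N \<Longrightarrow> B (\<tau> i) \<in> borel_measurable M" "\<And>i. i < N \<Longrightarrow> B (\<tau> (Suc i)) \<in> borel_measurable M"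
    and \<psi>: "\<And>i. i < N \<Longrightarrow> \<psi> i \<in> L2"
  shows "(\<lambda>(\<omega>, x). step_integral B N \<tau> \<psi> \<omega> x) \<in> borel_measurable (M \<Otimes>\<^sub>M cubeM)"
proof -
  have "(\<lambda>p. \<Sum>i<N. (B (\<tau> (Suc i)) (fst p) - B (\<tau> i) (fst p)) * \<psi> i (snd p)) \<in> borel_measurable (M \<Otimes>\<^sub>M cubeM)"
  proof (rule borel_measurable_sum)
    fix i assume "i \<in> {..<N}"
    then have i: "i < N" by simp
    have [measurable]: "B (\<tau> i) \<in> borel_measurable M" "B (\<tau> (Suc i)) \<in> borel_measurable M"
      "\<psi> i \<in> borel_measurable cubeM"
      using B[OF i] \<psi>[OF i] by (auto simp: L2_measurable)
    show "(\<lambda>p. (B (\<tau> (Suc i)) (fst p) - B (\<tau> i) (fst p)) * \<psi> i (snd p)) \<in> borel_measurable (M \<Otimes>\<^sub>M cubeM)"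
      by measurable
  qed
  then show ?thesis by (simp add: step_integral_def case_prod_beta')
qed

lemma partition_mono:
  fixes \<tau> :: "nat \<Rightarrow> real"
  assumes "\<And>i. i < N \<Longrightarrow> \<tau> i \<le> \<tau> (Suc i)" "i \<le> j" "j \<le> N"
  shows "\<tau> i \<le> \<tau> j"
  using assms(2,3)
proof (induction rule: dec_induct)
  case (step n) then show ?case using assms(1)[of n] by linarith
qed simp

lemma partition_step_value:
  fixes \<tau> :: "nat \<Rightarrow> real"
  assumes mono: "\<And>i. i < N \<Longrightarrow> \<tau> i \<le> \<tau> (Suc i)" and s: "\<tau> 0 < s" "s \<le> \<tau> N"
  obtains i where "i < N" "s \<in> {\<tau> i<..\<tau> (Suc i)}"
    "\<And>g. (\<Sum>k<N. g k * indicator {\<tau> k<..\<tau> (Suc k)} s) = (g i :: real)"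
proof -
  define n where "n = (LEAST n. s \<le> \<tau> n)"
  have n: "s \<le> \<tau> n" unfolding n_def by (rule LeastI[of _ N]) (rule s)
  have nN: "n \<le> N" unfolding n_def by (rule Least_le) (rule s)
  have "n \<noteq> 0" using n s by (metis not_less)
  then obtain i where i: "n = Suc i" using not0_implies_Suc by blast
  have "\<not> s \<le> \<tau> i" using not_less_Least[of i "\<lambda>n. s \<le> \<tau> n"] i by (simp add: n_def)
  then have si: "s \<in> {\<tau> i<..\<tau> (Suc i)}" using n i by simp
  have other: "s \<notin> {\<tau> k<..\<tau> (Suc k)}" if k: "k < N" "k \<noteq> i" for k
  proof (cases "k < i")
    case True
    have "\<tau> (Suc k) \<le> \<tau> i" by (rule partition_mono[of N \<tau> "Suc k" i, OF mono]) (use True nN i in auto)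
    then show ?thesis using si by auto
  next
    case False
    have "\<tau> (Suc i) \<le> \<tau> k" by (rule partition_mono[of N \<tau> "Suc i" k, OF mono]) (use False k in auto)
    then show ?thesis using si by auto
  qed
  have "(\<Sum>k<N. g k * indicator {\<tau> k<..\<tau> (Suc k)} s) = g i" for g :: "nat \<Rightarrow> real"
  proof -
    have "(\<Sum>k<N. g k * indicator {\<tau> k<..\<tau> (Suc k)} s) = (\<Sum>k<N. if k = i then g k else 0)"
      by (intro sum.cong refl) (use other si in \<open>auto simp: indicator_def\<close>)
    also have "\<dots> = g i" using nN i by simp
    finally show ?thesis .
  qed
  then show ?thesis using that[of i] nN i si by auto
qed

lemma wiener_integral_AE_L2:
  fixes X :: "'w \<Rightarrow> real^'d::finite \<Rightarrow> real"
  assumes M: "prob_space M" and B: "brownian_motion M B" and X: "wiener_integral M B 0 t \<Phi> X"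
  shows "AE \<omega> in M. X \<omega> \<in> L2"
proof -
  interpret prob_space M by fact
  interpret C: sigma_finite_measure "cubeM :: (real^'d) measure" by (rule sigma_finite_cubeM)
  have Bm: "B t \<in> borel_measurable M" if "t \<ge> 0" for t using B that by (simp add: brownian_motion_def)
  obtain N \<tau> \<psi> where Xm: "(\<lambda>(\<omega>, x). X \<omega> x) \<in> borel_measurable (M \<Otimes>\<^sub>M cubeM)"
    and p: "\<And>n. \<tau> n 0 = 0" "\<And>n i. i < N n \<Longrightarrow> \<tau> n i \<le> \<tau> n (Suc i)" "\<And>n i. i < N n \<Longrightarrow> \<psi> n i \<in> L2"
    and lim: "(\<lambda>n. \<integral>\<^sup>+\<omega>. Lp_pow 2 (\<lambda>x. step_integral B (N n) (\<tau> n) (\<psi> n) \<omega> x - X \<omega> x) \<partial>M) \<longlonglongrightarrow> 0"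
    using X unfolding wiener_integral_def by blast
  have "\<forall>\<^sub>F n in sequentially. (\<integral>\<^sup>+\<omega>. Lp_pow 2 (\<lambda>x. step_integral B (N n) (\<tau> n) (\<psi> n) \<omega> x - X \<omega> x) \<partial>M) < 1"
    using order_tendstoD(2)[OF lim, of 1] by simp
  then obtain n where n: "(\<integral>\<^sup>+\<omega>. Lp_pow 2 (\<lambda>x. step_integral B (N n) (\<tau> n) (\<psi> n) \<omega> x - X \<omega> x) \<partial>M) < 1"
    by (auto simp: eventually_sequentially)
  have \<tau>0: "0 \<le> \<tau> n i" if "i \<le> N n" for i
    using partition_mono[of "N n" "\<tau> n" 0 i] p that by simp
  have Sm: "(\<lambda>(\<omega>, x). step_integral B (N n) (\<tau> n) (\<psi> n) \<omega> x) \<in> borel_measurable (M \<Otimes>\<^sub>M cubeM)"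
    by (rule step_integral_joint_measurable) (auto intro!: Bm \<tau>0 p)
  have dm: "(\<lambda>q. step_integral B (N n) (\<tau> n) (\<psi> n) (fst q) (snd q) - X (fst q) (snd q)) \<in> borel_measurable (M \<Otimes>\<^sub>M cubeM)"
    using Sm Xm by (simp add: case_prod_beta')
  have "(\<lambda>q. ennreal ((step_integral B (N n) (\<tau> n) (\<psi> n) (fst q) (snd q) - X (fst q) (snd q))\<^sup>2))
      \<in> borel_measurable (M \<Otimes>\<^sub>M cubeM)"
    using dm by simp
  from C.borel_measurable_nn_integral_fst[OF this]
  have "(\<lambda>\<omega>. Lp_pow 2 (\<lambda>x. step_integral B (N n) (\<tau> n) (\<psi> n) \<omega> x - X \<omega> x)) \<in> borel_measurable M"
    by (simp add: Lp_pow_2)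
  then have "AE \<omega> in M. Lp_pow 2 (\<lambda>x. step_integral B (N n) (\<tau> n) (\<psi> n) \<omega> x - X \<omega> x) \<noteq> \<infinity>"
    by (rule nn_integral_PInf_AE) (use n in auto)
  then show ?thesis
  proof (rule AE_mp, intro AE_I2 impI)
    fix \<omega> assume \<omega>: "\<omega> \<in> space M"
      and fin: "Lp_pow 2 (\<lambda>x. step_integral B (N n) (\<tau> n) (\<psi> n) \<omega> x - X \<omega> x) \<noteq> \<infinity>"
    have S: "step_integral B (N n) (\<tau> n) (\<psi> n) \<omega> \<in> L2"
      unfolding step_integral_def[abs_def] by (rule L2_sum, rule L2_scale, rule p) simp
    have "(\<lambda>x. step_integral B (N n) (\<tau> n) (\<psi> n) \<omega> x - X \<omega> x) \<in> borel_measurable cubeM"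
      using measurable_Pair2[OF dm \<omega>] by simp
    then have "(\<lambda>x. step_integral B (N n) (\<tau> n) (\<psi> n) \<omega> x - X \<omega> x) \<in> L2"
      using fin by (simp add: L2_def less_top)
    from L2_diff[OF S this] show "X \<omega> \<in> L2" by simp
  qed
qed

text \<open>By the isometry the coefficient of a Wiener integral is the \<open>L\<^sup>2(\<Omega>)\<close>-limit of Riemann sums of
  the coefficient of the integrand, so any pathwise bound on the Riemann sums is inherited.\<close>

lemma wiener_integral_coefficient_bound:
  fixes X :: "'w \<Rightarrow> real^'d::finite \<Rightarrow> real" and \<sigma> :: "nat \<Rightarrow> nat \<Rightarrow> real"
  assumes M: "prob_space M" and B: "brownian_motion M B" and X: "wiener_integral M B 0 t \<Phi> X" and t: "0 \<le> t"
    and c: "c \<in> L2" "L2_inner c c = 1"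
    and \<Phi>: "\<And>s. s \<in> {0..t} \<Longrightarrow> \<Phi> s \<in> L2" "\<And>s. s \<in> {0..t} \<Longrightarrow> L2_inner (\<Phi> s) c = f s"
    and fm: "f \<in> borel_measurable borel"
    and \<sigma>: "\<And>K. \<sigma> K 0 = 0" "\<And>K. \<sigma> K (J K) = t" "\<And>K i. i < J K \<Longrightarrow> \<sigma> K i \<le> \<sigma> K (Suc i)"
    and unif: "\<And>K i s. i < J K \<Longrightarrow> s \<in> {\<sigma> K i<..\<sigma> K (Suc i)} \<Longrightarrow> \<bar>f s - g K i\<bar> \<le> \<delta> K" and \<delta>: "\<delta> \<longlonglongrightarrow> 0"
    and bd: "\<And>K. AE \<omega> in M. \<bar>\<Sum>i<J K. g K i * (B (\<sigma> K (Suc i)) \<omega> - B (\<sigma> K i) \<omega>)\<bar> \<le> b \<omega>"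
    and bm: "b \<in> borel_measurable M"
  shows "AE \<omega> in M. \<bar>L2_inner (X \<omega>) c\<bar> \<le> b \<omega>"
proof -
  interpret prob_space M by fact
  interpret C: sigma_finite_measure "cubeM :: (real^'d) measure" by (rule sigma_finite_cubeM)
  have Bm: "B t \<in> borel_measurable M" if "t \<ge> 0" for t using B that by (simp add: brownian_motion_def)
  obtain N \<tau> \<psi> where Xm: "(\<lambda>(\<omega>, x). X \<omega> x) \<in> borel_measurable (M \<Otimes>\<^sub>M cubeM)"
    and p: "\<And>n. \<tau> n 0 = 0" "\<And>n. \<tau> n (N n) = t" "\<And>n i. i < N n \<Longrightarrow> \<tau> n i \<le> \<tau> n (Suc i)" "\<And>n i. i < N n \<Longrightarrow> \<psi> n i \<in> L2"
    and lim1: "(\<lambda>n. \<integral>\<^sup>+s\<in>{0..t}. Lp_pow 2 (\<lambda>x. step_integrand (N n) (\<tau> n) (\<psi> n) s x - \<Phi> s x) \<partial>lborel) \<longlonglongrightarrow> 0"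
    and lim2: "(\<lambda>n. \<integral>\<^sup>+\<omega>. Lp_pow 2 (\<lambda>x. step_integral B (N n) (\<tau> n) (\<psi> n) \<omega> x - X \<omega> x) \<partial>M) \<longlonglongrightarrow> 0"
    using X unfolding wiener_integral_def by blast
  define \<beta> where "\<beta> n = (\<integral>\<^sup>+s\<in>{0..t}. Lp_pow 2 (\<lambda>x. step_integrand (N n) (\<tau> n) (\<psi> n) s x - \<Phi> s x) \<partial>lborel)" for n
  define \<alpha> where "\<alpha> n = (\<integral>\<^sup>+\<omega>. Lp_pow 2 (\<lambda>x. step_integral B (N n) (\<tau> n) (\<psi> n) \<omega> x - X \<omega> x) \<partial>M)" for n
  have \<tau>0: "0 \<le> \<tau> n i" "\<tau> n i \<le> t" if "i \<le> N n" for n i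
    using partition_mono[of "N n" "\<tau> n" 0 i] partition_mono[of "N n" "\<tau> n" i "N n"] p that by auto
  have \<sigma>0: "0 \<le> \<sigma> K i" "\<sigma> K i \<le> t" if "i \<le> J K" for K i
    using partition_mono[of "J K" "\<sigma> K" 0 i] partition_mono[of "J K" "\<sigma> K" i "J K"] \<sigma> that by auto
  define Y where "Y \<omega> = L2_inner (X \<omega>) c" for \<omega>
  define \<gamma> where "\<gamma> n i = L2_inner (\<psi> n i) c" for n i
  define S where "S n \<omega> = (\<Sum>i<N n. \<gamma> n i * (B (\<tau> n (Suc i)) \<omega> - B (\<tau> n i) \<omega>))" for n \<omega>
  define R where "R K \<omega> = (\<Sum>i<J K. g K i * (B (\<sigma> K (Suc i)) \<omega> - B (\<sigma> K i) \<omega>))" for K \<omega>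
  define fn where "fn n s = (\<Sum>i<N n. \<gamma> n i * indicator {\<tau> n i<..\<tau> n (Suc i)} s)" for n s
  define gK where "gK K s = (\<Sum>i<J K. g K i * indicator {\<sigma> K i<..\<sigma> K (Suc i)} s)" for K s
  have Sm[measurable]: "S n \<in> borel_measurable M" for n
    unfolding S_def by (intro borel_measurable_sum borel_measurable_times borel_measurable_diff
        borel_measurable_const Bm \<tau>0) auto
  have Rm[measurable]: "R K \<in> borel_measurable M" for K
    unfolding R_def by (intro borel_measurable_sum borel_measurable_times borel_measurable_diff
        borel_measurable_const Bm \<sigma>0) auto
  have Ym[measurable]: "Y \<in> borel_measurable M"
  proof -
    have "(\<lambda>(\<omega>, x). X \<omega> x * c x) \<in> borel_measurable (M \<Otimes>\<^sub>M cubeM)"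
      using borel_measurable_times[OF Xm measurable_compose[OF measurable_snd L2_measurable[OF c(1)]]]
      by (simp add: case_prod_beta')
    then show ?thesis unfolding Y_def L2_inner_def by (rule C.borel_measurable_lebesgue_integral)
  qed
  \<comment> \<open>First approximation: the given step integrals.\<close>
  have YS: "(\<integral>\<^sup>+\<omega>. ennreal ((Y \<omega> - S n \<omega>)\<^sup>2) \<partial>M) \<le> \<alpha> n" for n
    unfolding \<alpha>_def
  proof (rule nn_integral_mono)
    fix \<omega> assume \<omega>: "\<omega> \<in> space M"
    define st where "st = step_integral B (N n) (\<tau> n) (\<psi> n) \<omega>"
    have stL: "st \<in> L2"
      unfolding st_def step_integral_def[abs_def] by (rule L2_sum, rule L2_scale, rule p) simp
    have stc: "L2_inner st c = S n \<omega>"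
      unfolding st_def step_integral_def[abs_def] S_def \<gamma>_def
      by (subst L2_inner_lincomb_left) (auto simp: p c mult.commute)
    have Xx: "X \<omega> \<in> borel_measurable cubeM" using measurable_Pair2[OF Xm \<omega>] by simp
    have dm: "(\<lambda>x. st x - X \<omega> x) \<in> borel_measurable cubeM"
      using Xx L2_measurable[OF stL] by simp
    show "ennreal ((Y \<omega> - S n \<omega>)\<^sup>2) \<le> Lp_pow 2 (\<lambda>x. step_integral B (N n) (\<tau> n) (\<psi> n) \<omega> x - X \<omega> x)"
      unfolding st_def[symmetric]
    proof (cases "Lp_pow 2 (\<lambda>x. st x - X \<omega> x) = \<infinity>")
      case False
      then have d: "(\<lambda>x. st x - X \<omega> x) \<in> L2" using dm by (simp add: L2_def less_top)
      from L2_diff[OF stL d] have XL: "X \<omega> \<in> L2" by simp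
      have "L2_inner (\<lambda>x. st x - X \<omega> x) c = S n \<omega> - Y \<omega>"
        by (simp add: L2_inner_diff_left[OF stL XL c(1)] stc Y_def)
      then show "ennreal ((Y \<omega> - S n \<omega>)\<^sup>2) \<le> Lp_pow 2 (\<lambda>x. st x - X \<omega> x)"
        using L2_inner_Cauchy_Schwarz_ennreal[OF dm c(1)] c(2) by (simp add: power2_commute)
    qed simp
  qed
  \<comment> \<open>Second approximation: Riemann sums, compared through the isometry.\<close>
  have SR: "(\<integral>\<^sup>+\<omega>. ennreal ((S n \<omega> - R K \<omega>)\<^sup>2) \<partial>M) = (\<integral>\<^sup>+s. ennreal ((fn n s - gK K s)\<^sup>2) \<partial>lborel)" for n K
  proof -
    define I where "I = {..<N n} <+> {..<J K}"
    define co where "co = case_sum (\<gamma> n) (\<lambda>i. - g K i)"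
    define lo where "lo = case_sum (\<tau> n) (\<sigma> K)"
    define up where "up = case_sum (\<lambda>i. \<tau> n (Suc i)) (\<lambda>i. \<sigma> K (Suc i))"
    have plus: "(\<Sum>i<N n. \<gamma> n i * U i) - (\<Sum>i<J K. g K i * W i) = (\<Sum>i\<in>I. co i * case_sum U W i)" for U W
      unfolding I_def co_def by (simp add: sum.Plus sum_negf)
    have 1: "S n \<omega> - R K \<omega> = (\<Sum>i\<in>I. co i * (B (up i) \<omega> - B (lo i) \<omega>))" for \<omega>
      unfolding S_def R_def plus
      by (intro sum.cong refl) (auto simp: lo_def up_def split: sum.split)
    have 2: "fn n s - gK K s = (\<Sum>i\<in>I. co i * indicator {lo i<..up i} s)" for s
      unfolding fn_def gK_def plus
      by (intro sum.cong refl arg_cong2[where f="(*)"]) (simp add: lo_def up_def split: sum.split)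
    have ab: "0 \<le> lo i" "lo i \<le> up i" if "i \<in> I" for i
      using that \<tau>0 \<sigma>0 p \<sigma> by (auto simp: I_def lo_def up_def)
    have i1: "integrable M (\<lambda>\<omega>. (\<Sum>i\<in>I. co i * (B (up i) \<omega> - B (lo i) \<omega>))\<^sup>2)"
      by (rule wiener_isometry(1)[OF M B ab])
    have i2: "integrable lborel (\<lambda>s. (\<Sum>i\<in>I. co i * indicator {lo i<..up i} s)\<^sup>2)"
      by (rule wiener_isometry(2)[OF M B ab])
    have i3: "(\<integral>\<omega>. (\<Sum>i\<in>I. co i * (B (up i) \<omega> - B (lo i) \<omega>))\<^sup>2 \<partial>M) =
        (\<integral>s. (\<Sum>i\<in>I. co i * indicator {lo i<..up i} s)\<^sup>2 \<partial>lborel)"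
      by (rule wiener_isometry(3)[OF M B ab])
    show ?thesis
      unfolding 1 2 nn_integral_eq_integral[OF i1 AE_I2[OF zero_le_power2]]
        nn_integral_eq_integral[OF i2 AE_I2[OF zero_le_power2]] i3 ..
  qed
  have FG: "(\<integral>\<^sup>+s. ennreal ((fn n s - gK K s)\<^sup>2) \<partial>lborel) \<le> 2 * \<beta> n + ennreal (2 * (\<delta> K)\<^sup>2 * t)" for n K
  proof -
    have pt: "ennreal ((fn n s - gK K s)\<^sup>2) \<le>
        2 * (ennreal ((fn n s - f s)\<^sup>2) * indicator {0..t} s) + ennreal (2 * (\<delta> K)\<^sup>2) * indicator {0..t} s" for s
    proof (cases "s \<in> {0<..t}")
      case True
      then obtain i where i: "i < J K" "s \<in> {\<sigma> K i<..\<sigma> K (Suc i)}" "gK K s = g K i"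
        unfolding gK_def by - (rule partition_step_value[of "J K" "\<sigma> K" s], auto simp: \<sigma>)
      have "\<bar>f s - gK K s\<bar> \<le> \<delta> K" using unif[OF i(1,2)] i(3) by simp
      then have "(f s - gK K s)\<^sup>2 \<le> (\<delta> K)\<^sup>2" using abs_le_square_iff by fastforce
      moreover have "(fn n s - gK K s)\<^sup>2 \<le> 2 * (fn n s - f s)\<^sup>2 + 2 * (f s - gK K s)\<^sup>2"
      proof -
        have "0 \<le> ((fn n s - f s) - (f s - gK K s))\<^sup>2" by simp
        then show ?thesis by (simp add: power2_eq_square algebra_simps)
      qed
      ultimately have "(fn n s - gK K s)\<^sup>2 \<le> 2 * (fn n s - f s)\<^sup>2 + 2 * (\<delta> K)\<^sup>2" by linarith
      then have "ennreal ((fn n s - gK K s)\<^sup>2) \<le> ennreal (2 * (fn n s - f s)\<^sup>2 + 2 * (\<delta> K)\<^sup>2)"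
        by (rule ennreal_leI)
      also have "\<dots> = 2 * ennreal ((fn n s - f s)\<^sup>2) + ennreal (2 * (\<delta> K)\<^sup>2)"
        by (simp add: ennreal_plus ennreal_mult)
      finally show ?thesis using True by simp
    next
      case False
      have "fn n s = 0" unfolding fn_def
      proof (rule sum.neutral, safe)
        fix i assume "i < N n"
        then have "s \<notin> {\<tau> n i<..\<tau> n (Suc i)}" using False \<tau>0(1)[of i n] \<tau>0(2)[of "Suc i" n] by auto
        then show "\<gamma> n i * indicator {\<tau> n i<..\<tau> n (Suc i)} s = 0" by simp
      qed
      moreover have "gK K s = 0" unfolding gK_def
      proof (rule sum.neutral, safe)
        fix i assume "i < J K"
        then have "s \<notin> {\<sigma> K i<..\<sigma> K (Suc i)}" using False \<sigma>0(1)[of i K] \<sigma>0(2)[of "Suc i" K] by auto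
        then show "g K i * indicator {\<sigma> K i<..\<sigma> K (Suc i)} s = 0" by simp
      qed
      ultimately show ?thesis by simp
    qed
    have fnm[measurable]: "fn n \<in> borel_measurable borel" unfolding fn_def by measurable
    note fm[measurable]
    have "(\<integral>\<^sup>+s. ennreal ((fn n s - gK K s)\<^sup>2) \<partial>lborel) \<le>
        (\<integral>\<^sup>+s. 2 * (ennreal ((fn n s - f s)\<^sup>2) * indicator {0..t} s) + ennreal (2 * (\<delta> K)\<^sup>2) * indicator {0..t} s \<partial>lborel)"
      by (intro nn_integral_mono pt)
    also have "\<dots> = 2 * (\<integral>\<^sup>+s\<in>{0..t}. ennreal ((fn n s - f s)\<^sup>2) \<partial>lborel) + ennreal (2 * (\<delta> K)\<^sup>2) * ennreal t"
      using t by (simp add: nn_integral_add nn_integral_cmult nn_integral_cmult_indicator)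
    also have "ennreal (2 * (\<delta> K)\<^sup>2) * ennreal t = ennreal (2 * (\<delta> K)\<^sup>2 * t)"
      using t by (simp add: ennreal_mult)
    also have "(\<integral>\<^sup>+s\<in>{0..t}. ennreal ((fn n s - f s)\<^sup>2) \<partial>lborel) \<le> \<beta> n"
      unfolding \<beta>_def
    proof (rule nn_integral_mono)
      fix s :: real
      show "ennreal ((fn n s - f s)\<^sup>2) * indicator {0..t} s \<le>
          Lp_pow 2 (\<lambda>x. step_integrand (N n) (\<tau> n) (\<psi> n) s x - \<Phi> s x) * indicator {0..t} s"
      proof (cases "s \<in> {0..t}")
        case True
        define si where "si = step_integrand (N n) (\<tau> n) (\<psi> n) s"
        have siL: "si \<in> L2"
          unfolding si_def step_integrand_def[abs_def] by (rule L2_sum, rule L2_scale, rule p) simp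
        have sic: "L2_inner si c = fn n s"
          unfolding si_def step_integrand_def[abs_def] fn_def \<gamma>_def
          by (subst L2_inner_lincomb_left) (auto simp: p c mult.commute)
        have "L2_inner (\<lambda>x. si x - \<Phi> s x) c = fn n s - f s"
          by (simp add: L2_inner_diff_left[OF siL \<Phi>(1)[OF True] c(1)] sic \<Phi>(2)[OF True])
        then show ?thesis
          using L2_inner_Cauchy_Schwarz_ennreal[OF L2_measurable[OF L2_diff[OF siL \<Phi>(1)[OF True]]] c(1)] c(2) True
          by (simp add: si_def)
      qed simp
    qed
    finally show ?thesis by (simp add: add_right_mono mult_left_mono)
  qed
  \<comment> \<open>The excess over the bound vanishes, being dominated by both approximation errors.\<close>
  define V where "V \<omega> = (max 0 (\<bar>Y \<omega>\<bar> - b \<omega>))\<^sup>2" for \<omega>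
  have Vm[measurable]: "V \<in> borel_measurable M" unfolding V_def using bm by measurable
  have key: "(\<integral>\<^sup>+\<omega>. ennreal (V \<omega>) \<partial>M) \<le> 2 * \<alpha> n + 2 * (2 * \<beta> n + ennreal (2 * (\<delta> K)\<^sup>2 * t))" for n K
  proof -
    have "(\<integral>\<^sup>+\<omega>. ennreal (V \<omega>) \<partial>M) \<le>
        (\<integral>\<^sup>+\<omega>. 2 * ennreal ((Y \<omega> - S n \<omega>)\<^sup>2) + 2 * ennreal ((S n \<omega> - R K \<omega>)\<^sup>2) \<partial>M)"
      using bd[of K] unfolding R_def[symmetric]
    proof (intro nn_integral_mono_AE, eventually_elim)
      case (elim \<omega>)
      have "max 0 (\<bar>Y \<omega>\<bar> - b \<omega>) \<le> \<bar>Y \<omega> - R K \<omega>\<bar>" using elim by linarith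
      then have "V \<omega> \<le> \<bar>Y \<omega> - R K \<omega>\<bar>\<^sup>2" unfolding V_def by (intro power_mono) auto
      also have "\<dots> = (Y \<omega> - R K \<omega>)\<^sup>2" by simp
      also have "\<dots> \<le> 2 * (Y \<omega> - S n \<omega>)\<^sup>2 + 2 * (S n \<omega> - R K \<omega>)\<^sup>2"
      proof -
        have "0 \<le> ((Y \<omega> - S n \<omega>) - (S n \<omega> - R K \<omega>))\<^sup>2" by simp
        then show ?thesis by (simp add: power2_eq_square algebra_simps)
      qed
      finally have "ennreal (V \<omega>) \<le> ennreal (2 * (Y \<omega> - S n \<omega>)\<^sup>2 + 2 * (S n \<omega> - R K \<omega>)\<^sup>2)" by (rule ennreal_leI)
      also have "\<dots> = 2 * ennreal ((Y \<omega> - S n \<omega>)\<^sup>2) + 2 * ennreal ((S n \<omega> - R K \<omega>)\<^sup>2)"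
        by (simp add: ennreal_plus ennreal_mult)
      finally show ?case .
    qed
    also have "\<dots> = 2 * (\<integral>\<^sup>+\<omega>. ennreal ((Y \<omega> - S n \<omega>)\<^sup>2) \<partial>M) + 2 * (\<integral>\<^sup>+\<omega>. ennreal ((S n \<omega> - R K \<omega>)\<^sup>2) \<partial>M)"
      by (simp add: nn_integral_add nn_integral_cmult)
    also have "\<dots> \<le> 2 * \<alpha> n + 2 * (2 * \<beta> n + ennreal (2 * (\<delta> K)\<^sup>2 * t))"
      unfolding SR by (intro add_mono mult_left_mono YS FG) auto
    finally show ?thesis .
  qed
  have "(\<integral>\<^sup>+\<omega>. ennreal (V \<omega>) \<partial>M) \<le> 2 * 0 + 2 * (2 * 0 + ennreal (2 * 0\<^sup>2 * t))"
  proof (rule LIMSEQ_le_const)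
    show "\<exists>N. \<forall>n\<ge>N. (\<integral>\<^sup>+\<omega>. ennreal (V \<omega>) \<partial>M) \<le> 2 * \<alpha> n + 2 * (2 * \<beta> n + ennreal (2 * (\<delta> n)\<^sup>2 * t))"
      using key by blast
    show "(\<lambda>n. 2 * \<alpha> n + 2 * (2 * \<beta> n + ennreal (2 * (\<delta> n)\<^sup>2 * t))) \<longlonglongrightarrow> 2 * 0 + 2 * (2 * 0 + ennreal (2 * 0\<^sup>2 * t))"
      by (intro tendsto_add ennreal_tendsto_cmult lim1[folded \<beta>_def] lim2[folded \<alpha>_def] tendsto_ennrealI
          tendsto_mult[OF tendsto_mult[OF tendsto_const tendsto_power[OF \<delta>]] tendsto_const]) simp_all
  qed
  then have "(\<integral>\<^sup>+\<omega>. ennreal (V \<omega>) \<partial>M) = 0" by simp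
  then have "AE \<omega> in M. ennreal (V \<omega>) = 0" by (subst (asm) nn_integral_0_iff_AE) auto
  then show ?thesis
    by eventually_elim (auto simp: V_def Y_def max_def split: if_splits)
qed

section \<open>Volume estimates for quasi-uniform meshes\<close>

lemma diameter_cball_ge:
  fixes x :: "real^'d::finite"
  assumes "cball x r \<subseteq> K" "bounded K" "r \<ge> 0"
  shows "2 * r \<le> diameter K"
  using diameter_subset[OF assms(1,2)] assms(3) by simp

locale mesh =
  fixes \<kappa> :: real and \<T> :: "(real^'d::finite) set set"
  assumes qu: "quasi_uniform_mesh \<kappa> \<T>"
begin

lemma finite_mesh: "finite \<T>" and simplex: "K \<in> \<T> \<Longrightarrow> int CARD('d) simplex K"
  and cover: "\<Union>\<T> = cbox 0 1"
  and face: "K \<in> \<T> \<Longrightarrow> L \<in> \<T> \<Longrightarrow> (K \<inter> L) face_of K"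
  and regular: "K \<in> \<T> \<Longrightarrow> diameter K \<le> \<kappa> * in_diameter K"
  and uniform: "K \<in> \<T> \<Longrightarrow> mesh_size \<T> \<le> \<kappa> * diameter K"
  using qu by (auto simp: quasi_uniform_mesh_def triangulation_def)

lemma compact_element: "K \<in> \<T> \<Longrightarrow> compact K"
  and convex_element: "K \<in> \<T> \<Longrightarrow> convex K"
  using simplex compact_simplex convex_simplex by blast+

lemma mesh_nonempty: "\<T> \<noteq> {}"
proof
  assume "\<T> = {}"
  then have "(0 :: real^'d) \<notin> cbox 0 1" using cover by auto
  then show False by (simp add: mem_box_cart)
qed

text \<open>Shape regularity and quasi-uniformity together give every element a ball whose radius is
  comparable to the mesh size; all volume estimates below rest on it.\<close>

lemma element_ball:
  assumes K: "K \<in> \<T>"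
  obtains x r where "r > 0" "cball x r \<subseteq> K" "mesh_size \<T> \<le> 4 * \<kappa>\<^sup>2 * r" "mesh_size \<T> > 0" "\<kappa> > 0"
proof -
  have bK: "bounded K" using compact_element[OF K] by (rule compact_imp_bounded)
  define R where "R = {2 * r |r. r \<ge> 0 \<and> (\<exists>x. cball x r \<subseteq> K)}"
  have bdd: "bdd_above R" unfolding R_def
    by (rule bdd_aboveI[of _ "diameter K"]) (use diameter_cball_ge[OF _ bK] in auto)
  have "aff_dim K = int DIM(real^'d)" using simplex[OF K] by (simp add: aff_dim_simplex)
  then have "interior K \<noteq> {}"
    using rel_interior_eq_empty[OF convex_element[OF K]] by (auto simp: interior_rel_interior_gen)
  then obtain x0 r0 where r0: "r0 > 0" "cball x0 r0 \<subseteq> K"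
    by (metis ex_in_conv mem_interior_cball)
  have in0: "2 * r0 \<in> R" unfolding R_def using r0 by auto
  have dpos: "diameter K > 0" using diameter_cball_ge[OF r0(2) bK] r0 by simp
  have hpos: "mesh_size \<T> > 0"
  proof -
    have "diameter K \<le> mesh_size \<T>" unfolding mesh_size_def using finite_mesh K by simp
    then show ?thesis using dpos by simp
  qed
  have in_eq: "in_diameter K = Sup R" by (simp add: in_diameter_def R_def)
  have inpos: "in_diameter K > 0"
    using cSup_upper[OF in0 bdd] r0 in_eq by simp
  have \<kappa>: "\<kappa> > 0" using regular[OF K] dpos inpos by (smt (verit) mult_nonpos_nonneg)
  have "in_diameter K / 2 < Sup R" using inpos in_eq by simp
  then obtain y where "y \<in> R" "in_diameter K / 2 < y"
    using less_cSupD[of R] in0 by blast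
  then obtain x r where r: "r \<ge> 0" "cball x r \<subseteq> K" "in_diameter K / 2 < 2 * r" by (auto simp: R_def)
  have "mesh_size \<T> \<le> \<kappa> * (\<kappa> * in_diameter K)"
    using uniform[OF K] mult_left_mono[OF regular[OF K], of \<kappa>] \<kappa> by linarith
  also have "\<dots> \<le> \<kappa> * (\<kappa> * (4 * r))" using \<kappa> r by (intro mult_left_mono) auto
  finally have "mesh_size \<T> \<le> 4 * \<kappa>\<^sup>2 * r" by (simp add: power2_eq_square mult_ac)
  moreover have "r > 0" using r inpos by simp
  ultimately show ?thesis using that r hpos \<kappa> by blast
qed

lemma mesh_size_pos: "mesh_size \<T> > 0" and kappa_pos: "\<kappa> > 0"
proof -
  obtain K where "K \<in> \<T>" using mesh_nonempty by auto
  from element_ball[OF this] show "mesh_size \<T> > 0" "\<kappa> > 0" by metis+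
qed

lemma element_measure_ge:
  assumes K: "K \<in> \<T>"
  shows "unit_ball_vol CARD('d) * (mesh_size \<T> / (4 * \<kappa>\<^sup>2)) ^ CARD('d) \<le> measure lebesgue K"
proof -
  obtain x r where r: "r > 0" "cball x r \<subseteq> K" "mesh_size \<T> \<le> 4 * \<kappa>\<^sup>2 * r"
    using element_ball[OF K] by metis
  have "mesh_size \<T> / (4 * \<kappa>\<^sup>2) \<le> r" using r(3) kappa_pos by (simp add: divide_le_eq mult.commute)
  then have "unit_ball_vol CARD('d) * (mesh_size \<T> / (4 * \<kappa>\<^sup>2)) ^ CARD('d) \<le> unit_ball_vol CARD('d) * r ^ CARD('d)"
    using mesh_size_pos by (intro mult_left_mono power_mono) auto
  also have "\<dots> = measure lborel (cball x r)" using content_cball[of r x] r by simp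
  also have "\<dots> = measure lebesgue (cball x r)" by simp
  also have "\<dots> \<le> measure lebesgue K"
    using r compact_element[OF K] by (intro measure_mono_fmeasurable lmeasurable_compact) auto
  finally show ?thesis .
qed

text \<open>Distinct elements overlap in a proper face of one of them, a null set, so the volumes of all elements sum
  to one.\<close>

lemma card_mesh_le:
  "real (card \<T>) * (unit_ball_vol CARD('d) * (mesh_size \<T> / (4 * \<kappa>\<^sup>2)) ^ CARD('d)) \<le> 1"
proof -
  have neg: "negligible (K \<inter> L)" if K: "K \<in> \<T>" and L: "L \<in> \<T>" and ne: "K \<noteq> L" for K L
  proof -
    have low: "negligible (K \<inter> L)" if "K \<inter> L \<noteq> K" "K \<in> \<T>" "(K \<inter> L) face_of K" for K L
    proof -
      have "aff_dim (K \<inter> L) < aff_dim K"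
        using convex_element that by (intro face_of_aff_dim_lt) auto
      also have "\<dots> \<le> int DIM(real^'d)" by (rule aff_dim_le_DIM)
      finally have "interior (K \<inter> L) = {}" by (simp add: interior_rel_interior_gen)
      moreover have "convex (K \<inter> L)" using that(3) by (rule face_of_imp_convex)
      ultimately show ?thesis by (simp add: negligible_convex_interior)
    qed
    show ?thesis
    proof (cases "K \<inter> L = K")
      case True
      then have "L \<inter> K \<noteq> L" using ne by auto
      then have "negligible (L \<inter> K)" using L face[OF L K] by (intro low)
      then show ?thesis by (simp add: Int_commute)
    next
      case False
      then show ?thesis using K face[OF K L] by (intro low)
    qed
  qed
  have "real (card \<T>) * (unit_ball_vol CARD('d) * (mesh_size \<T> / (4 * \<kappa>\<^sup>2)) ^ CARD('d)) =
      (\<Sum>K\<in>\<T>. unit_ball_vol CARD('d) * (mesh_size \<T> / (4 * \<kappa>\<^sup>2)) ^ CARD('d))" by simp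
  also have "\<dots> \<le> (\<Sum>K\<in>\<T>. measure lebesgue K)" by (intro sum_mono element_measure_ge)
  also have "\<dots> = measure lebesgue (\<Union>\<T>)"
    using finite_mesh compact_element neg
    by (intro measure_negligible_finite_Union[symmetric]) (auto simp: pairwise_def lmeasurable_compact)
  also have "\<dots> = measure lborel (cbox 0 1 :: (real^'d) set)" unfolding cover by simp
  also have "\<dots> = 1"
    by (subst content_cbox_cart) (auto simp: interval_eq_empty_cart)
  finally show ?thesis .
qed

lemma vertices:
  assumes K: "K \<in> \<T>"
  obtains C where "finite C" "card C = CARD('d) + 1" "{x. x extreme_point_of K} \<subseteq> C"
proof -
  obtain C where C: "\<not> affine_dependent C" "int (card C) = int CARD('d) + 1" "K = convex hull C"
    using simplex[OF K] unfolding simplex_def by blast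
  have "finite C" using C(1) by (rule aff_independent_finite)
  moreover have "card C = CARD('d) + 1" using C(2) by linarith
  moreover have "{x. x extreme_point_of K} \<subseteq> C" using C(3) extreme_point_of_convex_hull by blast
  ultimately show ?thesis by (rule that)
qed

lemma finite_nodes: "finite (nodes \<T>)"
  and card_nodes_le: "card (nodes \<T>) \<le> card \<T> * (CARD('d) + 1)"
proof -
  have eq: "nodes \<T> = (\<Union>K\<in>\<T>. {x. x extreme_point_of K})" by (auto simp: nodes_def)
  have K: "finite {x. x extreme_point_of K}" "card {x. x extreme_point_of K} \<le> CARD('d) + 1" if "K \<in> \<T>" for K
    using vertices[OF that] by (metis finite_subset, metis card_mono)
  show "finite (nodes \<T>)" unfolding eq using finite_mesh K by blast
  have "card (nodes \<T>) \<le> (\<Sum>K\<in>\<T>. card {x. x extreme_point_of K})"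
    unfolding eq by (rule card_UN_le[OF finite_mesh])
  also have "\<dots> \<le> (\<Sum>K\<in>\<T>. CARD('d) + 1)" by (intro sum_mono K)
  finally show "card (nodes \<T>) \<le> card \<T> * (CARD('d) + 1)" by simp
qed

lemma nodal_affine:
  assumes \<phi>: "nodal_basis \<T> \<phi>" and z: "z \<in> nodes \<T>" and K: "K \<in> \<T>"
  shows "\<exists>a b. \<forall>y\<in>K. \<phi> z y = a \<bullet> y + b"
proof -
  have "\<phi> z \<in> fe_space \<T>" using \<phi> z by (simp add: nodal_basis_def)
  then have "\<forall>K\<in>\<T>. \<exists>a b. \<forall>y\<in>K. \<phi> z y = a \<bullet> y + b" by (simp add: fe_space_def)
  then show ?thesis using K by (rule bspec)
qed

text \<open>A nodal function is affine on each element and takes the values \<open>0\<close> and \<open>1\<close> at its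
  vertices.\<close>

lemma nodal_bounds:
  assumes \<phi>: "nodal_basis \<T> \<phi>" and z: "z \<in> nodes \<T>" and x: "x \<in> cbox 0 1"
  shows "0 \<le> \<phi> z x" "\<phi> z x \<le> 1"
proof -
  obtain K where K: "K \<in> \<T>" "x \<in> K" using x cover by blast
  obtain a b where ab: "\<And>y. y \<in> K \<Longrightarrow> \<phi> z y = a \<bullet> y + b"
    using nodal_affine[OF \<phi> z K(1)] by metis
  define S where "S = {y. 0 \<le> a \<bullet> y + b \<and> a \<bullet> y + b \<le> 1}"
  have "S = {y. a \<bullet> y \<ge> - b} \<inter> {y. a \<bullet> y \<le> 1 - b}" by (auto simp: S_def)
  then have "convex S" by (simp add: convex_Int convex_halfspace_le convex_halfspace_ge)
  moreover have "y \<in> S" if y: "y extreme_point_of K" for y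
  proof -
    have "y \<in> K" using y by (simp add: extreme_point_of_def)
    moreover have "y \<in> nodes \<T>" using y K(1) by (auto simp: nodes_def)
    then have "\<phi> z y = (if z = y then 1 else 0)" using \<phi> z by (auto simp: nodal_basis_def)
    ultimately show ?thesis using ab[of y] by (auto simp: S_def split: if_splits)
  qed
  ultimately have "convex hull {y. y extreme_point_of K} \<subseteq> S" by (intro hull_minimal) auto
  then have "x \<in> S"
    using K(2) Krein_Milman_Minkowski[OF compact_element[OF K(1)] convex_element[OF K(1)]] by (metis subsetD)
  then show "0 \<le> \<phi> z x" "\<phi> z x \<le> 1" using ab[OF K(2)] by (auto simp: S_def)
qed

lemma nodal_measurable:
  assumes \<phi>: "nodal_basis \<T> \<phi>" and z: "z \<in> nodes \<T>"
  shows "\<phi> z \<in> borel_measurable cubeM"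
proof -
  have "continuous_on (cbox 0 1) (\<phi> z)" using \<phi> z by (auto simp: nodal_basis_def fe_space_def)
  then have "continuous_on (box 0 1) (\<phi> z)" by (rule continuous_on_subset) (rule box_subset_cbox)
  then have "\<phi> z \<in> borel_measurable (restrict_space borel (box 0 1))"
    by (rule borel_measurable_continuous_on_restrict)
  moreover have "sets (restrict_space borel (box 0 1)) = sets (cubeM :: (real^'d) measure)"
    by (rule sets_restrict_space_cong) simp
  ultimately show ?thesis using measurable_cong_sets by blast
qed

text \<open>Contracting a ball inside an element by the factor one half towards a vertex \<open>z\<close> gives a ball
  on which the nodal function of \<open>z\<close> is at least one half.\<close>

lemma nodal_integral_ge:
  assumes \<phi>: "nodal_basis \<T> \<phi>" and z: "z \<in> nodes \<T>"
  shows "unit_ball_vol CARD('d) / 2 * (mesh_size \<T> / (8 * \<kappa>\<^sup>2)) ^ CARD('d) \<le> L2_inner (\<phi> z) (\<lambda>_. 1)"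
proof -
  obtain K where K: "K \<in> \<T>" "z extreme_point_of K" using z by (auto simp: nodes_def)
  have zK: "z \<in> K" using K(2) by (simp add: extreme_point_of_def)
  have Kc: "K \<subseteq> cbox 0 1" using K(1) cover by blast
  obtain x0 r where r: "r > 0" "cball x0 r \<subseteq> K" "mesh_size \<T> \<le> 4 * \<kappa>\<^sup>2 * r"
    using element_ball[OF K(1)] by metis
  obtain a b where ab: "\<And>y. y \<in> K \<Longrightarrow> \<phi> z y = a \<bullet> y + b"
    using nodal_affine[OF \<phi> z K(1)] by metis
  have \<phi>1: "\<phi> z z = 1" using \<phi> z by (auto simp: nodal_basis_def)
  define E where "E = ball ((1/2) *\<^sub>R (x0 + z)) (r / 2)"
  have half: "y \<in> K \<and> 1/2 \<le> \<phi> z y" if y: "y \<in> E" for y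
  proof -
    define x where "x = 2 *\<^sub>R y - z"
    have "dist x0 x = norm (2 *\<^sub>R ((1/2) *\<^sub>R (x0 + z) - y))"
      by (simp add: dist_norm x_def scaleR_diff_right algebra_simps)
    also have "\<dots> = 2 * dist ((1/2) *\<^sub>R (x0 + z)) y" by (simp add: dist_norm)
    also have "\<dots> \<le> r" using y by (simp add: E_def)
    finally have xK: "x \<in> K" using r(2) by auto
    have yx: "y = (1/2) *\<^sub>R x + (1/2) *\<^sub>R z" by (simp add: x_def scaleR_diff_right)
    have yK: "y \<in> K" unfolding yx by (rule convexD[OF convex_element[OF K(1)] xK zK]) auto
    have "\<phi> z y = 1/2 * \<phi> z x + 1/2 * \<phi> z z"
      using ab[OF yK] ab[OF xK] ab[OF zK] by (simp add: yx inner_add_right field_simps)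
    moreover have "0 \<le> \<phi> z x" using nodal_bounds(1)[OF \<phi> z] xK Kc by blast
    ultimately show ?thesis using yK \<phi>1 by simp
  qed
  have Ebox: "E \<subseteq> box 0 1"
  proof -
    have "E \<subseteq> interior (cbox 0 1)"
      by (rule interior_maximal) (use half Kc in \<open>auto simp: E_def\<close>)
    then show ?thesis by simp
  qed
  have Em: "E \<in> sets cubeM" using Ebox by (auto simp: sets_restrict_space_iff E_def)
  interpret prob_space "cubeM :: (real^'d) measure" by (rule prob_space_cubeM)
  have \<phi>m: "\<phi> z \<in> borel_measurable cubeM" by (rule nodal_measurable[OF \<phi> z])
  have \<phi>01: "0 \<le> \<phi> z x" "\<phi> z x \<le> 1" if "x \<in> box 0 1" for x
    using nodal_bounds[OF \<phi> z, of x] that box_subset_cbox by blast+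
  have "mesh_size \<T> / (8 * \<kappa>\<^sup>2) \<le> r / 2" using r(3) kappa_pos by (simp add: divide_le_eq mult.commute)
  then have "unit_ball_vol CARD('d) / 2 * (mesh_size \<T> / (8 * \<kappa>\<^sup>2)) ^ CARD('d) \<le>
      unit_ball_vol CARD('d) / 2 * (r / 2) ^ CARD('d)"
    using mesh_size_pos by (intro mult_left_mono power_mono) auto
  also have "\<dots> = 1/2 * measure cubeM E"
    using content_ball[of "r / 2" "(1/2) *\<^sub>R (x0 + z)"] r Ebox by (simp add: measure_restrict_space E_def)
  also have "\<dots> = (\<integral>x. 1/2 * indicator E x \<partial>cubeM)"
    using Em Ebox by (simp add: space_cubeM Int_absorb2)
  also have "\<dots> \<le> (\<integral>x. \<phi> z x * 1 \<partial>cubeM)"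
  proof (rule integral_mono)
    show "integrable cubeM (\<lambda>x. 1/2 * indicator E x :: real)"
      using Em by (intro integrable_mult_right integrable_real_indicator) (auto simp: emeasure_eq_measure)
    show "integrable cubeM (\<lambda>x. \<phi> z x * 1)"
      by (intro integrable_const_bound[where B=1] AE_I2) (use \<phi>m \<phi>01 in \<open>auto simp: space_cubeM abs_le_iff\<close>)
    show "1/2 * indicator E x \<le> \<phi> z x * 1" if "x \<in> space cubeM" for x
      using half \<phi>01 that by (auto simp: indicator_def space_cubeM)
  qed
  finally show ?thesis by (simp add: L2_inner_def)
qed

lemma nodal_integrable:
  assumes \<phi>: "nodal_basis \<T> \<phi>" and z: "z \<in> nodes \<T>"
  shows "integrable cubeM (\<phi> z)"
proof -
  interpret prob_space "cubeM :: (real^'d) measure" by (rule prob_space_cubeM)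
  show ?thesis
  proof (rule integrable_const_bound[where B=1])
    show "AE x in cubeM. norm (\<phi> z x) \<le> 1"
    proof (rule AE_I2)
      fix x :: "real^'d" assume "x \<in> space cubeM"
      then have "x \<in> cbox 0 1" using box_subset_cbox by (auto simp: space_cubeM)
      from nodal_bounds[OF \<phi> z this] show "norm (\<phi> z x) \<le> 1" by simp
    qed
  qed (rule nodal_measurable[OF \<phi> z])
qed

lemma noise_coeff_mean_zero:
  assumes \<phi>: "nodal_basis \<T> \<phi>" and z: "z \<in> nodes \<T>"
  shows "L2_inner (noise_coeff \<phi> z) (\<lambda>_. 1) = 0"
proof -
  interpret prob_space "cubeM :: (real^'d) measure" by (rule prob_space_cubeM)
  have one: "measure (cubeM :: (real^'d) measure) (box 0 1) = 1"
    using prob_space by (simp only: space_cubeM)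
  show ?thesis
    using nodal_integrable[OF \<phi> z]
    by (simp add: L2_inner_def noise_coeff_def mean_def measure_box_0_1 one space_cubeM)
qed

text \<open>The numerator of the coefficient is at most one, and its denominator squared is of the order of
  the volume of an element.  Bounding the numerator pointwise loses the smallness of the support of the
  nodal function, that is a factor \<open>h\<^sup>d\<close>, which the final estimate leaves room for.\<close>

lemma noise_coeff_L2_norm_le:
  assumes \<phi>: "nodal_basis \<T> \<phi>" and z: "z \<in> nodes \<T>"
  shows "L2_inner (noise_coeff \<phi> z) (noise_coeff \<phi> z) \<le>
    (real CARD('d) + 1) / (unit_ball_vol CARD('d) / 2 * (mesh_size \<T> / (8 * \<kappa>\<^sup>2)) ^ CARD('d))"
proof -
  interpret prob_space "cubeM :: (real^'d) measure" by (rule prob_space_cubeM)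
  define I where "I = L2_inner (\<phi> z) (\<lambda>_. 1)"
  define c where "c = unit_ball_vol CARD('d) / 2 * (mesh_size \<T> / (8 * \<kappa>\<^sup>2)) ^ CARD('d)"
  have c: "0 < c" unfolding c_def using mesh_size_pos kappa_pos by simp
  have cI: "c \<le> I" unfolding c_def I_def by (rule nodal_integral_ge[OF \<phi> z])
  have mean: "mean (\<phi> z) = I" by (simp add: mean_def I_def L2_inner_def measure_box_0_1)
  have b: "0 \<le> \<phi> z x" "\<phi> z x \<le> 1" if "x \<in> box 0 1" for x
    using nodal_bounds[OF \<phi> z, of x] that box_subset_cbox by blast+
  have I1: "I \<le> 1"
  proof -
    have "I = (\<integral>x. \<phi> z x \<partial>cubeM)" by (simp add: I_def L2_inner_def)
    also have "\<dots> \<le> (\<integral>x. 1 \<partial>(cubeM :: (real^'d) measure))"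
      by (rule integral_mono[OF nodal_integrable[OF \<phi> z]]) (use b in \<open>auto simp: space_cubeM\<close>)
    also have "\<dots> = 1" using prob_space by simp
    finally show ?thesis .
  qed
  have pt: "(noise_coeff \<phi> z x)\<^sup>2 \<le> (real CARD('d) + 1) / I" if x: "x \<in> box 0 1" for x
  proof -
    have "\<bar>\<phi> z x - I\<bar> \<le> 1" using b[OF x] I1 cI c by (simp add: abs_le_iff)
    then have "(\<phi> z x - I)\<^sup>2 \<le> 1\<^sup>2" using abs_le_square_iff[of "\<phi> z x - I" 1] by simp
    moreover have "(noise_coeff \<phi> z x)\<^sup>2 = (\<phi> z x - I)\<^sup>2 * ((real CARD('d) + 1) / I)"
      using cI c by (simp add: noise_coeff_def mean I_def[symmetric] power_divide field_simps)
    ultimately show ?thesis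
      using mult_right_mono[of "(\<phi> z x - I)\<^sup>2" 1 "(real CARD('d) + 1) / I"] cI c by simp
  qed
  have m: "noise_coeff \<phi> z \<in> borel_measurable cubeM"
    unfolding noise_coeff_def[abs_def] using nodal_measurable[OF \<phi> z] by simp
  have "L2_inner (noise_coeff \<phi> z) (noise_coeff \<phi> z) = (\<integral>x. (noise_coeff \<phi> z x)\<^sup>2 \<partial>cubeM)"
    by (simp add: L2_inner_def power2_eq_square)
  also have "\<dots> \<le> (\<integral>x. (real CARD('d) + 1) / I \<partial>(cubeM :: (real^'d) measure))"
  proof (rule integral_mono)
    show "integrable cubeM (\<lambda>x. (noise_coeff \<phi> z x)\<^sup>2)"
    proof (rule integrable_const_bound[where B="(real CARD('d) + 1) / I"])
      show "AE x in cubeM. norm ((noise_coeff \<phi> z x)\<^sup>2) \<le> (real CARD('d) + 1) / I"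
        using pt by (intro AE_I2) (simp add: space_cubeM)
    qed (use m in simp)
  qed (use pt in \<open>auto simp: space_cubeM\<close>)
  also have "\<dots> = (real CARD('d) + 1) / I" using prob_space by simp
  also have "\<dots> \<le> (real CARD('d) + 1) / c" using c cI by (intro divide_left_mono) auto
  finally show ?thesis by (simp add: c_def)
qed

end

section \<open>Pathwise bounds for the stochastic convolution\<close>

lemma neumann_eigenvalue_pos:
  assumes "m \<noteq> (\<lambda>_. 0)" shows "0 < neumann_eigenvalue m"
proof -
  obtain i where "m i \<noteq> 0" using assms by auto
  then show ?thesis
    unfolding neumann_eigenvalue_def by (intro sum_pos2[where i=i]) auto
qed

text \<open>The only place where \<open>d \<le> 3\<close> enters: the eigenvalues grow like the square of the frequency, so
  \<open>\<Sum> lam\<^sub>m\<^sup>-\<^sup>7\<^sup>/\<^sup>4\<close> converges for \<open>d < 7/2\<close>.  Since \<open>lam\<^sub>m\<close> dominates every \<open>(1 + m\<^sub>i\<^sup>2) / 2\<close>, it dominates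
  their geometric mean, and the sum of the resulting products factorizes.\<close>

lemma neumann_eigenvalues_summable:
  assumes d: "CARD('d::finite) \<le> 3"
  shows "\<exists>S\<ge>0. \<forall>A :: ('d \<Rightarrow> nat) set. finite A \<longrightarrow> (\<lambda>_. 0) \<notin> A \<longrightarrow>
    (\<Sum>m\<in>A. neumann_eigenvalue m powr (- (7/4))) \<le> S"
proof -
  define \<alpha> where "\<alpha> n = (1 + (real n)\<^sup>2) powr (- (7/12))" for n :: nat
  have \<alpha>: "\<alpha> n \<ge> 0" for n by (simp add: \<alpha>_def)
  have "summable \<alpha>"
  proof (rule summable_comparison_test')
    show "summable (\<lambda>n. real n powr (- (7/6)))" by (subst summable_real_powr_iff) simp
    fix n :: nat assume n: "1 \<le> n"
    have "\<alpha> n \<le> ((real n)\<^sup>2) powr (- (7/12))"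
      unfolding \<alpha>_def using n by (intro powr_mono2') auto
    also have "(real n)\<^sup>2 = real n powr 2" using n by (simp add: powr_numeral)
    also have "(real n powr 2) powr (- (7/12)) = real n powr (- (7/6))"
      unfolding powr_powr by simp
    finally show "norm (\<alpha> n) \<le> real n powr (- (7/6))" using \<alpha> by simp
  qed
  define \<Sigma> where "\<Sigma> = suminf \<alpha>"
  have \<Sigma>: "(\<Sum>n\<le>N. \<alpha> n) \<le> \<Sigma>" for N
    unfolding \<Sigma>_def using sum_le_suminf[OF \<open>summable \<alpha>\<close>, of "{..N}"] \<alpha> by simp
  have \<Sigma>0: "0 \<le> \<Sigma>" using \<Sigma>[of 0] \<alpha>[of 0] by simp
  have pt: "neumann_eigenvalue m powr (- (7/4)) \<le> 2 powr (7/4) * (\<Prod>i\<in>UNIV. \<alpha> (m i))"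
    if m: "m \<noteq> (\<lambda>_. 0)" for m :: "'d \<Rightarrow> nat"
  proof -
    define n2 where "n2 = (\<Sum>i\<in>UNIV. (real (m i))\<^sup>2)"
    obtain i0 where i0: "m i0 \<noteq> 0" using m by auto
    have mi: "(real (m i))\<^sup>2 \<le> n2" for i
      unfolding n2_def by (rule member_le_sum) auto
    have n21: "1 \<le> n2"
    proof -
      have "1 \<le> real (m i0)" using i0 by simp
      then have "1 \<le> (real (m i0))\<^sup>2" by (rule one_le_power)
      then show ?thesis using mi[of i0] by linarith
    qed
    have lam: "n2 \<le> neumann_eigenvalue m"
    proof -
      have "1 \<le> pi\<^sup>2" using pi_ge_two by (intro one_le_power) simp
      then have "1 * n2 \<le> pi\<^sup>2 * n2" using n21 by (intro mult_right_mono) auto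
      then show ?thesis
        by (simp add: n2_def neumann_eigenvalue_def power_mult_distrib sum_distrib_left mult.commute)
    qed
    define P where "P = (\<Prod>i\<in>UNIV. 1 + (real (m i))\<^sup>2)"
    have P1: "1 \<le> P" unfolding P_def by (intro prod_ge_1) simp
    have "P \<le> (\<Prod>i\<in>(UNIV :: 'd set). 2 * n2)"
      unfolding P_def
    proof (intro prod_mono conjI)
      fix i show "1 + (real (m i))\<^sup>2 \<le> 2 * n2" using mi[of i] n21 by linarith
    qed auto
    then have P: "P \<le> (2 * n2) ^ CARD('d)" by simp
    have "P powr (7/12) \<le> ((2 * n2) ^ CARD('d)) powr (7/12)"
      using P P1 by (intro powr_mono2) auto
    also have "\<dots> = (2 * n2) powr (real CARD('d) * (7/12))"
    proof -
      have "(2 * n2) ^ CARD('d) = (2 * n2) powr real CARD('d)"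
        using n21 by (intro powr_realpow[symmetric]) simp
      then show ?thesis by (simp only: powr_powr)
    qed
    also have "\<dots> \<le> (2 * n2) powr (7/4)"
      using d n21 by (intro powr_mono) auto
    finally have "(2 * n2) powr (- (7/4)) \<le> P powr (- (7/12))"
      using P1 n21 by (simp add: powr_minus le_imp_inverse_le)
    then have le: "2 powr (7/4) * (2 * n2) powr (- (7/4)) \<le> 2 powr (7/4) * P powr (- (7/12))"
      by (rule mult_left_mono) simp
    have "neumann_eigenvalue m powr (- (7/4)) \<le> n2 powr (- (7/4))"
      using lam n21 by (intro powr_mono2') auto
    also have "\<dots> = 2 powr (7/4) * (2 * n2) powr (- (7/4))"
      using n21 by (simp add: powr_mult powr_minus)
    also note le
    also have "P powr (- (7/12)) = (\<Prod>i\<in>UNIV. \<alpha> (m i))"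
      unfolding P_def \<alpha>_def by (rule prod_powr_distrib)
    finally show ?thesis .
  qed
  show ?thesis
  proof (intro exI[of _ "2 powr (7/4) * \<Sigma> ^ CARD('d)"] conjI allI impI)
    show "0 \<le> 2 powr (7/4) * \<Sigma> ^ CARD('d)" using \<Sigma>0 by simp
    fix A :: "('d \<Rightarrow> nat) set" assume A: "finite A" "(\<lambda>_. 0) \<notin> A"
    define N where "N = Max (insert 0 ((\<lambda>(m, i). m i) ` (A \<times> UNIV)))"
    have N: "m i \<le> N" if "m \<in> A" for m i
      unfolding N_def by (rule Max_ge) (use A that in auto)
    have sub: "A \<subseteq> PiE UNIV (\<lambda>_. {..N})" using N by (auto simp: PiE_iff)
    have "(\<Sum>m\<in>A. neumann_eigenvalue m powr (- (7/4))) \<le> (\<Sum>m\<in>A. 2 powr (7/4) * (\<Prod>i\<in>UNIV. \<alpha> (m i)))"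
      using A by (intro sum_mono pt) auto
    also have "\<dots> = 2 powr (7/4) * (\<Sum>m\<in>A. \<Prod>i\<in>UNIV. \<alpha> (m i))" by (simp add: sum_distrib_left)
    also have "\<dots> \<le> 2 powr (7/4) * (\<Sum>m\<in>PiE UNIV (\<lambda>_::'d. {..N}). \<Prod>i\<in>UNIV. \<alpha> (m i))"
      using sub \<alpha> by (intro mult_left_mono sum_mono2 finite_PiE prod_nonneg) auto
    also have "(\<Sum>m\<in>PiE UNIV (\<lambda>_::'d. {..N}). \<Prod>i\<in>UNIV. \<alpha> (m i)) = (\<Prod>i\<in>(UNIV :: 'd set). \<Sum>n\<le>N. \<alpha> n)"
      by (rule prod_sum_PiE[symmetric]) auto
    also have "\<dots> = (\<Sum>n\<le>N. \<alpha> n) ^ CARD('d)" by simp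
    also have "2 powr (7/4) * (\<Sum>n\<le>N. \<alpha> n) ^ CARD('d) \<le> 2 powr (7/4) * \<Sigma> ^ CARD('d)"
      using \<Sigma> \<alpha> by (intro mult_left_mono power_mono sum_nonneg) auto
    finally show "(\<Sum>m\<in>A. neumann_eigenvalue m powr (- (7/4))) \<le> 2 powr (7/4) * \<Sigma> ^ CARD('d)" .
  qed
qed

lemma abs_exp_minus_diff_le:
  fixes x y :: real
  assumes "0 \<le> x" "0 \<le> y"
  shows "\<bar>exp (- x) - exp (- y)\<bar> \<le> \<bar>x - y\<bar>"
proof -
  have *: "exp (- x) - exp (- y) \<le> y - x" if "0 \<le> x" "x \<le> y" for x y :: real
  proof -
    have "exp (- x) - exp (- y) = exp (- x) * (1 - exp (- (y - x)))"
      by (simp add: right_diff_distrib exp_add[symmetric])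
    also have "\<dots> \<le> 1 * (y - x)"
    proof (rule mult_mono)
      show "1 - exp (- (y - x)) \<le> y - x" using exp_ge_add_one_self[of "- (y - x)"] by linarith
    qed (use that in auto)
    finally show ?thesis by simp
  qed
  show ?thesis
  proof (cases "x \<le> y")
    case True
    have "0 \<le> exp (- x) - exp (- y)" using True by simp
    then show ?thesis using *[OF assms(1) True] True by simp
  next
    case False
    then have "0 \<le> exp (- y) - exp (- x)" "y \<le> x" by auto
    then show ?thesis using *[OF assms(2), of x] by simp
  qed
qed

text \<open>The \<open>m\<close>-th cosine coefficient of the stochastic convolution is a multiple of an
  Ornstein--Uhlenbeck process with damping \<open>a = \<epsilon> lam\<^sub>m\<^sup>2\<close>; by the bound for discrete convolutions it is
  smaller than the driving path by the factor \<open>a\<^sup>-\<^sup>7\<^sup>/\<^sup>1\<^sup>6\<close>.\<close>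

lemma convolution_coefficient_bound:
  fixes X :: "'w \<Rightarrow> real^'d::finite \<Rightarrow> real"
  assumes M: "prob_space M" and B: "brownian_motion M B" and T: "T > 0" and J: "J \<le> 2 ^ N0"
    and t: "t = T * real J / 2 ^ N0"
    and X: "wiener_integral M B 0 t \<Phi> X"
    and \<Phi>: "\<And>s. s \<in> {0..t} \<Longrightarrow> exp_bilaplacian \<epsilon> (t - s) g (\<Phi> s)"
    and zero: "L2_inner g (\<lambda>_. 1) = 0" and \<epsilon>: "\<epsilon> > 0"
    and Hm: "H \<in> borel_measurable M" and H0: "\<And>\<omega>. 0 \<le> H \<omega>"
    and H: "AE \<omega> in M. \<forall>N i j. i \<le> j \<and> j \<le> 2 ^ N \<longrightarrow>
          \<bar>B (T * real j / 2 ^ N) \<omega> - B (T * real i / 2 ^ N) \<omega>\<bar> \<le> H \<omega> * (real (j - i) / 2 ^ N) powr (7 / 16)"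
  shows "AE \<omega> in M. \<bar>L2_inner (X \<omega>) (cosine m)\<bar> \<le>
    \<bar>L2_inner g (cosine m)\<bar> * (3 * (H \<omega> * T powr (- (7/16))) * (\<epsilon> * (neumann_eigenvalue m)\<^sup>2) powr (- (7/16)))"
proof -
  define a where "a = \<epsilon> * (neumann_eigenvalue m)\<^sup>2"
  define c where "c = L2_inner g (cosine m)"
  have a0: "a \<ge> 0" using \<epsilon> by (simp add: a_def)
  have a: "a > 0 \<or> c = 0"
  proof (cases "m = (\<lambda>_. 0)")
    case True
    have "cosine m = (\<lambda>_. 1)" unfolding True by (rule ext) (rule cosine_zero)
    then show ?thesis using zero by (simp add: c_def)
  next
    case False
    then show ?thesis using neumann_eigenvalue_pos[OF False] \<epsilon> by (simp add: a_def)
  qed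
  define y where "y K i = T * (real (J * 2 ^ K) - real i) / 2 ^ (N0 + K)" for K i
  define \<sigma> where "\<sigma> K i = T * real i / 2 ^ (N0 + K)" for K i
  have ty: "t - \<sigma> K i = y K i" for K i
    by (simp add: t y_def \<sigma>_def power_add field_simps)
  have y0: "0 \<le> y K i" if "i \<le> J * 2 ^ K" for K i
  proof -
    have "real i \<le> real (J * 2 ^ K)" using that by (simp only: of_nat_le_iff)
    then show ?thesis unfolding y_def using T by simp
  qed
  have t0: "0 \<le> t" using T by (simp add: t)
  show ?thesis
    unfolding a_def[symmetric] c_def[symmetric]
  proof (rule wiener_integral_coefficient_bound[where \<sigma>=\<sigma> and J="\<lambda>K. J * 2 ^ K"
      and f="\<lambda>s. exp (- a * (t - s)) * c" and g="\<lambda>K i. exp (- a * y K i) * c"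
      and \<delta>="\<lambda>K. (\<bar>c\<bar> * a * T / 2 ^ N0) * (1/2) ^ K"])
    show "prob_space M" "brownian_motion M B" "wiener_integral M B 0 t \<Phi> X" "0 \<le> t" by fact+
    show "cosine m \<in> L2" "L2_inner (cosine m :: real^'d \<Rightarrow> real) (cosine m) = 1"
      by (simp_all add: cosine_L2 cosine_orthonormal)
    show "\<Phi> s \<in> L2" if "s \<in> {0..t}" for s using \<Phi>[OF that] by (simp add: exp_bilaplacian_def)
    show "L2_inner (\<Phi> s) (cosine m) = exp (- a * (t - s)) * c" if "s \<in> {0..t}" for s
      using exp_bilaplacian_cosine[OF \<Phi>[OF that], of m] by (simp add: a_def c_def)
    show "(\<lambda>s. exp (- a * (t - s)) * c) \<in> borel_measurable borel" by measurable
    show "\<sigma> K 0 = 0" for K by (simp add: \<sigma>_def)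
    show "\<sigma> K (J * 2 ^ K) = t" for K by (simp add: \<sigma>_def t power_add)
    show "\<sigma> K i \<le> \<sigma> K (Suc i)" for K i
      unfolding \<sigma>_def using T by (intro divide_right_mono mult_left_mono) auto
    show "\<bar>exp (- a * (t - s)) * c - exp (- a * y K i) * c\<bar> \<le> (\<bar>c\<bar> * a * T / 2 ^ N0) * (1/2) ^ K"
      if i: "i < J * 2 ^ K" and s: "s \<in> {\<sigma> K i<..\<sigma> K (Suc i)}" for K i s
    proof -
      have st: "0 \<le> t - s"
        using s ty[of K "Suc i"] y0[of "Suc i" K] i by auto
      have d: "\<bar>(t - s) - y K i\<bar> \<le> T / 2 ^ (N0 + K)"
      proof -
        have "\<sigma> K (Suc i) - \<sigma> K i = T / 2 ^ (N0 + K)" by (simp add: \<sigma>_def field_simps)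
        then show ?thesis using s ty[of K i] by auto
      qed
      have "\<bar>exp (- (a * (t - s))) - exp (- (a * y K i))\<bar> \<le> \<bar>a * (t - s) - a * y K i\<bar>"
        using a0 st y0[of i K] i by (intro abs_exp_minus_diff_le) auto
      also have "\<dots> = a * \<bar>(t - s) - y K i\<bar>" using a0 by (simp add: right_diff_distrib[symmetric] abs_mult)
      also have "\<dots> \<le> a * (T / 2 ^ (N0 + K))" using a0 d by (intro mult_left_mono) auto
      finally have "\<bar>c\<bar> * \<bar>exp (- (a * (t - s))) - exp (- (a * y K i))\<bar> \<le> \<bar>c\<bar> * (a * (T / 2 ^ (N0 + K)))"
        by (intro mult_left_mono) auto
      moreover have "\<bar>exp (- a * (t - s)) * c - exp (- a * y K i) * c\<bar> =
          \<bar>c\<bar> * \<bar>exp (- (a * (t - s))) - exp (- (a * y K i))\<bar>"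
        by (simp add: left_diff_distrib[symmetric] abs_mult)
      ultimately show ?thesis by (simp add: power_add power_one_over mult_ac)
    qed
    show "(\<lambda>K. (\<bar>c\<bar> * a * T / 2 ^ N0) * (1/2) ^ K) \<longlonglongrightarrow> 0"
      by (intro tendsto_mult_right_zero LIMSEQ_realpow_zero) auto
    show "(\<lambda>\<omega>. \<bar>c\<bar> * (3 * (H \<omega> * T powr (- (7/16))) * a powr (- (7/16)))) \<in> borel_measurable M"
      using Hm by measurable
    fix K
    show "AE \<omega> in M. \<bar>\<Sum>i<J * 2 ^ K. exp (- a * y K i) * c * (B (\<sigma> K (Suc i)) \<omega> - B (\<sigma> K i) \<omega>)\<bar>
        \<le> \<bar>c\<bar> * (3 * (H \<omega> * T powr (- (7/16))) * a powr (- (7/16)))"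
    proof (cases "c = 0")
      case False
      then have ap: "a > 0" using a by simp
      show ?thesis
        using H
      proof eventually_elim
        case (elim \<omega>)
        have "\<bar>\<Sum>i<J * 2 ^ K. exp (- a * y K i) * (B (\<sigma> K (Suc i)) \<omega> - B (\<sigma> K i) \<omega>)\<bar> \<le>
            3 * (H \<omega> * T powr (- (7/16))) * a powr - (7/16)"
        proof (rule exponential_convolution_bound)
          show "0 \<le> H \<omega> * T powr (- (7/16))" using H0 by simp
          show "y K (Suc i) \<le> y K i" for i
            unfolding y_def using T by (intro divide_right_mono mult_left_mono) auto
          show "y K (J * 2 ^ K) = 0" by (simp add: y_def)
          fix i assume i: "i \<le> J * 2 ^ K"
          have "J * 2 ^ K \<le> 2 ^ (N0 + K)" using J by (simp add: power_add)
          then have "\<bar>B (\<sigma> K (J * 2 ^ K)) \<omega> - B (\<sigma> K i) \<omega>\<bar> \<le>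
              H \<omega> * (real (J * 2 ^ K - i) / 2 ^ (N0 + K)) powr (7 / 16)"
            unfolding \<sigma>_def using elim i by blast
          also have "real (J * 2 ^ K - i) / 2 ^ (N0 + K) = y K i / T"
            using i T by (simp add: y_def of_nat_diff)
          also have "(y K i / T) powr (7/16) = T powr (- (7/16)) * y K i powr (7/16)"
            using T y0[OF i] by (simp add: powr_divide powr_minus_divide)
          finally show "\<bar>B (\<sigma> K (J * 2 ^ K)) \<omega> - B (\<sigma> K i) \<omega>\<bar> \<le> H \<omega> * T powr (- (7/16)) * y K i powr (7/16)"
            by (simp add: mult.assoc)
        qed (use ap in auto)
        then have "\<bar>c\<bar> * \<bar>\<Sum>i<J * 2 ^ K. exp (- a * y K i) * (B (\<sigma> K (Suc i)) \<omega> - B (\<sigma> K i) \<omega>)\<bar> \<le>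
            \<bar>c\<bar> * (3 * (H \<omega> * T powr (- (7/16))) * a powr - (7/16))"
          by (intro mult_left_mono) auto
        moreover have "(\<Sum>i<J * 2 ^ K. exp (- a * y K i) * c * (B (\<sigma> K (Suc i)) \<omega> - B (\<sigma> K i) \<omega>)) =
            c * (\<Sum>i<J * 2 ^ K. exp (- a * y K i) * (B (\<sigma> K (Suc i)) \<omega> - B (\<sigma> K i) \<omega>))"
          by (simp add: sum_distrib_left mult_ac)
        ultimately show ?case by (simp add: abs_mult)
      qed
    qed simp
  qed
qed

text \<open>Summing the coefficient bounds by Cauchy--Schwarz pairs Bessel's inequality for \<open>g\<close> with the
  convergent sum of eigenvalue powers.  The right-hand side does not depend on \<open>t\<close>, which is what makes
  the supremum over all times accessible.\<close>

lemma convolution_sup_bound: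
  fixes X :: "'w \<Rightarrow> real^'d::finite \<Rightarrow> real"
  assumes M: "prob_space M" and B: "brownian_motion M B" and T: "T > 0" and J: "J \<le> 2 ^ N0"
    and t: "t = T * real J / 2 ^ N0"
    and X: "wiener_integral M B 0 t \<Phi> X"
    and \<Phi>: "\<And>s. s \<in> {0..t} \<Longrightarrow> exp_bilaplacian \<epsilon> (t - s) g (\<Phi> s)"
    and zero: "L2_inner g (\<lambda>_. 1) = 0" and \<epsilon>: "\<epsilon> > 0"
    and Hm: "H \<in> borel_measurable M" and H0: "\<And>\<omega>. 0 \<le> H \<omega>"
    and H: "AE \<omega> in M. \<forall>N i j. i \<le> j \<and> j \<le> 2 ^ N \<longrightarrow>
          \<bar>B (T * real j / 2 ^ N) \<omega> - B (T * real i / 2 ^ N) \<omega>\<bar> \<le> H \<omega> * (real (j - i) / 2 ^ N) powr (7 / 16)"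
    and S: "S \<ge> 0" "\<And>A :: ('d \<Rightarrow> nat) set. finite A \<Longrightarrow> (\<lambda>_. 0) \<notin> A \<Longrightarrow>
      (\<Sum>m\<in>A. neumann_eigenvalue m powr (- (7/4))) \<le> S"
    and G: "L2_inner g g \<le> G"
  shows "AE \<omega> in M. AE x in cubeM. \<bar>X \<omega> x\<bar> \<le>
    sqrt 2 ^ CARD('d) * 3 * T powr (- (7/16)) * sqrt S * \<epsilon> powr (- (7/16)) * sqrt G * H \<omega>"
proof -
  have gL: "g \<in> L2" using \<Phi>[of 0] T by (auto simp: exp_bilaplacian_def t)
  have G0: "G \<ge> 0" using G L2_inner_self_nonneg[of g] by linarith
  have "AE \<omega> in M. \<forall>m. \<bar>L2_inner (X \<omega>) (cosine m)\<bar> \<le>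
    \<bar>L2_inner g (cosine m)\<bar> * (3 * (H \<omega> * T powr (- (7/16))) * (\<epsilon> * (neumann_eigenvalue m)\<^sup>2) powr (- (7/16)))"
    unfolding AE_all_countable
    using convolution_coefficient_bound[OF M B T J t X \<Phi> zero \<epsilon> Hm H0 H] by blast
  moreover have "AE \<omega> in M. X \<omega> \<in> L2" by (rule wiener_integral_AE_L2[OF M B X])
  ultimately show ?thesis
  proof eventually_elim
    case (elim \<omega>)
    define R where "R = 3 * (H \<omega> * T powr (- (7/16))) * \<epsilon> powr (- (7/16))"
    have R: "R \<ge> 0" using H0 by (simp add: R_def)
    have "AE x in cubeM. \<bar>X \<omega> x\<bar> \<le> sqrt 2 ^ CARD('d) * (R * (sqrt G * sqrt S))"
    proof (rule AE_abs_le_sum_cosine_coefficients[OF elim(2)])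
      fix A :: "('d \<Rightarrow> nat) set" assume A: "finite A"
      define A' where "A' = A - {\<lambda>_. 0}"
      have A': "finite A'" "(\<lambda>_. 0) \<notin> A'" using A by (auto simp: A'_def)
      have g0: "L2_inner g (cosine (\<lambda>_. 0)) = 0"
      proof -
        have "cosine (\<lambda>_. 0) = (\<lambda>_::real^'d. 1)" by (simp add: fun_eq_iff cosine_zero)
        then show ?thesis using zero by simp
      qed
      have X0: "L2_inner (X \<omega>) (cosine (\<lambda>_. 0)) = 0"
        using elim(1)[rule_format, of "\<lambda>_. 0"] by (simp add: g0)
      have "(\<Sum>m\<in>A. \<bar>L2_inner (X \<omega>) (cosine m)\<bar>) = (\<Sum>m\<in>A'. \<bar>L2_inner (X \<omega>) (cosine m)\<bar>)"
        unfolding A'_def by (rule sum.mono_neutral_right) (use A X0 in auto)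
      also have "\<dots> \<le> (\<Sum>m\<in>A'. R * (\<bar>L2_inner g (cosine m)\<bar> * neumann_eigenvalue m powr (- (7/8))))"
      proof (rule sum_mono)
        fix m assume "m \<in> A'"
        then have "m \<noteq> (\<lambda>_. 0)" using A' by auto
        then have l: "neumann_eigenvalue m > 0" by (rule neumann_eigenvalue_pos)
        have "(\<epsilon> * (neumann_eigenvalue m)\<^sup>2) powr (- (7/16)) =
            \<epsilon> powr (- (7/16)) * neumann_eigenvalue m powr (- (7/8))"
        proof -
          have "(neumann_eigenvalue m)\<^sup>2 = neumann_eigenvalue m powr 2" using l by (simp add: powr_numeral)
          then have "((neumann_eigenvalue m)\<^sup>2) powr (- (7/16)) = neumann_eigenvalue m powr (- (7/8))"
            by (simp only: powr_powr) simp
          then show ?thesis using \<epsilon> l by (simp add: powr_mult)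
        qed
        then show "\<bar>L2_inner (X \<omega>) (cosine m)\<bar> \<le> R * (\<bar>L2_inner g (cosine m)\<bar> * neumann_eigenvalue m powr (- (7/8)))"
          using elim(1)[rule_format, of m] by (simp add: R_def mult_ac)
      qed
      also have "\<dots> = R * (\<Sum>m\<in>A'. \<bar>L2_inner g (cosine m)\<bar> * neumann_eigenvalue m powr (- (7/8)))"
        by (simp add: sum_distrib_left)
      also have "\<dots> \<le> R * (sqrt G * sqrt S)"
      proof (rule mult_left_mono[OF _ R])
        have "(\<Sum>m\<in>A'. \<bar>L2_inner g (cosine m)\<bar> * neumann_eigenvalue m powr (- (7/8)))\<^sup>2 \<le>
            (\<Sum>m\<in>A'. \<bar>L2_inner g (cosine m)\<bar>\<^sup>2) * (\<Sum>m\<in>A'. (neumann_eigenvalue m powr (- (7/8)))\<^sup>2)"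
          by (rule Cauchy_Schwarz_ineq_sum)
        also have "\<dots> \<le> G * S"
        proof (rule mult_mono)
          have "(\<Sum>m\<in>A'. (L2_inner g (cosine m))\<^sup>2) \<le> L2_inner g g"
            using A'(1) by (intro L2_Bessel) (auto simp: cosine_L2 cosine_orthonormal gL)
          then show "(\<Sum>m\<in>A'. \<bar>L2_inner g (cosine m)\<bar>\<^sup>2) \<le> G" using G by simp
          have "(neumann_eigenvalue m powr (- (7/8)))\<^sup>2 = neumann_eigenvalue m powr (- (7/4))" for m :: "'d \<Rightarrow> nat"
            unfolding power2_eq_square powr_add[symmetric] by simp
          then show "(\<Sum>m\<in>A'. (neumann_eigenvalue m powr (- (7/8)))\<^sup>2) \<le> S"
            using S(2)[OF A'] by simp
        qed (use G0 in \<open>auto intro!: sum_nonneg\<close>)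
        finally have "\<bar>\<Sum>m\<in>A'. \<bar>L2_inner g (cosine m)\<bar> * neumann_eigenvalue m powr (- (7/8))\<bar> \<le> sqrt (G * S)"
          by (rule real_le_rsqrt[of "\<bar>_\<bar>", simplified])
        then show "(\<Sum>m\<in>A'. \<bar>L2_inner g (cosine m)\<bar> * neumann_eigenvalue m powr (- (7/8))) \<le> sqrt G * sqrt S"
          by (simp add: real_sqrt_mult)
      qed
      finally show "(\<Sum>m\<in>A. \<bar>L2_inner (X \<omega>) (cosine m)\<bar>) \<le> R * (sqrt G * sqrt S)" .
    qed
    then show ?case by (rule back_subst[where P="\<lambda>c. AE x in cubeM. \<bar>X \<omega> x\<bar> \<le> c"]) (simp add: R_def mult_ac)
  qed
qed

text \<open>Along a path that is continuous in \<open>L\<^sup>2\<close>, a uniform bound at the dyadic times extends to all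
  times, because a set of functions bounded by a constant is closed in \<open>L\<^sup>2\<close>.\<close>

lemma L2_continuous_AE_bound:
  fixes y :: "real \<Rightarrow> real^'d::finite \<Rightarrow> real"
  assumes y: "L2_continuous_on {0..T} y" and T: "T > 0"
    and bound: "\<And>N j. j \<le> 2 ^ N \<Longrightarrow> AE x in cubeM. \<bar>y (T * real j / 2 ^ N) x\<bar> \<le> b"
    and t: "t \<in> {0..T}"
  shows "AE x in cubeM. \<bar>y t x\<bar> \<le> b"
proof (rule ccontr)
  assume contra: "\<not> (AE x in cubeM. \<bar>y t x\<bar> \<le> b)"
  have ty: "y t \<in> L2" and lim: "((\<lambda>s. Lp_pow 2 (\<lambda>x. y s x - y t x)) \<longlongrightarrow> 0) (at t within {0..T})"
    using y t by (auto simp: L2_continuous_on_def)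
  define V where "V = (\<integral>\<^sup>+x. ennreal ((max 0 (\<bar>y t x\<bar> - b))\<^sup>2) \<partial>cubeM)"
  have "V \<noteq> 0"
  proof
    assume "V = 0"
    then have "AE x in cubeM. ennreal ((max 0 (\<bar>y t x\<bar> - b))\<^sup>2) = 0"
      unfolding V_def using L2_measurable[OF ty] by (subst (asm) nn_integral_0_iff_AE) auto
    then have "AE x in cubeM. \<bar>y t x\<bar> \<le> b"
      by eventually_elim (auto simp: max_def split: if_splits)
    with contra show False by simp
  qed
  then have "0 < V" by (simp add: zero_less_iff_neq_zero)
  from order_tendstoD(2)[OF lim this]
  obtain d where d: "d > 0" "\<And>s. s \<in> {0..T} \<Longrightarrow> s \<noteq> t \<Longrightarrow> dist s t < d \<Longrightarrow> Lp_pow 2 (\<lambda>x. y s x - y t x) < V"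
    unfolding eventually_at by blast
  obtain n where n: "T / d < 2 ^ n" using real_arch_pow[of 2 "T / d"] by auto
  define j where "j = nat \<lfloor>2 ^ n * t / T\<rfloor>"
  have j1: "real j \<le> 2 ^ n * t / T" "2 ^ n * t / T < real j + 1"
    using t T by (auto simp: j_def)
  have "2 ^ n * t / T \<le> 2 ^ n" using t T by (simp add: divide_le_eq)
  then have jn: "j \<le> 2 ^ n"
    using j1(1) by (metis of_nat_le_iff of_nat_numeral of_nat_power order_trans)
  define s where "s = T * real j / 2 ^ n"
  have s1: "s \<le> t" using j1(1) T by (simp add: s_def field_simps)
  have s2: "t - s < d"
  proof -
    have "t * 2 ^ n < T * (real j + 1)" using j1(2) T by (simp add: field_simps)
    then have "t < s + T / 2 ^ n" by (simp add: s_def field_simps)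
    moreover have "T / 2 ^ n < d" using n d(1) by (simp add: field_simps)
    ultimately show ?thesis by simp
  qed
  have sT: "s \<in> {0..T}" using s1 t T by (auto simp: s_def)
  have bs: "AE x in cubeM. \<bar>y s x\<bar> \<le> b" unfolding s_def by (rule bound[OF jn])
  have "s \<noteq> t" using bs contra by auto
  then have less: "Lp_pow 2 (\<lambda>x. y s x - y t x) < V" using d(2)[OF sT] s1 s2 by (simp add: dist_real_def)
  have "V \<le> Lp_pow 2 (\<lambda>x. y s x - y t x)"
    unfolding V_def Lp_pow_2
  proof (rule nn_integral_mono_AE)
    show "AE x in cubeM. ennreal ((max 0 (\<bar>y t x\<bar> - b))\<^sup>2) \<le> ennreal ((y s x - y t x)\<^sup>2)"
      using bs
    proof eventually_elim
      case (elim x)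
      have "max 0 (\<bar>y t x\<bar> - b) \<le> \<bar>y s x - y t x\<bar>" using elim by linarith
      then have "(max 0 (\<bar>y t x\<bar> - b))\<^sup>2 \<le> \<bar>y s x - y t x\<bar>\<^sup>2" by (intro power_mono) auto
      then show ?case by (simp add: ennreal_leI)
    qed
  qed
  with less show False by simp
qed

lemma Lp_pow_le_if_AE_bounded:
  fixes v :: "real^'d::finite \<Rightarrow> real"
  assumes "AE x in cubeM. \<bar>v x\<bar> \<le> b" "b \<ge> 0" "p \<ge> 0"
  shows "Lp_pow p v \<le> ennreal (b powr p)"
proof -
  interpret prob_space "cubeM :: (real^'d) measure" by (rule prob_space_cubeM)
  have "Lp_pow p v \<le> (\<integral>\<^sup>+x. ennreal (b powr p) \<partial>(cubeM :: (real^'d) measure))"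
    unfolding Lp_pow_def
    by (rule nn_integral_mono_AE) (use assms in \<open>auto elim!: eventually_mono intro!: ennreal_leI powr_mono2\<close>)
  also have "\<dots> = ennreal (b powr p)" using emeasure_space_1 by simp
  finally show ?thesis .
qed

lemma powr_sum_le:
  fixes H :: "'i \<Rightarrow> real"
  assumes A: "finite A" and H: "\<And>i. i \<in> A \<Longrightarrow> 0 \<le> H i" and p: "p \<ge> 1"
  shows "(\<Sum>i\<in>A. H i) powr p \<le> real (card A) powr (p - 1) * (\<Sum>i\<in>A. H i powr p)"
proof -
  \<comment> \<open>Vanishing summands are dropped so that convexity is only needed on the positive reals.\<close>
  define P where "P = {i \<in> A. 0 < H i}"
  have P: "finite P" "P \<subseteq> A" using A by (auto simp: P_def)
  have eq: "(\<Sum>i\<in>A. H i) = (\<Sum>i\<in>P. H i)"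
    by (rule sum.mono_neutral_right) (use A H in \<open>force simp: P_def\<close>)+
  show ?thesis
  proof (cases "P = {}")
    case True
    then show ?thesis using eq by (simp add: sum_nonneg)
  next
    case False
    define n where "n = real (card P)"
    have n: "n > 0" using False P by (simp add: n_def card_gt_0_iff)
    have "(\<Sum>i\<in>P. (1 / n) *\<^sub>R H i) powr p \<le> (\<Sum>i\<in>P. (1 / n) * H i powr p)"
      by (rule convex_on_sum[OF P(1) False powr_convex[OF p]]) (use n in \<open>auto simp: n_def P_def\<close>)
    then have "((1 / n) * (\<Sum>i\<in>P. H i)) powr p \<le> (1 / n) * (\<Sum>i\<in>P. H i powr p)"
      by (simp add: sum_distrib_left)
    moreover have "((1 / n) * (\<Sum>i\<in>P. H i)) powr p = n powr (- p) * (\<Sum>i\<in>P. H i) powr p"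
      using n by (simp add: powr_mult powr_divide powr_minus_divide P_def sum_nonneg)
    ultimately have "n powr p * (n powr (- p) * (\<Sum>i\<in>P. H i) powr p) \<le> n powr p * ((1 / n) * (\<Sum>i\<in>P. H i powr p))"
      by (intro mult_left_mono) auto
    moreover have "n powr p * (n powr (- p) * (\<Sum>i\<in>P. H i) powr p) = (\<Sum>i\<in>P. H i) powr p"
      using n by (simp add: mult.assoc[symmetric] powr_add[symmetric])
    moreover have "n powr p * ((1 / n) * (\<Sum>i\<in>P. H i powr p)) = n powr (p - 1) * (\<Sum>i\<in>P. H i powr p)"
      using n by (simp add: powr_diff)
    ultimately have "(\<Sum>i\<in>A. H i) powr p \<le> n powr (p - 1) * (\<Sum>i\<in>P. H i powr p)" using eq by simp
    also have "\<dots> \<le> real (card A) powr (p - 1) * (\<Sum>i\<in>A. H i powr p)"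
    proof (rule mult_mono)
      show "n powr (p - 1) \<le> real (card A) powr (p - 1)"
        using p n card_mono[OF A P(2)] by (intro powr_mono2) (auto simp: n_def)
      show "(\<Sum>i\<in>P. H i powr p) \<le> (\<Sum>i\<in>A. H i powr p)"
        using A P by (intro sum_mono2) auto
    qed (auto intro!: sum_nonneg)
    finally show ?thesis .
  qed
qed

section \<open>The moment bound\<close>

theorem lemmaA3:
  fixes T p \<kappa> :: real
  assumes "CARD('d::finite) \<in> {1, 2, 3}"
    and "T > 0"
    and "p \<ge> 2"
  shows "\<exists>C>0. \<forall>(\<T> :: (real^'d) set set) \<phi> \<epsilon> (M :: 'w measure) \<beta> u.
    quasi_uniform_mesh \<kappa> \<T> \<and> nodal_basis \<T> \<phi> \<and> 0 < \<epsilon> \<and> \<epsilon> < 1 \<and>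
    prob_space M \<and> independent_brownian_motions M (nodes \<T>) \<beta> \<and>
    linear_spde_solution M T \<epsilon> \<T> \<phi> \<beta> u \<longrightarrow>
      (\<integral>\<^sup>+\<omega>. (SUP t\<in>{0..T}. Lp_pow p (u t \<omega>)) \<partial>M)
        \<le> ennreal (C * mesh_size \<T> powr (- (3 * p * real CARD('d) / 2)) * \<epsilon> powr (- p / 2))"
proof -
  let ?D = "CARD('d)"
  have p0: "p > 0" using assms(3) by simp
  obtain CH where CH: "CH > 0" and hoelder: "\<And>(M :: 'w measure) B. prob_space M \<Longrightarrow> brownian_motion M B \<Longrightarrow>
      \<exists>H \<in> borel_measurable M. (\<forall>\<omega>. 0 \<le> H \<omega>) \<and> (\<integral>\<^sup>+\<omega>. ennreal (H \<omega> powr p) \<partial>M) \<le> ennreal CH \<and>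
        (AE \<omega> in M. \<forall>N i j. i \<le> j \<and> j \<le> 2 ^ N \<longrightarrow>
          \<bar>B (T * real j / 2 ^ N) \<omega> - B (T * real i / 2 ^ N) \<omega>\<bar> \<le> H \<omega> * (real (j - i) / 2 ^ N) powr (7 / 16))"
    by (rule brownian_dyadic_hoelder[OF assms(2) p0, where 'w='w], rule that, assumption, assumption)
  obtain S where S: "S \<ge> 0" "\<And>A :: ('d \<Rightarrow> nat) set. finite A \<Longrightarrow> (\<lambda>_. 0) \<notin> A \<Longrightarrow>
      (\<Sum>m\<in>A. neumann_eigenvalue m powr (- (7/4))) \<le> S"
    using neumann_eigenvalues_summable[where 'd='d] assms(1) by auto
  define ub where "ub = unit_ball_vol (real ?D)"
  have ub: "ub > 0" by (simp add: ub_def)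
  \<comment> \<open>\<open>c1\<close> comes from counting the nodes, \<open>c2\<close> from the norm of the noise coefficients; both are divided by
    \<open>h\<^sup>d\<close> in the end.  The summand \<open>1\<close> keeps \<open>C\<close> positive even if another factor vanishes.\<close>
  define c1 where "c1 = (real ?D + 1) * (4 * \<kappa>\<^sup>2) ^ ?D / ub"
  define c2 where "c2 = (real ?D + 1) * (8 * \<kappa>\<^sup>2) ^ ?D * 2 / ub"
  define c3 where "c3 = sqrt 2 ^ ?D * 3 * T powr (- (7/16)) * sqrt S * sqrt c2"
  define C where "C = (c3 * c1) powr p * CH + 1"
  have C: "C > 0" unfolding C_def using CH by (simp add: add_nonneg_pos)
  have main: "(\<integral>\<^sup>+\<omega>. (SUP t\<in>{0..T}. Lp_pow p (u t \<omega>)) \<partial>M)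
      \<le> ennreal (C * mesh_size \<T> powr (- (3 * p * real ?D / 2)) * \<epsilon> powr (- p / 2))"
    if qu: "quasi_uniform_mesh \<kappa> \<T>" and nb: "nodal_basis \<T> \<phi>" and \<epsilon>: "0 < \<epsilon>" "\<epsilon> < 1"
      and M: "prob_space M" and \<beta>: "independent_brownian_motions M (nodes \<T>) \<beta>"
      and sol: "linear_spde_solution M T \<epsilon> \<T> \<phi> \<beta> u"
    for \<T> :: "(real^'d) set set" and \<phi> \<epsilon> and M :: "'w measure" and \<beta> u
  proof -
    interpret mesh \<kappa> \<T> by (rule mesh.intro[OF qu])
    interpret prob_space M by (rule M)
    define h where "h = mesh_size \<T>"
    have h: "h > 0" unfolding h_def by (rule mesh_size_pos)
    define L where "L = real (card (nodes \<T>))"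
    have L0: "L \<ge> 0" by (simp add: L_def)
    have L: "L \<le> c1 / h ^ ?D"
    proof -
      have "real (card \<T>) * (ub * (h / (4 * \<kappa>\<^sup>2)) ^ ?D) \<le> 1"
        using card_mesh_le by (simp add: ub_def h_def)
      moreover have pos: "ub * (h / (4 * \<kappa>\<^sup>2)) ^ ?D > 0" using ub h kappa_pos by simp
      ultimately have "real (card \<T>) \<le> 1 / (ub * (h / (4 * \<kappa>\<^sup>2)) ^ ?D)" by (simp add: le_divide_eq)
      then have "real (card \<T>) * (real ?D + 1) \<le> 1 / (ub * (h / (4 * \<kappa>\<^sup>2)) ^ ?D) * (real ?D + 1)"
        by (intro mult_right_mono) auto
      moreover have "L \<le> real (card \<T>) * (real ?D + 1)"
      proof -
        have "real (card (nodes \<T>)) \<le> real (card \<T> * (?D + 1))" using card_nodes_le by (simp only: of_nat_le_iff)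
        then show ?thesis by (simp add: L_def algebra_simps)
      qed
      moreover have "1 / (ub * (h / (4 * \<kappa>\<^sup>2)) ^ ?D) * (real ?D + 1) = c1 / h ^ ?D"
        by (simp add: c1_def power_divide)
      ultimately show ?thesis by simp
    qed
    have c1: "c1 \<ge> 0" using ub by (simp add: c1_def)
    have c2: "c2 \<ge> 0" using ub by (simp add: c2_def)
    define G where "G = c2 / h ^ ?D"
    have G: "L2_inner (noise_coeff \<phi> z) (noise_coeff \<phi> z) \<le> G" if "z \<in> nodes \<T>" for z
      using noise_coeff_L2_norm_le[OF nb that]
      by (simp add: G_def c2_def ub_def h_def power_divide mult_ac)
    have BM: "brownian_motion M (\<beta> z)" if "z \<in> nodes \<T>" for z
      using \<beta> that by (simp add: independent_brownian_motions_def)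
    define good where "good z H \<longleftrightarrow> H \<in> borel_measurable M \<and> (\<forall>\<omega>. 0 \<le> H \<omega>) \<and>
        (\<integral>\<^sup>+\<omega>. ennreal (H \<omega> powr p) \<partial>M) \<le> ennreal CH \<and>
        (AE \<omega> in M. \<forall>N i j. i \<le> j \<and> j \<le> 2 ^ N \<longrightarrow>
          \<bar>\<beta> z (T * real j / 2 ^ N) \<omega> - \<beta> z (T * real i / 2 ^ N) \<omega>\<bar> \<le> H \<omega> * (real (j - i) / 2 ^ N) powr (7 / 16))"
      for z H
    have "\<forall>z\<in>nodes \<T>. \<exists>H. good z H"
      using hoelder[OF M BM] unfolding good_def by blast
    from bchoice[OF this] obtain H where good: "\<And>z. z \<in> nodes \<T> \<Longrightarrow> good z (H z)" by blast
    have H: "H z \<in> borel_measurable M" "0 \<le> H z \<omega>" "(\<integral>\<^sup>+\<omega>. ennreal (H z \<omega> powr p) \<partial>M) \<le> ennreal CH"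
      "AE \<omega> in M. \<forall>N i j. i \<le> j \<and> j \<le> 2 ^ N \<longrightarrow>
          \<bar>\<beta> z (T * real j / 2 ^ N) \<omega> - \<beta> z (T * real i / 2 ^ N) \<omega>\<bar> \<le> H z \<omega> * (real (j - i) / 2 ^ N) powr (7 / 16)"
      if "z \<in> nodes \<T>" for z \<omega>
      using good[OF that] by (simp_all add: good_def)
    define K where "K = sqrt 2 ^ ?D * 3 * T powr (- (7/16)) * sqrt S * \<epsilon> powr (- (7/16)) * sqrt G"
    have G0: "G \<ge> 0" using c2 h by (simp add: G_def)
    have K0: "K \<ge> 0" unfolding K_def using S G0 by simp
    define b where "b \<omega> = K * (\<Sum>z\<in>nodes \<T>. H z \<omega>)" for \<omega>
    have b0: "b \<omega> \<ge> 0" for \<omega> unfolding b_def using K0 H(2) by (intro mult_nonneg_nonneg sum_nonneg) auto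
    \<comment> \<open>The random variable \<open>b\<close> bounds the solution at each dyadic time, hence at all times.\<close>
    have dyadic: "AE \<omega> in M. AE x in cubeM. \<bar>u (T * real j / 2 ^ N) \<omega> x\<bar> \<le> b \<omega>" if j: "j \<le> 2 ^ N" for N j
    proof -
      define t where "t = T * real j / 2 ^ N"
      have "real j \<le> 2 ^ N" using j by (metis of_nat_le_iff of_nat_numeral of_nat_power)
      then have tT: "t \<in> {0..T}" using assms(2) by (auto simp: t_def divide_le_eq)
      have "\<forall>t\<in>{0..T}. \<exists>\<Phi> I. (\<forall>z\<in>nodes \<T>.
          (\<forall>s\<in>{0..t}. exp_bilaplacian \<epsilon> (t - s) (noise_coeff \<phi> z) (\<Phi> z s)) \<and>
          wiener_integral M (\<beta> z) 0 t (\<Phi> z) (I z)) \<and>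
        (AE \<omega> in M. AE x in cubeM. u t \<omega> x = (\<Sum>z\<in>nodes \<T>. I z \<omega> x))"
        using sol unfolding linear_spde_solution_def by (elim conjE)
      from bspec[OF this tT] have "\<exists>\<Phi> I. (\<forall>z\<in>nodes \<T>.
          (\<forall>s\<in>{0..t}. exp_bilaplacian \<epsilon> (t - s) (noise_coeff \<phi> z) (\<Phi> z s)) \<and>
          wiener_integral M (\<beta> z) 0 t (\<Phi> z) (I z)) \<and>
        (AE \<omega> in M. AE x in cubeM. u t \<omega> x = (\<Sum>z\<in>nodes \<T>. I z \<omega> x))"
        .
      then obtain \<Phi> I where \<Phi>I: "\<forall>z\<in>nodes \<T>.
          (\<forall>s\<in>{0..t}. exp_bilaplacian \<epsilon> (t - s) (noise_coeff \<phi> z) (\<Phi> z s)) \<and>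
          wiener_integral M (\<beta> z) 0 t (\<Phi> z) (I z)"
        and u: "AE \<omega> in M. AE x in cubeM. u t \<omega> x = (\<Sum>z\<in>nodes \<T>. I z \<omega> x)"
        by (elim exE conjE)
      have \<Phi>: "exp_bilaplacian \<epsilon> (t - s) (noise_coeff \<phi> z) (\<Phi> z s)" if "z \<in> nodes \<T>" "s \<in> {0..t}" for z s
        using bspec[OF \<Phi>I that(1)] that(2) by simp
      have I: "wiener_integral M (\<beta> z) 0 t (\<Phi> z) (I z)" if "z \<in> nodes \<T>" for z
        using bspec[OF \<Phi>I that] by simp
      have "AE \<omega> in M. \<forall>z\<in>nodes \<T>. AE x in cubeM. \<bar>I z \<omega> x\<bar> \<le> K * H z \<omega>"
      proof (rule AE_finite_allI[OF finite_nodes])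
        fix z assume z: "z \<in> nodes \<T>"
        show "AE \<omega> in M. AE x in cubeM. \<bar>I z \<omega> x\<bar> \<le> K * H z \<omega>"
          unfolding K_def
          by (rule convolution_sup_bound[OF M BM[OF z] assms(2) j t_def I[OF z] \<Phi>[OF z] noise_coeff_mean_zero[OF nb z]
              \<epsilon>(1) H(1)[OF z] H(2)[OF z] H(4)[OF z] S G[OF z]])
      qed
      with u have "AE \<omega> in M. AE x in cubeM. \<bar>u t \<omega> x\<bar> \<le> b \<omega>"
      proof eventually_elim
        case (elim \<omega>)
        have "AE x in cubeM. \<forall>z\<in>nodes \<T>. \<bar>I z \<omega> x\<bar> \<le> K * H z \<omega>"
          by (rule AE_finite_allI[OF finite_nodes]) (use elim(2) in blast)
        with elim(1) show ?case
        proof eventually_elim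
          case (elim x)
          have "\<bar>u t \<omega> x\<bar> \<le> (\<Sum>z\<in>nodes \<T>. \<bar>I z \<omega> x\<bar>)" unfolding elim(1) by (rule sum_abs)
          also have "\<dots> \<le> (\<Sum>z\<in>nodes \<T>. K * H z \<omega>)" using elim(2) by (intro sum_mono) auto
          finally show ?case by (simp add: b_def sum_distrib_left)
        qed
      qed
      then show ?thesis by (simp add: t_def)
    qed
    have "AE \<omega> in M. \<forall>N j. j \<le> 2 ^ N \<longrightarrow> (AE x in cubeM. \<bar>u (T * real j / 2 ^ N) \<omega> x\<bar> \<le> b \<omega>)"
      unfolding AE_all_countable by (intro allI AE_impI dyadic)
    moreover have "AE \<omega> in M. L2_continuous_on {0..T} (\<lambda>t. u t \<omega>)"
      using sol by (simp add: linear_spde_solution_def)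
    ultimately have sup: "AE \<omega> in M. (SUP t\<in>{0..T}. Lp_pow p (u t \<omega>)) \<le> ennreal (b \<omega> powr p)"
    proof eventually_elim
      case (elim \<omega>)
      show ?case
      proof (rule SUP_least)
        fix t assume t: "t \<in> {0..T}"
        have "AE x in cubeM. \<bar>u t \<omega> x\<bar> \<le> b \<omega>"
          by (rule L2_continuous_AE_bound[OF elim(2) assms(2) _ t]) (use elim(1) in blast)
        then show "Lp_pow p (u t \<omega>) \<le> ennreal (b \<omega> powr p)"
          by (rule Lp_pow_le_if_AE_bounded) (use b0 assms(3) in auto)
      qed
    qed
    have bp: "b \<omega> powr p \<le> (\<Sum>z\<in>nodes \<T>. K powr p * L powr (p - 1) * H z \<omega> powr p)" for \<omega>
    proof -
      have "b \<omega> powr p = K powr p * (\<Sum>z\<in>nodes \<T>. H z \<omega>) powr p"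
        unfolding b_def by (rule powr_mult)
      also have "\<dots> \<le> K powr p * (L powr (p - 1) * (\<Sum>z\<in>nodes \<T>. H z \<omega> powr p))"
        unfolding L_def using H(2) assms(3) by (intro mult_left_mono powr_sum_le finite_nodes) auto
      finally show ?thesis by (simp add: sum_distrib_left mult.assoc)
    qed
    have "(\<integral>\<^sup>+\<omega>. (SUP t\<in>{0..T}. Lp_pow p (u t \<omega>)) \<partial>M) \<le> (\<integral>\<^sup>+\<omega>. ennreal (b \<omega> powr p) \<partial>M)"
      by (rule nn_integral_mono_AE[OF sup])
    also have "\<dots> \<le> (\<integral>\<^sup>+\<omega>. (\<Sum>z\<in>nodes \<T>. ennreal (K powr p * L powr (p - 1)) * ennreal (H z \<omega> powr p)) \<partial>M)"
    proof (rule nn_integral_mono)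
      fix \<omega>
      have "ennreal (b \<omega> powr p) \<le> ennreal (\<Sum>z\<in>nodes \<T>. K powr p * L powr (p - 1) * H z \<omega> powr p)"
        by (rule ennreal_leI[OF bp])
      also have "\<dots> = (\<Sum>z\<in>nodes \<T>. ennreal (K powr p * L powr (p - 1)) * ennreal (H z \<omega> powr p))"
        by (subst sum_ennreal[symmetric]) (auto simp: ennreal_mult)
      finally show "ennreal (b \<omega> powr p) \<le> (\<Sum>z\<in>nodes \<T>. ennreal (K powr p * L powr (p - 1)) * ennreal (H z \<omega> powr p))" .
    qed
    also have "\<dots> = (\<Sum>z\<in>nodes \<T>. ennreal (K powr p * L powr (p - 1)) * (\<integral>\<^sup>+\<omega>. ennreal (H z \<omega> powr p) \<partial>M))"
    proof -
      have m: "(\<lambda>\<omega>. ennreal (H z \<omega> powr p)) \<in> borel_measurable M" if "z \<in> nodes \<T>" for z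
        using H(1)[OF that] by measurable
      have "(\<integral>\<^sup>+\<omega>. (\<Sum>z\<in>nodes \<T>. ennreal (K powr p * L powr (p - 1)) * ennreal (H z \<omega> powr p)) \<partial>M) =
          (\<Sum>z\<in>nodes \<T>. \<integral>\<^sup>+\<omega>. ennreal (K powr p * L powr (p - 1)) * ennreal (H z \<omega> powr p) \<partial>M)"
        by (rule nn_integral_sum) (rule borel_measurable_times_ennreal[OF borel_measurable_const m])
      also have "\<dots> = (\<Sum>z\<in>nodes \<T>. ennreal (K powr p * L powr (p - 1)) * (\<integral>\<^sup>+\<omega>. ennreal (H z \<omega> powr p) \<partial>M))"
        by (rule sum.cong[OF refl nn_integral_cmult[OF m]])
      finally show ?thesis .
    qed
    also have "\<dots> \<le> (\<Sum>z\<in>nodes \<T>. ennreal (K powr p * L powr (p - 1)) * ennreal CH)"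
      using H(3) by (intro sum_mono mult_left_mono) auto
    also have "\<dots> = ennreal (L * (K powr p * L powr (p - 1) * CH))"
      using CH by (simp add: L_def ennreal_mult ennreal_of_nat_eq_real_of_nat)
    also have "\<dots> \<le> ennreal (C * mesh_size \<T> powr (- (3 * p * real ?D / 2)) * \<epsilon> powr (- p / 2))"
    proof (rule ennreal_leI)
      have "L * (K powr p * L powr (p - 1) * CH) = (K * L) powr p * CH"
      proof (cases "L = 0")
        case False
        then have "L powr p = L * L powr (p - 1)" using L0 by (simp add: powr_diff)
        then show ?thesis using K0 L0 by (simp add: powr_mult)
      qed (use assms(3) in simp)
      also have "\<dots> \<le> ((c3 * c1) * (h powr (- (3 * real ?D / 2)) * \<epsilon> powr (- (1/2)))) powr p * CH"
      proof (rule mult_right_mono)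
        \<comment> \<open>The noise norm contributes \<open>h\<^sup>-\<^sup>d\<^sup>/\<^sup>2\<close> and the number of nodes \<open>h\<^sup>-\<^sup>d\<close>.\<close>
        have "K * L \<le> c3 * c1 * (h powr (- (3 * real ?D / 2)) * \<epsilon> powr (- (1/2)))"
        proof -
          have hD: "h ^ ?D = h powr real ?D" using h by (simp add: powr_realpow)
          have "sqrt G = sqrt c2 * h powr (- (real ?D / 2))"
            using h c2 by (simp add: G_def hD real_sqrt_divide powr_half_sqrt[symmetric] powr_powr powr_minus_divide)
          then have K: "K = c3 * h powr (- (real ?D / 2)) * \<epsilon> powr (- (7/16))"
            by (simp add: K_def c3_def mult_ac)
          have c3: "c3 \<ge> 0" unfolding c3_def using S c2 by simp
          have "K * L \<le> K * (c1 / h ^ ?D)" by (rule mult_left_mono[OF L K0])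
          also have "\<dots> = c3 * c1 * (h powr (- (real ?D / 2)) * h powr (- real ?D)) * \<epsilon> powr (- (7/16))"
            unfolding K hD by (simp add: powr_minus_divide)
          also have "h powr (- (real ?D / 2)) * h powr (- real ?D) = h powr (- (3 * real ?D / 2))"
            by (simp add: powr_add[symmetric])
          also have "c3 * c1 * h powr (- (3 * real ?D / 2)) * \<epsilon> powr (- (7/16)) \<le>
              c3 * c1 * h powr (- (3 * real ?D / 2)) * \<epsilon> powr (- (1/2))"
            using \<epsilon> c3 c1 by (intro mult_left_mono powr_mono') auto
          finally show ?thesis by (simp add: mult.assoc)
        qed
        then show "(K * L) powr p \<le> (c3 * c1 * (h powr (- (3 * real ?D / 2)) * \<epsilon> powr (- (1/2)))) powr p"
          using K0 L0 assms(3) by (intro powr_mono2) auto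
      qed (use CH in simp)
      also have "\<dots> = (c3 * c1) powr p * CH * (h powr (- (3 * p * real ?D / 2)) * \<epsilon> powr (- p / 2))"
      proof -
        have "c3 * c1 \<ge> 0" unfolding c3_def using S c2 c1 by simp
        then have "((c3 * c1) * (h powr (- (3 * real ?D / 2)) * \<epsilon> powr (- (1/2)))) powr p =
            (c3 * c1) powr p * ((h powr (- (3 * real ?D / 2))) powr p * (\<epsilon> powr (- (1/2))) powr p)"
          by (simp only: powr_mult powr_ge_zero mult_nonneg_nonneg)
        also have "(h powr (- (3 * real ?D / 2))) powr p = h powr (- (3 * p * real ?D / 2))"
          unfolding powr_powr by (simp add: mult_ac)
        also have "(\<epsilon> powr (- (1/2))) powr p = \<epsilon> powr (- p / 2)"
          unfolding powr_powr by simp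
        finally show ?thesis by (simp only: mult_ac)
      qed
      also have "\<dots> \<le> C * (h powr (- (3 * p * real ?D / 2)) * \<epsilon> powr (- p / 2))"
        unfolding C_def by (intro mult_right_mono) auto
      finally show "L * (K powr p * L powr (p - 1) * CH) \<le>
          C * mesh_size \<T> powr (- (3 * p * real ?D / 2)) * \<epsilon> powr (- p / 2)"
        by (simp only: h_def mult.assoc)
    qed
    finally show ?thesis .
  qed
  show ?thesis
    by (rule exI[of _ C]) (use C main in blast)
qed

end
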